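(* Let $\alpha>0$, and let $\varphi$ and $\psi$ be nonconstant linear fractional self-maps of $\mathbb D$. Then $$\|C_\varphi C_\psi^*\|_{e,\mathcal D_\alpha}^2=\max_{\substack{\xi,\zeta\in\mathbb T\\ \varphi(\xi)=\psi(\zeta)\in\mathbb T}}\bigl(|\varphi'(\xi)|\,|\psi'(\zeta)|\bigr)^{-\alpha},$$ where the maximum is understood to be zero when $\varphi(\mathbb T)\cap\psi(\mathbb T)\cap\mathbb T=\varnothing$.
   Context: $\mathbb D$ is the open unit disk in $\mathbb C$, $\mathbb T$ is the unit circle, and $dA$ is the normalized area measure on $\mathbb D$. For $\alpha>-1$, $dA_\alpha(z)=(1+\alpha)(1-|z|^2)^\alpha\,dA(z)$. The weighted Dirichlet space $\mathcal D_\alpha$ is the Hilbert space of analytic functions $f$ on $\mathbb D$ with $\|f\|_{\mathcal D_\alpha}^2=|f(0)|^2+\int_{\mathbb D}|f'(z)|^2\,dA_\alpha(z)<\infty$, with the associated inner product. A nonconstant linear fractional self-map of $\mathbb D$ is a map $\varphi(z)=\frac{az+b}{cz+d}$ with $ad-bc\neq0$ and $\varphi(\mathbb D)\subset\mathbb D$; it extends analytically to a neighborhood of $\overline{\mathbb D}$, and values and derivatives on $\mathbb T$ are those of this extension. The composition operator is $C_\varphi f=f\circ\varphi$; for such $\varphi$ it is bounded on $\mathcal D_\alpha$. $C_\psi^*$ is the Hilbert space adjoint of $C_\psi$ on $\mathcal D_\alpha$. For a bounded operator $T$ on a Hilbert space $\mathcal H$, the essential norm is $\|T\|_{e,\mathcal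 H}=\inf\{\|T-K\|:K\text{ compact on }\mathcal H\}$. *)

theory Defs
  imports "HOL-Analysis.Analysis"
begin

text \<open>
  A function on the unit disc is represented by the function on the whole plane that
  agrees with it there and vanishes elsewhere; pointwise linear combinations and equality
  of functions on the plane are then those of functions on the disc.
\<close>

definition disc_area :: "complex measure" where
  "disc_area = restrict_space (uniform_measure lborel (ball 0 1)) (ball 0 1)"

definition disc_area_weighted :: "real \<Rightarrow> complex measure" where
  "disc_area_weighted \<alpha> =
     density disc_area (\<lambda>z. ennreal ((1 + \<alpha>) * (1 - (norm z)\<^sup>2) powr \<alpha>))"

definition dirichlet_space :: "real \<Rightarrow> (complex \<Rightarrow> complex) set" where
  "dirichlet_space \<alpha> =
     {f. f holomorphic_on ball 0 1 \<and> (\<forall>z. z \<notin> ball 0 1 \<longrightarrow> f z = 0) \<and>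
         integrable (disc_area_weighted \<alpha>) (\<lambda>z. (norm (deriv f z))\<^sup>2)}"

definition dirichlet_inner ::
    "real \<Rightarrow> (complex \<Rightarrow> complex) \<Rightarrow> (complex \<Rightarrow> complex) \<Rightarrow> complex" where
  "dirichlet_inner \<alpha> f g =
     f 0 * cnj (g 0) + (\<integral>z. deriv f z * cnj (deriv g z) \<partial>disc_area_weighted \<alpha>)"

definition dirichlet_norm :: "real \<Rightarrow> (complex \<Rightarrow> complex) \<Rightarrow> real" where
  "dirichlet_norm \<alpha> f =
     sqrt ((norm (f 0))\<^sup>2 + (\<integral>z. (norm (deriv f z))\<^sup>2 \<partial>disc_area_weighted \<alpha>))"

definition dirichlet_dist ::
    "real \<Rightarrow> (complex \<Rightarrow> complex) \<Rightarrow> (complex \<Rightarrow> complex) \<Rightarrow> real" where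
  "dirichlet_dist \<alpha> f g = dirichlet_norm \<alpha> (\<lambda>z. f z - g z)"

text \<open>
  An operator is a map on all functions of which only the restriction to the space matters.
\<close>

type_synonym operator = "(complex \<Rightarrow> complex) \<Rightarrow> (complex \<Rightarrow> complex)"

definition linear_operator :: "real \<Rightarrow> operator \<Rightarrow> bool" where
  "linear_operator \<alpha> T \<longleftrightarrow>
     T ` dirichlet_space \<alpha> \<subseteq> dirichlet_space \<alpha> \<and>
     (\<forall>f\<in>dirichlet_space \<alpha>. \<forall>g\<in>dirichlet_space \<alpha>. \<forall>a b.
        T (\<lambda>z. a * f z + b * g z) = (\<lambda>z. a * T f z + b * T g z))"

definition operator_norm :: "real \<Rightarrow> operator \<Rightarrow> real" where
  "operator_norm \<alpha> T =
     Sup {dirichlet_norm \<alpha> (T f) |f. f \<in> dirichlet_space \<alpha> \<and> dirichlet_norm \<alpha> f \<le> 1}"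

definition compact_operator :: "real \<Rightarrow> operator \<Rightarrow> bool" where
  "compact_operator \<alpha> K \<longleftrightarrow>
     linear_operator \<alpha> K \<and>
     (let X = Metric_space.mtopology (dirichlet_space \<alpha>) (dirichlet_dist \<alpha>) in
        compactin X
          (X closure_of (K ` {f \<in> dirichlet_space \<alpha>. dirichlet_norm \<alpha> f \<le> 1})))"

definition essential_norm :: "real \<Rightarrow> operator \<Rightarrow> real" where
  "essential_norm \<alpha> T =
     Inf {operator_norm \<alpha> (\<lambda>f z. T f z - K f z) |K. compact_operator \<alpha> K}"

definition adjoint_operator :: "real \<Rightarrow> operator \<Rightarrow> operator" where
  "adjoint_operator \<alpha> T g =
     (THE h. h \<in> dirichlet_space \<alpha> \<and>
        (\<forall>f\<in>dirichlet_space \<alpha>. dirichlet_inner \<alpha> (T f) g = dirichlet_inner \<alpha> f h))"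

definition composition_operator :: "(complex \<Rightarrow> complex) \<Rightarrow> operator" where
  "composition_operator \<phi> f = (\<lambda>z. if z \<in> ball 0 1 then f (\<phi> z) else 0)"

text \<open>
  The condition on the image excludes a pole in the closed disc, since \<open>\<phi>\<close> is unbounded
  on the disc near such a pole; so \<open>\<phi>\<close> is its own analytic extension to a neighbourhood
  of the closed disc.
\<close>

definition linear_fractional_self_map :: "(complex \<Rightarrow> complex) \<Rightarrow> bool" where
  "linear_fractional_self_map \<phi> \<longleftrightarrow>
     (\<exists>a b c d. a * d - b * c \<noteq> 0 \<and> \<phi> = moebius a b c d) \<and> \<phi> ` ball 0 1 \<subseteq> ball 0 1"

end

theory Submission
  imports Defs "HOL-Complex_Analysis.Complex_Analysis" "HOL-Real_Asymp.Real_Asymp"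
begin

text \<open>
  A contact point of \<open>\<phi>\<close> is a point of the circle that \<open>\<phi>\<close> maps to the circle. Write
  \<open>C\<phi>\<close> for composition with \<open>\<phi>\<close> and \<open>m\<close> for the maximum of \<open>(|\<phi>' \<xi>| |\<psi>' \<zeta>|) powr (-\<alpha>/2)\<close>
  over the pairs of contact points with a common image on the circle, or 0 if there are
  no such pairs. Modulo compact operators only the behaviour near the contact points
  matters, and there the Schwarz-Pick lemma governs the weight: \<open>weight z\<close> is at most
  \<open>|\<phi>' z| powr (-\<alpha>)\<close> times \<open>weight (\<phi> z)\<close>.

  Upper estimate. Compact errors are measured on tails, the orthogonal complements of
  the first \<open>N\<close> basis vectors: \<open>ess_le T M\<close> bounds \<open>T\<close> there by \<open>M\<close> up to a small error,
  and \<open>ess_dom A B\<close> says that \<open>A g\<close> is there no longer than \<open>B g\<close> up to a small error.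
  Let \<open>V p\<close> multiply the derivative of a function by the polynomial \<open>p\<close>. By change of
  variables, \<open>C\<psi>\<close> is dominated by \<open>V p\<close> if \<open>|p (\<psi> \<zeta>)|\<close> exceeds \<open>|\<psi>' \<zeta>| powr (-\<alpha>/2)\<close> at
  the contact points of \<open>\<psi>\<close> (\<open>ess_dom_Comp\<close>), and \<open>C\<phi> V p\<close> is bounded by \<open>m + \<epsilon>\<close> on
  tails if \<open>|p (\<phi> \<xi>)| |\<phi>' \<xi>| powr (-\<alpha>/2)\<close> is less than \<open>m + \<epsilon>\<close> at the contact points of
  \<open>\<phi>\<close> (\<open>ess_le_Comp_V\<close>). The two demands on \<open>p\<close> are compatible because they meet only
  where \<open>\<phi> \<xi> = \<psi> \<zeta>\<close>, so one polynomial satisfies both (\<open>separating_polynomial\<close>). Finally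
  \<open>V p\<close> is dominated by its adjoint (\<open>ess_dom_V_adjoint\<close>), since the obstruction is a
  Hankel operator with continuous symbol. Hence \<open>C\<psi> C\<phi>*\<close> is dominated by
  \<open>(V p)* C\<phi>* = (C\<phi> V p)*\<close>, which is bounded by \<open>m + \<epsilon>\<close> on tails; and the adjoint of
  \<open>C\<psi> C\<phi>*\<close> is \<open>C\<phi> C\<psi>*\<close> (\<open>upper_bound\<close>).

  Lower estimate. The space contains functions \<open>kprim w\<close> such that the inner product of
  \<open>f\<close> with \<open>kprim w\<close> is a constant times \<open>f' w\<close>. By the chain rule \<open>C\<psi>*\<close> maps \<open>kprim w\<close>
  to a multiple of \<open>kprim (\<psi> w)\<close>, so the inner products of \<open>C\<phi> C\<psi>* (kprim w)\<close> with
  \<open>kprim v\<close> are explicit (\<open>operator_on_kernels\<close>). Let \<open>w\<close> and \<open>v\<close> approach contact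
  points \<open>\<zeta>\<close> and \<open>\<xi>\<close> with \<open>\<phi> \<xi> = \<psi> \<zeta>\<close> radially, with speeds chosen so that \<open>\<psi> w\<close> and
  \<open>\<phi> v\<close> approach the common image equally fast. For normalized kernels the inner
  products then tend to \<open>(|\<phi>' \<xi>| |\<psi>' \<zeta>|) powr (-\<alpha>/2)\<close>, and since normalized kernels tend
  weakly to 0, no compact perturbation can lower this limit (\<open>lower_bound\<close>).

  The maximum is attained because the pairs of contact points form a compact set.
\<close>

section \<open>Hilbert spaces of functions, and operators modulo compact errors\<close>

text \<open>
  Sequential compactness of a polydisc, the subsequence being refined one coordinate at
  a time. It is the finite-dimensional input to the compactness of finite-rank
  operators.
\<close>

lemma bounded_coefficients_subsequence:
  fixes c :: "nat \<Rightarrow> nat \<Rightarrow> complex"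
  assumes "\<And>k n. n < N \<Longrightarrow> cmod (c k n) \<le> B"
  shows "\<exists>l r. strict_mono (r :: nat \<Rightarrow> nat) \<and> (\<forall>n<N. cmod (l n) \<le> B \<and> (\<lambda>k. c (r k) n) \<longlonglongrightarrow> l n)"
  using assms
proof (induction N)
  case 0
  then show ?case using strict_mono_id by auto
next
  case (Suc N)
  then obtain l r where r: "strict_mono (r :: nat \<Rightarrow> nat)"
    and l: "\<And>n. n < N \<Longrightarrow> cmod (l n) \<le> B \<and> (\<lambda>k. c (r k) n) \<longlonglongrightarrow> l n" by (meson less_SucI)
  have "compact (cball (0::complex) B)" by simp
  moreover have "\<forall>k. c (r k) N \<in> cball 0 B" using Suc.prems by simp
  ultimately obtain a q where a: "a \<in> cball 0 B" and q: "strict_mono q" "((\<lambda>k. c (r k) N) \<circ> q) \<longlonglongrightarrow> a"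
    unfolding compact_def by meson
  have "(\<lambda>k. c (r (q k)) n) \<longlonglongrightarrow> l n" if "n < N" for n
    using LIMSEQ_subseq_LIMSEQ[OF conjunct2[OF l[OF that]] q(1)] by (simp add: o_def)
  then show ?case
    using l a q strict_mono_o[OF r q(1)]
    by (intro exI[of _ "l(N := a)"] exI[of _ "r \<circ> q"]) (auto simp: less_Suc_eq o_def)
qed

text \<open>
  A Hilbert space whose elements are the functions in the set \<open>H\<close>, with an orthonormal
  basis \<open>e\<close>. The Dirichlet space is a set of functions and not a type, which is why the
  space is carried by a set. Completeness is present in the form of \<open>riesz_fischer\<close>:
  bounded partial sums of squares are the coefficients of an element.
\<close>

locale function_hilbert_space =
  fixes H :: "('a \<Rightarrow> complex) set"
    and ip :: "('a \<Rightarrow> complex) \<Rightarrow> ('a \<Rightarrow> complex) \<Rightarrow> complex"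
    and e :: "nat \<Rightarrow> 'a \<Rightarrow> complex"
  assumes lincomb: "\<And>f g a b. f \<in> H \<Longrightarrow> g \<in> H \<Longrightarrow> (\<lambda>z. a * f z + b * g z) \<in> H"
    and ip_lincomb: "\<And>f g h a b. f \<in> H \<Longrightarrow> g \<in> H \<Longrightarrow> h \<in> H \<Longrightarrow>
           ip (\<lambda>z. a * f z + b * g z) h = a * ip f h + b * ip g h"
    and ip_commute: "\<And>f g. f \<in> H \<Longrightarrow> g \<in> H \<Longrightarrow> ip f g = cnj (ip g f)"
    and e_in: "\<And>n. e n \<in> H"
    and e_ortho: "\<And>m n. ip (e m) (e n) = (if m = n then 1 else 0)"
    and parseval: "\<And>f. f \<in> H \<Longrightarrow> (\<lambda>n. (cmod (ip f (e n)))\<^sup>2) sums Re (ip f f)"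
    and ip_definite: "\<And>f. f \<in> H \<Longrightarrow> ip f f = 0 \<Longrightarrow> f = (\<lambda>z. 0)"
    and riesz_fischer: "\<And>c C. (\<And>N. (\<Sum>n<N. (cmod (c n))\<^sup>2) \<le> C) \<Longrightarrow> \<exists>h\<in>H. \<forall>n. ip h (e n) = c n"
begin

definition nrm :: "('a \<Rightarrow> complex) \<Rightarrow> real" where
  "nrm f = sqrt (Re (ip f f))"

lemma zero_in: "(\<lambda>z. 0) \<in> H"
  using lincomb[OF e_in e_in, of 0 0 0 0] by simp

lemma scale_in: "f \<in> H \<Longrightarrow> (\<lambda>z. a * f z) \<in> H"
  using lincomb[of f f a 0] by simp

lemma add_in: "f \<in> H \<Longrightarrow> g \<in> H \<Longrightarrow> (\<lambda>z. f z + g z) \<in> H"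
  using lincomb[of f g 1 1] by simp

lemma diff_in: "f \<in> H \<Longrightarrow> g \<in> H \<Longrightarrow> (\<lambda>z. f z - g z) \<in> H"
  using lincomb[of f g 1 "-1"] by simp

lemma sum_in: "(\<And>i. i \<in> A \<Longrightarrow> f i \<in> H) \<Longrightarrow> (\<lambda>z. \<Sum>i\<in>A. c i * f i z) \<in> H"
proof (induction A rule: infinite_finite_induct)
  case (insert x A)
  then show ?case using lincomb[of "f x" "\<lambda>z. \<Sum>i\<in>A. c i * f i z" "c x" 1] by simp
qed (auto simp: zero_in)

lemma ip_scale: "f \<in> H \<Longrightarrow> h \<in> H \<Longrightarrow> ip (\<lambda>z. a * f z) h = a * ip f h"
  using ip_lincomb[of f f h a 0] by simp

lemma ip_add: "f \<in> H \<Longrightarrow> g \<in> H \<Longrightarrow> h \<in> H \<Longrightarrow> ip (\<lambda>z. f z + g z) h = ip f h + ip g h"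
  using ip_lincomb[of f g h 1 1] by simp

lemma ip_diff: "f \<in> H \<Longrightarrow> g \<in> H \<Longrightarrow> h \<in> H \<Longrightarrow> ip (\<lambda>z. f z - g z) h = ip f h - ip g h"
  using ip_lincomb[of f g h 1 "-1"] by simp

lemma ip_zero: "h \<in> H \<Longrightarrow> ip (\<lambda>z. 0) h = 0"
  using ip_scale[OF zero_in, of h 0] by simp

lemma ip_sum: "(\<And>i. i \<in> A \<Longrightarrow> f i \<in> H) \<Longrightarrow> h \<in> H \<Longrightarrow>
    ip (\<lambda>z. \<Sum>i\<in>A. c i * f i z) h = (\<Sum>i\<in>A. c i * ip (f i) h)"
proof (induction A rule: infinite_finite_induct)
  case (insert x A)
  then show ?case
    using ip_lincomb[of "f x" "\<lambda>z. \<Sum>i\<in>A. c i * f i z" h "c x" 1] sum_in[of A f c] by simp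
qed (auto simp: ip_zero)

lemma ip_scale2: "f \<in> H \<Longrightarrow> h \<in> H \<Longrightarrow> ip h (\<lambda>z. a * f z) = cnj a * ip h f"
  by (subst ip_commute) (auto simp: scale_in ip_scale ip_commute[of h f])

lemma ip_add2: "f \<in> H \<Longrightarrow> g \<in> H \<Longrightarrow> h \<in> H \<Longrightarrow> ip h (\<lambda>z. f z + g z) = ip h f + ip h g"
  by (subst ip_commute) (auto simp: add_in ip_add ip_commute[of h f] ip_commute[of h g])

lemma ip_diff2: "f \<in> H \<Longrightarrow> g \<in> H \<Longrightarrow> h \<in> H \<Longrightarrow> ip h (\<lambda>z. f z - g z) = ip h f - ip h g"
  by (subst ip_commute) (auto simp: diff_in ip_diff ip_commute[of h f] ip_commute[of h g])

lemma ip_self_nonneg: "f \<in> H \<Longrightarrow> 0 \<le> Re (ip f f)"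
  using sums_le[OF _ sums_zero parseval[of f]] by simp

lemma ip_self_real: "f \<in> H \<Longrightarrow> ip f f = of_real (Re (ip f f))"
  using ip_commute[of f f] by (simp add: complex_eq_iff)

lemma nrm_nonneg: "f \<in> H \<Longrightarrow> 0 \<le> nrm f"
  by (simp add: nrm_def ip_self_nonneg)

lemma nrm_sq: "f \<in> H \<Longrightarrow> (nrm f)\<^sup>2 = Re (ip f f)"
  by (simp add: nrm_def ip_self_nonneg)

lemma ip_self: "f \<in> H \<Longrightarrow> ip f f = of_real ((nrm f)\<^sup>2)"
  using ip_self_real by (simp add: nrm_sq)

lemma nrm_eq_0: "f \<in> H \<Longrightarrow> nrm f = 0 \<longleftrightarrow> f = (\<lambda>z. 0)"
  using ip_self[of f] ip_definite[of f] ip_zero[OF zero_in] by (auto simp: nrm_def)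

lemma nrm_e: "nrm (e n) = 1"
  by (simp add: nrm_def e_ortho)

lemma nrm_zero: "nrm (\<lambda>z. 0) = 0"
  using nrm_eq_0[OF zero_in] by simp

lemma nrm_scale: "f \<in> H \<Longrightarrow> nrm (\<lambda>z. a * f z) = cmod a * nrm f"
proof -
  assume f: "f \<in> H"
  have "ip (\<lambda>z. a * f z) (\<lambda>z. a * f z) = (a * cnj a) * ip f f"
    using f by (simp add: ip_scale ip_scale2 scale_in)
  also have "\<dots> = of_real ((cmod a)\<^sup>2 * (nrm f)\<^sup>2)"
    using f by (simp add: ip_self complex_norm_square[symmetric])
  finally have "Re (ip (\<lambda>z. a * f z) (\<lambda>z. a * f z)) = (cmod a * nrm f)\<^sup>2"
    by (simp add: power_mult_distrib)
  then show ?thesis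
    unfolding nrm_def[of "\<lambda>z. a * f z"] using nrm_nonneg[OF f] by simp
qed

lemma nrm_uminus_diff: "f \<in> H \<Longrightarrow> g \<in> H \<Longrightarrow> nrm (\<lambda>z. f z - g z) = nrm (\<lambda>z. g z - f z)"
  using nrm_scale[OF diff_in[of g f], of "-1"] by simp

lemma nrm_diff_sq:
  "f \<in> H \<Longrightarrow> g \<in> H \<Longrightarrow> (nrm (\<lambda>z. f z - g z))\<^sup>2 = (nrm f)\<^sup>2 + (nrm g)\<^sup>2 - 2 * Re (ip f g)"
  by (simp add: nrm_sq diff_in ip_diff ip_diff2 ip_commute[of g f])

lemma nrm_add_sq:
  "f \<in> H \<Longrightarrow> g \<in> H \<Longrightarrow> (nrm (\<lambda>z. f z + g z))\<^sup>2 = (nrm f)\<^sup>2 + (nrm g)\<^sup>2 + 2 * Re (ip f g)"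
  by (simp add: nrm_sq add_in ip_add ip_add2 ip_commute[of g f])

lemma cauchy_schwarz:
  assumes f: "f \<in> H" and g: "g \<in> H" shows "cmod (ip f g) \<le> nrm f * nrm g"
proof (cases "g = (\<lambda>z. 0)")
  case True
  then show ?thesis
    using ip_commute[OF f zero_in] f by (simp add: ip_zero nrm_zero)
next
  case False
  then have pos: "nrm g > 0" using nrm_eq_0 nrm_nonneg g by (metis less_eq_real_def)
  define c where "c = ip f g / of_real ((nrm g)\<^sup>2)"
  have "ip f (\<lambda>z. c * g z) = ip f g * cnj (ip f g) / of_real ((nrm g)\<^sup>2)"
    using ip_scale2[OF g f, of c] by (simp add: c_def)
  also have "\<dots> = of_real ((cmod (ip f g))\<^sup>2 / (nrm g)\<^sup>2)"
    unfolding complex_norm_square[symmetric] by simp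
  finally have "Re (ip f (\<lambda>z. c * g z)) = (cmod (ip f g))\<^sup>2 / (nrm g)\<^sup>2"
    by (simp del: of_real_power of_real_divide)
  moreover have "cmod c * nrm g = cmod (ip f g) / nrm g"
    using pos by (simp add: c_def norm_divide norm_power power2_eq_square norm_mult)
  moreover have "0 \<le> (nrm (\<lambda>z. f z - c * g z))\<^sup>2" by simp
  ultimately have "0 \<le> (nrm f)\<^sup>2 + (cmod (ip f g) / nrm g)\<^sup>2 - 2 * ((cmod (ip f g))\<^sup>2 / (nrm g)\<^sup>2)"
    using nrm_diff_sq[OF f scale_in[OF g], of c] nrm_scale[OF g] by simp
  then have "(cmod (ip f g))\<^sup>2 / (nrm g)\<^sup>2 \<le> (nrm f)\<^sup>2" by (simp add: power_divide)
  then have "(cmod (ip f g))\<^sup>2 \<le> (nrm f * nrm g)\<^sup>2"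
    using pos by (simp add: power_mult_distrib divide_simps)
  then show ?thesis
    using power2_le_imp_le nrm_nonneg f g by (meson mult_nonneg_nonneg)
qed

lemma nrm_triangle:
  assumes f: "f \<in> H" and g: "g \<in> H" shows "nrm (\<lambda>z. f z + g z) \<le> nrm f + nrm g"
proof (rule power2_le_imp_le)
  have "Re (ip f g) \<le> nrm f * nrm g"
    using cauchy_schwarz[OF f g] complex_Re_le_cmod order_trans by blast
  then show "(nrm (\<lambda>z. f z + g z))\<^sup>2 \<le> (nrm f + nrm g)\<^sup>2"
    using f g by (simp add: nrm_add_sq power2_sum)
qed (use f g nrm_nonneg in auto)

lemma nrm_triangle_diff:
  assumes f: "f \<in> H" and g: "g \<in> H" shows "nrm (\<lambda>z. f z - g z) \<le> nrm f + nrm g"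
  using nrm_triangle[OF f scale_in[OF g, of "-1"]] nrm_scale[OF g, of "-1"] by simp

lemma nrm_le_diff:
  assumes f: "f \<in> H" and g: "g \<in> H" shows "nrm f \<le> nrm g + nrm (\<lambda>z. f z - g z)"
  using nrm_triangle[OF g diff_in[OF f g]] by simp

lemma nrm_sum_le: "(\<And>i. i \<in> A \<Longrightarrow> f i \<in> H) \<Longrightarrow>
   nrm (\<lambda>z. \<Sum>i\<in>A. c i * f i z) \<le> (\<Sum>i\<in>A. cmod (c i) * nrm (f i))"
proof (induction A rule: infinite_finite_induct)
  case (insert x A)
  have "nrm (\<lambda>z. c x * f x z + (\<Sum>i\<in>A. c i * f i z))
     \<le> nrm (\<lambda>z. c x * f x z) + nrm (\<lambda>z. \<Sum>i\<in>A. c i * f i z)"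
    using insert.prems by (intro nrm_triangle scale_in sum_in) auto
  then show ?case using insert by (simp add: nrm_scale)
qed (auto simp: nrm_zero)

lemma coeff_eqI:
  assumes "f \<in> H" "g \<in> H" "\<And>n. ip f (e n) = ip g (e n)" shows "f = g"
proof -
  have d: "(\<lambda>z. f z - g z) \<in> H" using assms diff_in by blast
  have "(\<lambda>n. (cmod (ip (\<lambda>z. f z - g z) (e n)))\<^sup>2) = (\<lambda>n. 0)"
    using assms by (simp add: ip_diff e_in)
  then have "Re (ip (\<lambda>z. f z - g z) (\<lambda>z. f z - g z)) = 0"
    using parseval[OF d] by (metis sums_unique2 sums_zero)
  then have "(\<lambda>z. f z - g z) = (\<lambda>z. 0)" using nrm_eq_0[OF d] by (simp add: nrm_def)
  then show ?thesis by (simp add: fun_eq_iff)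
qed

lemma ip_eqI:
  assumes "f \<in> H" "g \<in> H" "\<And>h. h \<in> H \<Longrightarrow> ip h f = ip h g" shows "f = g"
  using assms coeff_eqI e_in ip_commute by metis

text \<open>
  \<open>P N\<close> is the orthogonal projection onto the span of the first \<open>N\<close> basis vectors, and
  \<open>R N\<close> takes the tail. Compact errors of an operator are those that become small on
  tails.
\<close>

definition P :: "nat \<Rightarrow> ('a \<Rightarrow> complex) \<Rightarrow> 'a \<Rightarrow> complex" where
  "P N f = (\<lambda>z. \<Sum>n<N. ip f (e n) * e n z)"

definition R :: "nat \<Rightarrow> ('a \<Rightarrow> complex) \<Rightarrow> 'a \<Rightarrow> complex" where
  "R N f = (\<lambda>z. f z - P N f z)"

lemma P_in: "P N f \<in> H"
  unfolding P_def by (rule sum_in) (rule e_in)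

lemma R_in: "f \<in> H \<Longrightarrow> R N f \<in> H"
  unfolding R_def by (intro diff_in P_in)

lemma ip_sum_e: "ip (\<lambda>z. \<Sum>n<N. c n * e n z) (e k) = (if k < N then c k else 0)"
  by (simp add: ip_sum e_in e_ortho if_distrib[of "\<lambda>x. _ * x"] cong: if_cong)

lemma ip_P: "ip (P N f) (e k) = (if k < N then ip f (e k) else 0)"
  unfolding P_def by (rule ip_sum_e)

lemma ip_R: "f \<in> H \<Longrightarrow> ip (R N f) (e k) = (if k < N then 0 else ip f (e k))"
  by (simp add: R_def ip_diff P_in e_in ip_P)

lemma P_add_R: "f = (\<lambda>z. P N f z + R N f z)"
  by (simp add: R_def)

lemma nrm_P_sq: "(nrm (P N f))\<^sup>2 = (\<Sum>n<N. (cmod (ip f (e n)))\<^sup>2)"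
proof -
  have "(\<lambda>n. (cmod (ip (P N f) (e n)))\<^sup>2) sums (\<Sum>n<N. (cmod (ip (P N f) (e n)))\<^sup>2)"
    by (rule sums_finite) (auto simp: ip_P)
  then show ?thesis using parseval[OF P_in, of N f] by (simp add: sums_unique2 nrm_sq P_in ip_P)
qed

lemma R_R: "f \<in> H \<Longrightarrow> M \<le> N \<Longrightarrow> R M (R N f) = R N f"
  by (rule coeff_eqI) (auto simp: R_in ip_R)

lemma ip_P_R: "f \<in> H \<Longrightarrow> ip (P N g) (R N f) = 0"
proof -
  assume f: "f \<in> H"
  have "ip (e n) (R N f) = 0" if "n < N" for n
    using that f ip_R[OF f, of N n] by (subst ip_commute) (auto simp: e_in R_in)
  then show ?thesis unfolding P_def[of N g] using f by (subst ip_sum) (auto simp: e_in R_in)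
qed

lemma nrm_pythagoras: "f \<in> H \<Longrightarrow> (nrm f)\<^sup>2 = (nrm (P N f))\<^sup>2 + (nrm (R N f))\<^sup>2"
  using nrm_add_sq[OF P_in R_in, of f N f N] P_add_R[of f N] ip_P_R[of f N f] by simp

lemma nrm_P_le: "f \<in> H \<Longrightarrow> nrm (P N f) \<le> nrm f"
  by (rule power2_le_imp_le) (auto simp: nrm_pythagoras[of f N] nrm_nonneg)

lemma nrm_R_le: "f \<in> H \<Longrightarrow> nrm (R N f) \<le> nrm f"
  by (rule power2_le_imp_le) (auto simp: nrm_pythagoras[of f N] nrm_nonneg)

lemma R_tendsto_0: "f \<in> H \<Longrightarrow> (\<lambda>N. nrm (R N f)) \<longlonglongrightarrow> 0"
proof -
  assume f: "f \<in> H"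
  have "(\<lambda>N. (nrm (P N f))\<^sup>2) \<longlonglongrightarrow> (nrm f)\<^sup>2"
    using parseval[OF f] unfolding nrm_P_sq nrm_sq[OF f] sums_def .
  then have "(\<lambda>N. (nrm f)\<^sup>2 - (nrm (P N f))\<^sup>2) \<longlonglongrightarrow> (nrm f)\<^sup>2 - (nrm f)\<^sup>2"
    by (rule tendsto_diff[OF tendsto_const])
  moreover have "(nrm f)\<^sup>2 - (nrm (P N f))\<^sup>2 = (nrm (R N f))\<^sup>2" for N
    using nrm_pythagoras[OF f, of N] by simp
  ultimately have "(\<lambda>N. (nrm (R N f))\<^sup>2) \<longlonglongrightarrow> 0" by simp
  then have "(\<lambda>N. sqrt ((nrm (R N f))\<^sup>2)) \<longlonglongrightarrow> sqrt 0" by (rule tendsto_real_sqrt)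
  then show ?thesis using nrm_nonneg[OF R_in[OF f]] by simp
qed

lemma ip_R_swap: "f \<in> H \<Longrightarrow> g \<in> H \<Longrightarrow> ip (R N f) g = ip f (R N g)"
proof -
  assume f: "f \<in> H" and g: "g \<in> H"
  have "ip (R N f) g = ip (R N f) (P N g) + ip (R N f) (R N g)"
    using f g ip_add2[of "P N g" "R N g" "R N f"] P_add_R[of g N] by (simp add: P_in R_in)
  moreover have "ip f (R N g) = ip (P N f) (R N g) + ip (R N f) (R N g)"
    using f g ip_add[of "P N f" "R N f" "R N g"] P_add_R[of f N] by (simp add: P_in R_in)
  moreover have "ip (R N f) (P N g) = 0"
    using f ip_P_R[OF f, of N g] by (subst ip_commute) (auto simp: R_in P_in)
  ultimately show ?thesis using g by (simp add: ip_P_R)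
qed

definition bounded_op :: "(('a \<Rightarrow> complex) \<Rightarrow> 'a \<Rightarrow> complex) \<Rightarrow> bool" where
  "bounded_op T \<longleftrightarrow> (\<forall>f\<in>H. T f \<in> H) \<and>
     (\<forall>f\<in>H. \<forall>g\<in>H. \<forall>a b. T (\<lambda>z. a * f z + b * g z) = (\<lambda>z. a * T f z + b * T g z)) \<and>
     (\<exists>M. \<forall>f\<in>H. nrm (T f) \<le> M * nrm f)"

definition adjoint_pair where
  "adjoint_pair T S \<longleftrightarrow> bounded_op T \<and> bounded_op S \<and> (\<forall>f\<in>H. \<forall>g\<in>H. ip (T f) g = ip f (S g))"

lemma bounded_opI:
  assumes "\<And>f. f \<in> H \<Longrightarrow> T f \<in> H"
    and "\<And>f g a b. f \<in> H \<Longrightarrow> g \<in> H \<Longrightarrow> T (\<lambda>z. a * f z + b * g z) = (\<lambda>z. a * T f z + b * T g z)"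
    and "\<And>f. f \<in> H \<Longrightarrow> nrm (T f) \<le> M * nrm f"
  shows "bounded_op T"
  using assms unfolding bounded_op_def by blast

lemma bounded_op_in: "bounded_op T \<Longrightarrow> f \<in> H \<Longrightarrow> T f \<in> H"
  by (simp add: bounded_op_def)

lemma bounded_op_lincomb: "bounded_op T \<Longrightarrow> f \<in> H \<Longrightarrow> g \<in> H \<Longrightarrow>
    T (\<lambda>z. a * f z + b * g z) = (\<lambda>z. a * T f z + b * T g z)"
  by (simp add: bounded_op_def)

lemma bounded_op_bound:
  assumes "bounded_op T"
  obtains M where "M > 0" "\<And>f. f \<in> H \<Longrightarrow> nrm (T f) \<le> M * nrm f"
proof -
  obtain M where M: "\<forall>f\<in>H. nrm (T f) \<le> M * nrm f" using assms by (auto simp: bounded_op_def)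
  show ?thesis
  proof (rule that[of "max M 1"])
    fix f assume f: "f \<in> H"
    have "M * nrm f \<le> max M 1 * nrm f" using nrm_nonneg[OF f] by (intro mult_right_mono) auto
    then show "nrm (T f) \<le> max M 1 * nrm f" using M f by force
  qed auto
qed

lemma bounded_op_add: "bounded_op T \<Longrightarrow> f \<in> H \<Longrightarrow> g \<in> H \<Longrightarrow> T (\<lambda>z. f z + g z) = (\<lambda>z. T f z + T g z)"
  using bounded_op_lincomb[of T f g 1 1] by simp

lemma bounded_op_diff: "bounded_op T \<Longrightarrow> f \<in> H \<Longrightarrow> g \<in> H \<Longrightarrow> T (\<lambda>z. f z - g z) = (\<lambda>z. T f z - T g z)"
  using bounded_op_lincomb[of T f g 1 "-1"] by simp

lemma bounded_op_scale: "bounded_op T \<Longrightarrow> f \<in> H \<Longrightarrow> T (\<lambda>z. a * f z) = (\<lambda>z. a * T f z)"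
  using bounded_op_lincomb[of T f f a 0] by simp

lemma bounded_op_sum: "bounded_op T \<Longrightarrow> (\<And>i. i \<in> A \<Longrightarrow> f i \<in> H) \<Longrightarrow>
   T (\<lambda>z. \<Sum>i\<in>A. c i * f i z) = (\<lambda>z. \<Sum>i\<in>A. c i * T (f i) z)"
proof (induction A rule: infinite_finite_induct)
  case (insert x A)
  then show ?case
    using bounded_op_lincomb[of T "f x" "\<lambda>z. \<Sum>i\<in>A. c i * f i z" "c x" 1] sum_in[of A f c] by simp
qed (use bounded_op_scale[OF _ zero_in, of T 0] in auto)

lemma bounded_op_comp:
  assumes T: "bounded_op T" and S: "bounded_op S" shows "bounded_op (\<lambda>f. T (S f))"
proof -
  obtain M1 where M1: "M1 > 0" "\<And>f. f \<in> H \<Longrightarrow> nrm (T f) \<le> M1 * nrm f" using bounded_op_bound[OF T] by blast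
  obtain M2 where M2: "M2 > 0" "\<And>f. f \<in> H \<Longrightarrow> nrm (S f) \<le> M2 * nrm f" using bounded_op_bound[OF S] by blast
  show ?thesis
  proof (rule bounded_opI[where M = "M1 * M2"])
    fix f assume f: "f \<in> H"
    have "nrm (T (S f)) \<le> M1 * nrm (S f)" using M1 bounded_op_in[OF S f] by blast
    also have "\<dots> \<le> M1 * (M2 * nrm f)" using M1 M2 f by (intro mult_left_mono) auto
    finally show "nrm (T (S f)) \<le> M1 * M2 * nrm f" by (simp add: mult.assoc)
  qed (use S T in \<open>auto simp: bounded_op_in bounded_op_lincomb\<close>)
qed

lemma bounded_op_P: "bounded_op (P N)"
proof (rule bounded_opI[where M = 1])
  fix f g a b assume "f \<in> H" "g \<in> H"
  then show "P N (\<lambda>z. a * f z + b * g z) = (\<lambda>z. a * P N f z + b * P N g z)"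
    by (simp add: P_def ip_lincomb e_in sum_distrib_left sum.distrib algebra_simps)
qed (auto simp: P_in nrm_P_le)

text \<open>
  The adjoint is built from the coefficients it must have: that of \<open>S g\<close> at \<open>n\<close> is the
  conjugate of \<open>ip (T (e n)) g\<close>. Applying \<open>T\<close> to the finite combination of basis vectors
  with these same coefficients bounds their partial sums of squares, so \<open>riesz_fischer\<close>
  supplies the vector. The defining identity passes from finite combinations to all of
  \<open>H\<close> because tails tend to 0.
\<close>

lemma adjoint_pair_exists:
  assumes T: "bounded_op T" obtains S where "adjoint_pair T S"
proof -
  obtain M where M: "M > 0" "\<And>f. f \<in> H \<Longrightarrow> nrm (T f) \<le> M * nrm f" using bounded_op_bound[OF T] by blast
  have ex: "\<exists>h\<in>H. \<forall>f\<in>H. ip (T f) g = ip f h" if g: "g \<in> H" for g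
  proof -
    define c where "c n = cnj (ip (T (e n)) g)" for n
    \<comment> \<open>The inner product of \<open>T f\<close> with \<open>g\<close> equals \<open>(nrm f)^2\<close> for this \<open>f\<close>, and it is at most
      \<open>M * nrm f * nrm g\<close>.\<close>
    have "(\<Sum>n<N. (cmod (c n))\<^sup>2) \<le> (M * nrm g)\<^sup>2" for N
    proof -
      define f where "f = (\<lambda>z. \<Sum>n<N. c n * e n z)"
      have fH: "f \<in> H" unfolding f_def by (rule sum_in) (rule e_in)
      have fP: "f = P N f" unfolding P_def by (simp add: f_def ip_sum_e)
      have fn: "(nrm f)\<^sup>2 = (\<Sum>n<N. (cmod (c n))\<^sup>2)"
        by (subst fP, subst nrm_P_sq) (simp add: f_def ip_sum_e)
      have "ip (T f) g = (\<Sum>n<N. c n * cnj (c n))"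
        unfolding f_def c_def using g by (subst bounded_op_sum[OF T]) (auto simp: e_in ip_sum bounded_op_in[OF T])
      also have "\<dots> = of_real ((nrm f)\<^sup>2)"
        by (simp add: fn complex_norm_square del: of_real_power)
      finally have "(nrm f)\<^sup>2 = cmod (ip (T f) g)" by (simp add: norm_power flip: of_real_power)
      also have "\<dots> \<le> nrm (T f) * nrm g" using cauchy_schwarz[OF bounded_op_in[OF T fH] g] .
      also have "\<dots> \<le> M * nrm f * nrm g" using M fH g nrm_nonneg by (intro mult_right_mono) auto
      finally have "nrm f * nrm f \<le> nrm f * (M * nrm g)" by (simp add: power2_eq_square mult_ac)
      then have "nrm f \<le> M * nrm g"
        using nrm_nonneg[OF fH] nrm_nonneg[OF g] M(1) by (cases "nrm f = 0") auto
      then have "(nrm f)\<^sup>2 \<le> (M * nrm g)\<^sup>2" using nrm_nonneg[OF fH] by (intro power_mono) auto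
      then show ?thesis using fn by simp
    qed
    from riesz_fischer[of c, OF this] obtain h where h: "h \<in> H" "\<And>n. ip h (e n) = c n" by blast
    have he: "ip (e n) h = ip (T (e n)) g" for n
      using h(2)[of n] ip_commute[OF e_in[of n] h(1)] by (simp add: c_def)
    have "ip (T f) g = ip f h" if f: "f \<in> H" for f
    proof -
      have PN: "ip (T (P N f)) g = ip (P N f) h" for N
        unfolding P_def using g h he
        by (subst bounded_op_sum[OF T]) (auto simp: e_in ip_sum bounded_op_in[OF T])
      have "cmod (ip (T f) g - ip f h) \<le> (M * nrm g + nrm h) * nrm (R N f)" for N
      proof -
        have RH: "R N f \<in> H" using f R_in by blast
        have "ip f h = ip (P N f) h + ip (R N f) h"
          using ip_add[OF P_in RH h(1), of N f] P_add_R[of f N] by simp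
        moreover have "ip (T f) g = ip (T (P N f)) g + ip (T (R N f)) g"
          using ip_add[OF bounded_op_in[OF T P_in] bounded_op_in[OF T RH] g, of N f]
            bounded_op_add[OF T P_in RH, of N f] P_add_R[of f N] by simp
        ultimately have "ip (T f) g - ip f h = ip (T (R N f)) g - ip (R N f) h" using PN by simp
        then have "cmod (ip (T f) g - ip f h) \<le> cmod (ip (T (R N f)) g) + cmod (ip (R N f) h)"
          by (simp add: norm_triangle_ineq4)
        also have "\<dots> \<le> nrm (T (R N f)) * nrm g + nrm (R N f) * nrm h"
          using cauchy_schwarz[OF bounded_op_in[OF T RH] g] cauchy_schwarz[OF RH h(1)] by linarith
        also have "nrm (T (R N f)) * nrm g \<le> M * nrm (R N f) * nrm g"
          using M RH g nrm_nonneg by (intro mult_right_mono) auto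
        finally show ?thesis by (simp add: algebra_simps)
      qed
      moreover have "(\<lambda>N. (M * nrm g + nrm h) * nrm (R N f)) \<longlonglongrightarrow> (M * nrm g + nrm h) * 0"
        by (intro tendsto_intros R_tendsto_0 f)
      ultimately have "cmod (ip (T f) g - ip f h) \<le> 0"
        by (intro LIMSEQ_le_const[where a = "cmod (ip (T f) g - ip f h)"]) auto
      then show ?thesis by simp
    qed
    then show ?thesis using h by blast
  qed
  then obtain S where S: "\<And>g. g \<in> H \<Longrightarrow> S g \<in> H" "\<And>f g. g \<in> H \<Longrightarrow> f \<in> H \<Longrightarrow> ip (T f) g = ip f (S g)"
    by metis
  have "bounded_op S"
  proof (rule bounded_opI[where M = M])
    fix f assume f: "f \<in> H" then show "S f \<in> H" by (rule S)
    have "(nrm (S f))\<^sup>2 = cmod (ip (T (S f)) f)"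
      using S(2)[OF f S(1)[OF f]] ip_self[OF S(1)[OF f]] by (simp add: norm_power)
    also have "\<dots> \<le> nrm (T (S f)) * nrm f" using cauchy_schwarz[OF bounded_op_in[OF T S(1)[OF f]] f] .
    also have "\<dots> \<le> M * nrm (S f) * nrm f" using M S f nrm_nonneg by (intro mult_right_mono) auto
    finally have "nrm (S f) * nrm (S f) \<le> nrm (S f) * (M * nrm f)" by (simp add: power2_eq_square mult_ac)
    then show "nrm (S f) \<le> M * nrm f"
      using nrm_nonneg[OF S(1)[OF f]] nrm_nonneg[OF f] M(1) by (cases "nrm (S f) = 0") auto
  next
    fix f g a b assume f: "f \<in> H" and g: "g \<in> H"
    show "S (\<lambda>z. a * f z + b * g z) = (\<lambda>z. a * S f z + b * S g z)"
    proof (rule ip_eqI)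
      fix h assume h: "h \<in> H"
      have "ip h (S (\<lambda>z. a * f z + b * g z)) = ip (T h) (\<lambda>z. a * f z + b * g z)"
        using S(2)[OF lincomb[OF f g] h] by simp
      also have "\<dots> = cnj a * ip (T h) f + cnj b * ip (T h) g"
        using f g bounded_op_in[OF T h] by (simp add: ip_add2 scale_in ip_scale2)
      also have "\<dots> = ip h (\<lambda>z. a * S f z + b * S g z)"
        using f g h by (simp add: ip_add2 scale_in ip_scale2 S)
      finally show "ip h (S (\<lambda>z. a * f z + b * g z)) = ip h (\<lambda>z. a * S f z + b * S g z)" .
    qed (use f g S lincomb in auto)
  qed
  then show ?thesis using that[of S] S T by (auto simp: adjoint_pair_def)
qed

lemma adjoint_pair_sym: "adjoint_pair T S \<Longrightarrow> adjoint_pair S T"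
  unfolding adjoint_pair_def using ip_commute bounded_op_in by metis

lemma adjoint_pair_comp:
  "adjoint_pair T S \<Longrightarrow> adjoint_pair T' S' \<Longrightarrow> adjoint_pair (\<lambda>f. T (T' f)) (\<lambda>f. S' (S f))"
  unfolding adjoint_pair_def by (auto simp: bounded_op_comp bounded_op_in)

text \<open>
  A bounded operator followed by a finite-rank projection is compact, hence small on
  tails: the inner product of \<open>T (R N f)\<close> with \<open>e i\<close> is that of \<open>f\<close> with
  \<open>R N (S (e i))\<close>, and each of the finitely many tails \<open>R N (S (e i))\<close> tends to 0.
\<close>

lemma compress_tail_small:
  assumes ad: "adjoint_pair T S" and eps: "\<epsilon> > 0"
  obtains N where "\<And>f. f \<in> H \<Longrightarrow> nrm (P L (T (R N f))) \<le> \<epsilon> * nrm f"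
proof -
  have S: "S (e i) \<in> H" for i using ad e_in bounded_op_in by (auto simp: adjoint_pair_def)
  have "(\<lambda>N. \<Sum>i<L. (nrm (R N (S (e i))))\<^sup>2) \<longlonglongrightarrow> (\<Sum>i<L. 0\<^sup>2)"
    by (intro tendsto_intros R_tendsto_0 S)
  then have "eventually (\<lambda>N. (\<Sum>i<L. (nrm (R N (S (e i))))\<^sup>2) < \<epsilon>\<^sup>2) sequentially"
    using eps by (intro order_tendstoD) auto
  then obtain N where N: "(\<Sum>i<L. (nrm (R N (S (e i))))\<^sup>2) < \<epsilon>\<^sup>2"
    by (auto simp: eventually_sequentially)
  show ?thesis
  proof (rule that[of N])
    fix f assume f: "f \<in> H"
    have "(nrm (P L (T (R N f))))\<^sup>2 = (\<Sum>i<L. (cmod (ip (T (R N f)) (e i)))\<^sup>2)" by (rule nrm_P_sq)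
    also have "\<dots> \<le> (\<Sum>i<L. (nrm f * nrm (R N (S (e i))))\<^sup>2)"
    proof (intro sum_mono power_mono)
      fix i
      have "ip (T (R N f)) (e i) = ip f (R N (S (e i)))"
        using ad f S e_in R_in ip_R_swap by (simp add: adjoint_pair_def)
      then show "cmod (ip (T (R N f)) (e i)) \<le> nrm f * nrm (R N (S (e i)))"
        using cauchy_schwarz[OF f R_in[OF S]] by simp
    qed auto
    also have "\<dots> = (nrm f)\<^sup>2 * (\<Sum>i<L. (nrm (R N (S (e i))))\<^sup>2)"
      by (simp add: power_mult_distrib sum_distrib_left)
    also have "\<dots> \<le> (nrm f)\<^sup>2 * \<epsilon>\<^sup>2" using N by (intro mult_left_mono) auto
    also have "\<dots> = (\<epsilon> * nrm f)\<^sup>2" by (simp add: power_mult_distrib)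
    finally show "nrm (P L (T (R N f))) \<le> \<epsilon> * nrm f"
      by (rule power2_le_imp_le) (use eps nrm_nonneg[OF f] in auto)
  qed
qed

text \<open>
  A bound \<open>M\<close> for the essential norm of \<open>T\<close>, expressed through tails so that compact
  operators need not be mentioned.
\<close>

definition ess_le :: "(('a \<Rightarrow> complex) \<Rightarrow> 'a \<Rightarrow> complex) \<Rightarrow> real \<Rightarrow> bool" where
  "ess_le T M \<longleftrightarrow> (\<forall>\<epsilon>>0. \<exists>N. \<forall>f\<in>H. nrm (T (R N f)) \<le> (M + \<epsilon>) * nrm f)"

text \<open>
  The estimate \<open>nrm (B g) \<le> nrm (Q g)\<close> up to a compact error. It is transitive, passes
  to compositions on the right and transports essential bounds, which is all the
  calculus modulo compact operators that the upper estimate uses.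
\<close>

definition ess_dom where
  "ess_dom B Q \<longleftrightarrow> (\<forall>\<epsilon>>0. \<exists>N. \<forall>f\<in>H. nrm (B (R N f)) \<le> nrm (Q (R N f)) + \<epsilon> * nrm f)"

text \<open>
  An estimate on one tail persists on all later tails, since \<open>R M (R N f) = R N f\<close> for
  \<open>M \<le> N\<close>. The same holds for domination below.
\<close>

lemma ess_leD:
  assumes "ess_le T M" "\<epsilon> > 0"
  obtains N where "\<And>n f. N \<le> n \<Longrightarrow> f \<in> H \<Longrightarrow> nrm (T (R n f)) \<le> (M + \<epsilon>) * nrm (R n f)"
proof -
  obtain N where N: "\<forall>f\<in>H. nrm (T (R N f)) \<le> (M + \<epsilon>) * nrm f" using assms by (auto simp: ess_le_def)
  then have "nrm (T (R n f)) \<le> (M + \<epsilon>) * nrm (R n f)" if "N \<le> n" "f \<in> H" for n f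
    using R_R[OF that(2,1)] R_in[OF that(2)] by metis
  then show ?thesis using that by blast
qed

lemma ess_domD:
  assumes "ess_dom B Q" "\<epsilon> > 0"
  obtains N where "\<And>n f. N \<le> n \<Longrightarrow> f \<in> H \<Longrightarrow> nrm (B (R n f)) \<le> nrm (Q (R n f)) + \<epsilon> * nrm f"
proof -
  obtain N where N: "\<forall>f\<in>H. nrm (B (R N f)) \<le> nrm (Q (R N f)) + \<epsilon> * nrm f"
    using assms by (auto simp: ess_dom_def)
  have "nrm (B (R n f)) \<le> nrm (Q (R n f)) + \<epsilon> * nrm f" if "N \<le> n" "f \<in> H" for n f
  proof -
    have "nrm (B (R n f)) \<le> nrm (Q (R n f)) + \<epsilon> * nrm (R n f)"
      using R_R[OF that(2,1)] R_in[OF that(2)] N by metis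
    moreover have "\<epsilon> * nrm (R n f) \<le> \<epsilon> * nrm f" using nrm_R_le that assms by (intro mult_left_mono) auto
    ultimately show ?thesis by linarith
  qed
  then show ?thesis using that by blast
qed

lemma ess_dom_trans:
  assumes "ess_dom A B" "ess_dom B C" shows "ess_dom A C"
  unfolding ess_dom_def
proof (intro allI impI)
  fix \<epsilon> :: real assume "\<epsilon> > 0"
  then have e2: "\<epsilon> / 2 > 0" by simp
  obtain N1 where N1: "\<And>n f. N1 \<le> n \<Longrightarrow> f \<in> H \<Longrightarrow> nrm (A (R n f)) \<le> nrm (B (R n f)) + \<epsilon>/2 * nrm f"
    using ess_domD[OF assms(1) e2] by blast
  obtain N2 where N2: "\<And>n f. N2 \<le> n \<Longrightarrow> f \<in> H \<Longrightarrow> nrm (B (R n f)) \<le> nrm (C (R n f)) + \<epsilon>/2 * nrm f"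
    using ess_domD[OF assms(2) e2] by blast
  have "nrm (A (R (max N1 N2) f)) \<le> nrm (C (R (max N1 N2) f)) + \<epsilon> * nrm f" if "f \<in> H" for f
    using N1[of "max N1 N2" f] N2[of "max N1 N2" f] that by (simp add: field_simps)
  then show "\<exists>N. \<forall>f\<in>H. nrm (A (R N f)) \<le> nrm (C (R N f)) + \<epsilon> * nrm f" by blast
qed

lemma ess_dom_imp_le:
  assumes "ess_dom A B" "ess_le B M" and M: "0 \<le> M" shows "ess_le A M"
  unfolding ess_le_def
proof (intro allI impI)
  fix \<epsilon> :: real assume eps: "\<epsilon> > 0"
  then have e2: "\<epsilon> / 2 > 0" by simp
  obtain N1 where N1: "\<And>n f. N1 \<le> n \<Longrightarrow> f \<in> H \<Longrightarrow> nrm (A (R n f)) \<le> nrm (B (R n f)) + \<epsilon>/2 * nrm f"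
    using ess_domD[OF assms(1) e2] by blast
  obtain N2 where N2: "\<forall>f\<in>H. nrm (B (R N2 f)) \<le> (M + \<epsilon>/2) * nrm f"
    using assms(2) e2 unfolding ess_le_def by blast
  have "nrm (A (R (max N1 N2) f)) \<le> (M + \<epsilon>) * nrm f" if f: "f \<in> H" for f
  proof -
    let ?n = "max N1 N2"
    have "nrm (B (R ?n f)) \<le> (M + \<epsilon>/2) * nrm (R ?n f)"
      using N2[rule_format, OF R_in[OF f, of ?n]] R_R[OF f, of N2 ?n] by simp
    moreover have "(M + \<epsilon>/2) * nrm (R ?n f) \<le> (M + \<epsilon>/2) * nrm f"
      using nrm_R_le[OF f] eps M by (intro mult_left_mono) auto
    ultimately show ?thesis using N1[of ?n f] f by (simp add: field_simps)
  qed
  then show "\<exists>N. \<forall>f\<in>H. nrm (A (R N f)) \<le> (M + \<epsilon>) * nrm f" by auto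
qed

text \<open>
  The image of a tail under \<open>S\<close> is split at \<open>L\<close>. Its first \<open>L\<close> coordinates are small by
  compactness, and its tail is controlled by duality, because \<open>R L\<close> after \<open>S\<close> is adjoint
  to \<open>T\<close> after \<open>R L\<close>.
\<close>

lemma ess_le_adjoint:
  assumes ad: "adjoint_pair T S" and le: "ess_le T M" and M: "0 \<le> M"
  shows "ess_le S M"
  unfolding ess_le_def
proof (intro allI impI)
  fix \<epsilon> :: real assume eps: "\<epsilon> > 0"
  then have e2: "\<epsilon> / 2 > 0" by simp
  have T: "bounded_op T" and S: "bounded_op S" using ad by (auto simp: adjoint_pair_def)
  obtain L where L: "\<And>n f. L \<le> n \<Longrightarrow> f \<in> H \<Longrightarrow> nrm (T (R n f)) \<le> (M + \<epsilon>/2) * nrm (R n f)"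
    using ess_leD[OF le e2] by blast
  obtain N where N: "\<And>f. f \<in> H \<Longrightarrow> nrm (P L (S (R N f))) \<le> \<epsilon>/2 * nrm f"
    using compress_tail_small[OF adjoint_pair_sym[OF ad] e2] by blast
  have RS: "nrm (R L (S g)) \<le> (M + \<epsilon>/2) * nrm g" if g: "g \<in> H" for g
  proof -
    let ?h = "R L (S g)"
    have h: "?h \<in> H" using R_in bounded_op_in[OF S g] by blast
    have "(nrm ?h)\<^sup>2 = cmod (ip ?h ?h)" using ip_self[OF h] by (simp add: norm_power)
    also have "ip ?h ?h = ip (R L ?h) (S g)"
      using ip_R_swap[OF h bounded_op_in[OF S g], of L] by simp
    also have "\<dots> = ip (T (R L ?h)) g" using ad R_in[OF h] g by (simp add: adjoint_pair_def)
    also have "cmod \<dots> \<le> nrm (T (R L ?h)) * nrm g"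
      using cauchy_schwarz bounded_op_in[OF T R_in[OF h]] g by blast
    also have "\<dots> \<le> (M + \<epsilon>/2) * nrm ?h * nrm g"
      using L[OF order_refl h] R_R[OF bounded_op_in[OF S g] order_refl, of L] nrm_nonneg[OF g]
      by (intro mult_right_mono) auto
    finally have "nrm ?h * nrm ?h \<le> nrm ?h * ((M + \<epsilon>/2) * nrm g)" by (simp add: power2_eq_square mult_ac)
    then show ?thesis using nrm_nonneg[OF h] nrm_nonneg[OF g] M eps by (cases "nrm ?h = 0") auto
  qed
  have "nrm (S (R N f)) \<le> (M + \<epsilon>) * nrm f" if f: "f \<in> H" for f
  proof -
    have Sf: "S (R N f) \<in> H" using bounded_op_in[OF S R_in[OF f]] .
    have "nrm (S (R N f)) \<le> nrm (P L (S (R N f))) + nrm (R L (S (R N f)))"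
      using nrm_triangle[OF P_in R_in[OF Sf], of L "S (R N f)" L] P_add_R[of "S (R N f)" L] by simp
    also have "nrm (R L (S (R N f))) \<le> (M + \<epsilon>/2) * nrm (R N f)" using RS R_in f by blast
    also have "\<dots> \<le> (M + \<epsilon>/2) * nrm f" using nrm_R_le[OF f] M eps by (intro mult_left_mono) auto
    finally show ?thesis using N[OF f] by (simp add: field_simps)
  qed
  then show "\<exists>N. \<forall>f\<in>H. nrm (S (R N f)) \<le> (M + \<epsilon>) * nrm f" by blast
qed

text \<open>
  The image \<open>Y (R N f)\<close> of a tail need not be a tail, but its first \<open>L\<close> coordinates are
  small by compactness, and to the remainder the domination applies.
\<close>

lemma ess_dom_comp:
  assumes dom: "ess_dom B Q" and B: "bounded_op B" and Q: "bounded_op Q" and ad: "adjoint_pair Y Y'"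
  shows "ess_dom (\<lambda>f. B (Y f)) (\<lambda>f. Q (Y f))"
  unfolding ess_dom_def
proof (intro allI impI)
  fix \<epsilon> :: real assume eps: "\<epsilon> > 0"
  have Y: "bounded_op Y" using ad by (simp add: adjoint_pair_def)
  obtain My where My: "My > 0" "\<And>f. f \<in> H \<Longrightarrow> nrm (Y f) \<le> My * nrm f" using bounded_op_bound[OF Y] by blast
  obtain Mb where Mb: "Mb > 0" "\<And>f. f \<in> H \<Longrightarrow> nrm (B f) \<le> Mb * nrm f" using bounded_op_bound[OF B] by blast
  obtain Mq where Mq: "Mq > 0" "\<And>f. f \<in> H \<Longrightarrow> nrm (Q f) \<le> Mq * nrm f" using bounded_op_bound[OF Q] by blast
  define \<delta> where "\<delta> = \<epsilon> / (2 * My)"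
  define \<eta> where "\<eta> = \<epsilon> / (2 * (Mb + Mq))"
  have pos: "\<delta> > 0" "\<eta> > 0" using eps My Mb Mq by (auto simp: \<delta>_def \<eta>_def)
  obtain L where L: "\<And>n f. L \<le> n \<Longrightarrow> f \<in> H \<Longrightarrow> nrm (B (R n f)) \<le> nrm (Q (R n f)) + \<delta> * nrm f"
    using ess_domD[OF dom pos(1)] by blast
  obtain N where N: "\<And>f. f \<in> H \<Longrightarrow> nrm (P L (Y (R N f))) \<le> \<eta> * nrm f"
    using compress_tail_small[OF ad pos(2)] by blast
  have "nrm (B (Y (R N f))) \<le> nrm (Q (Y (R N f))) + \<epsilon> * nrm f" if f: "f \<in> H" for f
  proof -
    define y where "y = Y (R N f)"
    have y: "y \<in> H" using bounded_op_in[OF Y R_in[OF f]] by (simp add: y_def)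
    have Py: "nrm (P L y) \<le> \<eta> * nrm f" using N[OF f] by (simp add: y_def)
    have yn: "nrm y \<le> My * nrm f"
    proof -
      have "nrm y \<le> My * nrm (R N f)" using My R_in f by (simp add: y_def)
      also have "\<dots> \<le> My * nrm f" using nrm_R_le[OF f] My by (intro mult_left_mono) auto
      finally show ?thesis .
    qed
    have "nrm (B y) \<le> nrm (B (P L y)) + nrm (B (R L y))"
      using nrm_triangle[OF bounded_op_in[OF B P_in] bounded_op_in[OF B R_in[OF y]], of L y L]
        bounded_op_add[OF B P_in R_in[OF y], of L y L] P_add_R[of y L] by simp
    also have "nrm (B (R L y)) \<le> nrm (Q (R L y)) + \<delta> * nrm y" using L y by blast
    also have "nrm (Q (R L y)) \<le> nrm (Q y) + nrm (Q (P L y))"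
      using nrm_triangle_diff[OF bounded_op_in[OF Q y] bounded_op_in[OF Q P_in], of L y]
        bounded_op_diff[OF Q y P_in, of L y] by (simp add: R_def)
    finally have "nrm (B y) \<le> nrm (B (P L y)) + (nrm (Q y) + nrm (Q (P L y)) + \<delta> * nrm y)" by simp
    moreover have "nrm (B (P L y)) \<le> Mb * nrm (P L y)" using Mb P_in by blast
    moreover have "nrm (Q (P L y)) \<le> Mq * nrm (P L y)" using Mq P_in by blast
    moreover have "(Mb + Mq) * nrm (P L y) \<le> (Mb + Mq) * (\<eta> * nrm f)"
      using Py Mb Mq by (intro mult_left_mono) auto
    moreover have "\<delta> * nrm y \<le> \<delta> * (My * nrm f)" using yn pos by (intro mult_left_mono) auto
    moreover have "(Mb + Mq) * (\<eta> * nrm f) = \<epsilon>/2 * nrm f" using Mb Mq by (simp add: \<eta>_def field_simps)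
    moreover have "\<delta> * (My * nrm f) = \<epsilon>/2 * nrm f" using My by (simp add: \<delta>_def)
    ultimately have "nrm (B y) \<le> nrm (Q y) + (\<epsilon>/2 * nrm f + \<epsilon>/2 * nrm f)"
      by (simp add: distrib_right)
    then show ?thesis by (simp add: y_def)
  qed
  then show "\<exists>N. \<forall>f\<in>H. nrm (B (Y (R N f))) \<le> nrm (Q (Y (R N f))) + \<epsilon> * nrm f" by blast
qed

text \<open>
  A bounded sequence whose coordinates tend to 0 tends weakly to 0: up to a small tail,
  \<open>y\<close> is a finite combination of basis vectors.
\<close>

lemma ip_tendsto_0I:
  assumes "y \<in> H" "\<And>n. k n \<in> H" "\<And>n. nrm (k n) \<le> 1" "\<And>i. (\<lambda>n. ip (e i) (k n)) \<longlonglongrightarrow> 0"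
  shows "(\<lambda>n. ip y (k n)) \<longlonglongrightarrow> 0"
proof (rule LIMSEQ_I)
  fix r :: real assume r: "r > 0"
  have "eventually (\<lambda>N. nrm (R N y) < r / 2) sequentially"
    using R_tendsto_0[OF assms(1)] r by (intro order_tendstoD) auto
  then obtain N where N: "nrm (R N y) < r / 2" by (auto simp: eventually_sequentially)
  have "(\<lambda>n. ip (P N y) (k n)) \<longlonglongrightarrow> (\<Sum>i<N. ip y (e i) * 0)"
    unfolding P_def ip_sum[OF e_in assms(2)] using assms(4) by (intro tendsto_intros)
  then have "(\<lambda>n. ip (P N y) (k n)) \<longlonglongrightarrow> 0" by simp
  then obtain n0 where n0: "\<And>n. n \<ge> n0 \<Longrightarrow> cmod (ip (P N y) (k n)) < r / 2"
    using LIMSEQ_D[of _ 0 "r/2"] r by (metis diff_zero half_gt_zero)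
  have "cmod (ip y (k n)) < r" if n: "n \<ge> n0" for n
  proof -
    have "ip y (k n) = ip (P N y) (k n) + ip (R N y) (k n)"
      using ip_add[OF P_in R_in[OF assms(1)] assms(2), of N y N n] P_add_R[of y N] by simp
    moreover have "cmod (ip (R N y) (k n)) \<le> nrm (R N y) * nrm (k n)"
      using cauchy_schwarz R_in assms by blast
    moreover have "nrm (R N y) * nrm (k n) \<le> nrm (R N y) * 1"
      using assms nrm_nonneg R_in by (intro mult_left_mono) auto
    ultimately show ?thesis using n0[OF n] N norm_triangle_ineq[of "ip (P N y) (k n)" "ip (R N y) (k n)"]
      by simp
  qed
  then show "\<exists>no. \<forall>n\<ge>no. norm (ip y (k n) - 0) < r" by auto
qed

text \<open>
  The image of the unit ball under \<open>T\<close> after \<open>P N\<close> lies in the set of combinations of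
  \<open>T (e 0), \<dots>, T (e (N - 1))\<close> with coefficients of modulus at most 1, and this set is
  the continuous image of a polydisc.
\<close>

lemma finite_rank_compact:
  assumes ms: "Metric_space H (\<lambda>f g. nrm (\<lambda>z. f z - g z))" and T: "bounded_op T"
  shows "compactin (Metric_space.mtopology H (\<lambda>f g. nrm (\<lambda>z. f z - g z)))
           (Metric_space.mtopology H (\<lambda>f g. nrm (\<lambda>z. f z - g z)) closure_of
              ((\<lambda>f. T (P N f)) ` {f \<in> H. nrm f \<le> 1}))"
proof -
  interpret M: Metric_space H "\<lambda>f g. nrm (\<lambda>z. f z - g z)" by (rule ms)
  define comb where "comb c = (\<lambda>z. \<Sum>n<N. c n * T (e n) z)" for c
  define Q where "Q = comb ` {c. \<forall>n<N. cmod (c n) \<le> 1}"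
  have combH: "comb c \<in> H" for c
    unfolding comb_def by (rule sum_in) (rule bounded_op_in[OF T e_in])
  have Q: "compactin M.mtopology Q"
    unfolding M.compactin_sequentially
  proof (intro conjI allI impI)
    show "Q \<subseteq> H" using combH by (auto simp: Q_def)
    fix \<sigma> :: "nat \<Rightarrow> 'a \<Rightarrow> complex" assume "range \<sigma> \<subseteq> Q"
    then have "\<forall>k. \<exists>c. \<sigma> k = comb c \<and> (\<forall>n<N. cmod (c n) \<le> 1)" by (auto simp: Q_def)
    then obtain c where c: "\<And>k. \<sigma> k = comb (c k)" "\<And>k n. n < N \<Longrightarrow> cmod (c k n) \<le> 1" by metis
    obtain l r where r: "strict_mono (r :: nat \<Rightarrow> nat)"
      and l: "\<And>n. n < N \<Longrightarrow> cmod (l n) \<le> 1" "\<And>n. n < N \<Longrightarrow> (\<lambda>k. c (r k) n) \<longlonglongrightarrow> l n"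
      using bounded_coefficients_subsequence[of N c] c(2) by blast
    have bd: "nrm (\<lambda>z. comb (c (r k)) z - comb l z) \<le> (\<Sum>n<N. cmod (c (r k) n - l n) * nrm (T (e n)))" for k
    proof -
      have "(\<lambda>z. comb (c (r k)) z - comb l z) = (\<lambda>z. \<Sum>n<N. (c (r k) n - l n) * T (e n) z)"
        by (simp add: comb_def sum_subtractf algebra_simps)
      then show ?thesis using nrm_sum_le[of "{..<N}" "\<lambda>n. T (e n)"] bounded_op_in[OF T e_in] by simp
    qed
    have "(\<lambda>k. \<Sum>n<N. cmod (c (r k) n - l n) * nrm (T (e n))) \<longlonglongrightarrow> (\<Sum>n<N. cmod (l n - l n) * nrm (T (e n)))"
      using l by (intro tendsto_intros) auto
    then have lim: "(\<lambda>k. \<Sum>n<N. cmod (c (r k) n - l n) * nrm (T (e n))) \<longlonglongrightarrow> 0" by simp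
    have "(\<lambda>k. nrm (\<lambda>z. comb (c (r k)) z - comb l z)) \<longlonglongrightarrow> 0"
      by (rule tendsto_sandwich[OF _ _ tendsto_const lim])
        (use bd nrm_nonneg[OF diff_in[OF combH combH]] in auto)
    then have "limitin M.mtopology (\<sigma> \<circ> r) (comb l) sequentially"
      using combH by (simp add: M.limitin_metric_dist_null o_def c)
    moreover have "comb l \<in> Q" using l by (auto simp: Q_def)
    ultimately show "\<exists>l r. l \<in> Q \<and> strict_mono r \<and> limitin M.mtopology (\<sigma> \<circ> r) l sequentially"
      using r by blast
  qed
  have sub: "(\<lambda>f. T (P N f)) ` {f \<in> H. nrm f \<le> 1} \<subseteq> Q"
  proof clarify
    fix f assume f: "f \<in> H" "nrm f \<le> 1"
    have "T (P N f) = comb (\<lambda>n. ip f (e n))"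
      unfolding P_def comb_def by (rule bounded_op_sum[OF T]) (rule e_in)
    moreover have "cmod (ip f (e n)) \<le> 1" for n
      using cauchy_schwarz[OF f(1) e_in, of n] f(2) by (simp add: nrm_e)
    ultimately show "T (P N f) \<in> Q" by (auto simp: Q_def)
  qed
  have "closedin M.mtopology Q"
    using compactin_imp_closedin[OF M.Hausdorff_space_mtopology Q] .
  then have "M.mtopology closure_of ((\<lambda>f. T (P N f)) ` {f \<in> H. nrm f \<le> 1}) \<subseteq> Q"
    by (rule closure_of_minimal[OF sub])
  then show ?thesis using closed_compactin[OF Q] closedin_closure_of by blast
qed

lemma compact_image_subsequence:
  assumes ms: "Metric_space H (\<lambda>f g. nrm (\<lambda>z. f z - g z))"
    and K: "compactin (Metric_space.mtopology H (\<lambda>f g. nrm (\<lambda>z. f z - g z)))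
           (Metric_space.mtopology H (\<lambda>f g. nrm (\<lambda>z. f z - g z)) closure_of A)"
    and A: "\<And>n::nat. x n \<in> A" "A \<subseteq> H"
  obtains y r where "y \<in> H" "strict_mono r" "(\<lambda>n. nrm (\<lambda>z. x (r n) z - y z)) \<longlonglongrightarrow> 0"
proof -
  interpret M: Metric_space H "\<lambda>f g. nrm (\<lambda>z. f z - g z)" by (rule ms)
  have "A \<subseteq> M.mtopology closure_of A" using A(2) by (intro closure_of_subset) simp
  then have "range x \<subseteq> M.mtopology closure_of A" using A by blast
  then obtain l r where "strict_mono r" "limitin M.mtopology (x \<circ> r) l sequentially"
    using K unfolding M.compactin_sequentially by blast
  then show ?thesis using that by (auto simp: M.limitin_metric_dist_null o_def)
qed

lemma compact_image_bounded:
  assumes ms: "Metric_space H (\<lambda>f g. nrm (\<lambda>z. f z - g z))"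
    and K: "compactin (Metric_space.mtopology H (\<lambda>f g. nrm (\<lambda>z. f z - g z)))
           (Metric_space.mtopology H (\<lambda>f g. nrm (\<lambda>z. f z - g z)) closure_of A)"
    and A: "A \<subseteq> H"
  obtains C where "\<And>f. f \<in> A \<Longrightarrow> nrm f \<le> C"
proof -
  interpret M: Metric_space H "\<lambda>f g. nrm (\<lambda>z. f z - g z)" by (rule ms)
  have "A \<subseteq> M.mtopology closure_of A" using A by (intro closure_of_subset) simp
  moreover obtain x B where "M.mtopology closure_of A \<subseteq> M.mcball x B"
    using M.compactin_imp_mbounded[OF K] by (auto simp: M.mbounded_def)
  ultimately have sub: "A \<subseteq> M.mcball x B" by blast
  show ?thesis
  proof (rule that[of "nrm x + B"])
    fix f assume "f \<in> A"
    then have "f \<in> H" "x \<in> H" "nrm (\<lambda>z. x z - f z) \<le> B" using sub by (auto simp: M.in_mcball)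
    then show "nrm f \<le> nrm x + B" using nrm_le_diff[of f x] nrm_uminus_diff[of f x] by simp
  qed
qed

end

section \<open>Change of variables for injective holomorphic maps\<close>

text \<open>
  Lebesgue measure of the plane does not depend on reading points as complex numbers or
  as pairs of reals; the pairs give access to Jacobian determinants.
\<close>

lemma distr_complex_of_vec2:
  "distr lborel borel (\<lambda>x::real^2. Complex (x$1) (x$2)) = lborel"
proof (rule lborel_eqI[symmetric])
  have m[measurable]: "(\<lambda>x::real^2. Complex (x$1) (x$2)) \<in> borel_measurable borel"
    unfolding complex_eq_iff Complex_eq by (intro borel_measurable_continuous_onI continuous_intros)
  fix l u :: complex assume lu: "\<And>b. b \<in> Basis \<Longrightarrow> l \<bullet> b \<le> u \<bullet> b"
  have B2: "(Basis :: (real^2) set) = {axis 1 1, axis 2 1}"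
    by (auto simp: Basis_vec_def UNIV_2)
  have ne: "axis 1 1 \<noteq> (axis 2 1 :: real^2)" by (simp add: axis_eq_axis)
  have "(\<lambda>x::real^2. Complex (x$1) (x$2)) -` box l u = box (vector [Re l, Im l]) (vector [Re u, Im u])"
    by (auto simp: box_def Basis_complex_def B2 inner_axis inner_complex_def)
  moreover have "Re l \<le> Re u" "Im l \<le> Im u" using lu[of 1] lu[of \<i>] by (auto simp: Basis_complex_def inner_complex_def)
  ultimately show "emeasure (distr lborel borel (\<lambda>x::real^2. Complex (x$1) (x$2))) (box l u) = ennreal (\<Prod>b\<in>Basis. (u - l) \<bullet> b)"
    by (simp add: emeasure_distr emeasure_lborel_box_eq B2 ne inner_axis Basis_complex_def inner_complex_def complex_eq_iff)
qed simp

text \<open>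
  The Jacobian of a holomorphic map at a point is that of multiplication by its complex
  derivative, which scales area by the squared modulus.
\<close>

lemma abs_det_complex_mult:
  "\<bar>det (matrix (\<lambda>h::real^2. vector [Re (c * Complex (h$1) (h$2)), Im (c * Complex (h$1) (h$2))] :: real^2))\<bar> = (cmod c)\<^sup>2"
proof -
  have "det (matrix (\<lambda>h::real^2. vector [Re (c * Complex (h$1) (h$2)), Im (c * Complex (h$1) (h$2))] :: real^2)) = (cmod c)\<^sup>2"
    by (simp add: det_2 matrix_def axis_def cmod_power2) (simp add: power2_eq_square)
  then show ?thesis by simp
qed

text \<open>
  The area formula. It is proved by transporting the holomorphic map to \<open>real^2\<close>, where
  the Jacobian is the squared modulus of the derivative.
\<close>

lemma emeasure_injective_holomorphic_image:
  assumes S: "open S" and hol: "f holomorphic_on S" and inj: "inj_on f S" and B: "B \<in> sets borel" "B \<subseteq> S"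
    and fin: "bounded (f ` S)" and fB: "f ` B \<in> sets borel"
  shows "emeasure lborel (f ` B) = (\<integral>\<^sup>+z\<in>B. ennreal ((cmod (deriv f z))\<^sup>2) \<partial>lborel)"
proof -
  define C where "C = (\<lambda>x::real^2. Complex (x$1) (x$2))"
  define V where "V = (\<lambda>z. vector [Re z, Im z] :: real^2)"
  have CV: "C (V z) = z" and VC: "V (C x) = x" for z x
    by (simp_all add: C_def V_def vec_eq_iff forall_2)
  have linC: "bounded_linear C" unfolding C_def
    by (intro linear_conv_bounded_linear[THEN iffD1] linearI) (auto simp: complex_eq_iff)
  have linV: "bounded_linear V" unfolding V_def
    by (intro linear_conv_bounded_linear[THEN iffD1] linearI) (auto simp: vec_eq_iff forall_2)
  have mC[measurable]: "C \<in> borel_measurable borel"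
    using linC by (intro borel_measurable_continuous_onI) (simp add: linear_continuous_on)
  define T where "T = C -` B"
  have T: "T \<in> sets borel" unfolding T_def using measurable_sets[OF mC B(1)] by simp
  define g where "g = (\<lambda>x. V (f (C x)))"
  have im: "g ` T = C -` (f ` B)"
    by (auto simp: g_def T_def CV) (metis CV VC image_eqI vimageI2 vimage_eq)
  have imb: "g ` T \<in> sets borel" unfolding im using measurable_sets[OF mC fB] by simp
  have der: "(g has_derivative (\<lambda>h. V (deriv f (C x) * C h))) (at x within T)" if "x \<in> T" for x
  proof -
    have "(f has_field_derivative deriv f (C x)) (at (C x))"
      using holomorphic_derivI[OF hol S] that B by (auto simp: T_def)
    then have "(f has_derivative (*) (deriv f (C x))) (at (C x))" by (simp add: has_field_derivative_def)
    from has_derivative_compose[OF bounded_linear.has_derivative[OF linC has_derivative_ident] this]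
    have "((\<lambda>x. f (C x)) has_derivative (\<lambda>h. deriv f (C x) * C h)) (at x)" by simp
    from bounded_linear.has_derivative[OF linV this] show ?thesis
      unfolding g_def by (rule has_derivative_at_withinI)
  qed
  have injg: "inj_on g T"
  proof (rule inj_onI)
    fix x y assume xy: "x \<in> T" "y \<in> T" "g x = g y"
    then have "f (C x) = f (C y)" unfolding g_def by (metis CV)
    then have "C x = C y" using inj xy B by (auto simp: T_def inj_on_def)
    then show "x = y" by (metis VC)
  qed
  have dist: "distr lborel borel C = lborel" unfolding C_def by (rule distr_complex_of_vec2)
  have em: "emeasure lborel A = emeasure lborel (C -` A)" if "A \<in> sets borel" for A
    using emeasure_distr[of C lborel borel A] that dist by simp
  have "bounded (f ` B)" using fin B bounded_subset by (metis image_mono)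
  then have fin: "emeasure lborel (g ` T) < \<infinity>"
    using em[OF fB] im emeasure_bounded_finite[of "f ` B"] by simp
  have lm: "g ` T \<in> lmeasurable" using fin imb by (simp add: fmeasurable_def)
  have "((\<lambda>x. \<bar>det (matrix (\<lambda>h. V (deriv f (C x) * C h)))\<bar>) has_integral measure lebesgue (g ` T)) T"
    using has_measure_differentiable_image[OF _ der injg, of "measure lebesgue (g ` T)"] T lm by simp
  then have hi: "((\<lambda>x. (cmod (deriv f (C x)))\<^sup>2) has_integral measure lborel (g ` T)) T"
    using imb abs_det_complex_mult by (simp add: C_def V_def)
  have "(\<lambda>z. indicator S z *\<^sub>R deriv f z) \<in> borel_measurable borel"
    using holomorphic_on_imp_continuous_on[OF holomorphic_deriv[OF hol S]] S
    by (simp add: borel_measurable_continuous_on_indicator)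
  then have m: "(\<lambda>z. indicator B z *\<^sub>R (indicator S z *\<^sub>R deriv f z)) \<in> borel_measurable borel"
    using B(1) by measurable
  have ii: "indicator B z *\<^sub>R (indicator S z *\<^sub>R deriv f z) = indicator B z *\<^sub>R deriv f z" for z
    using B by (auto simp: indicator_def)
  have mB[measurable]: "(\<lambda>z. indicator B z *\<^sub>R deriv f z) \<in> borel_measurable borel"
    using m unfolding ii .
  have sqm: "(\<lambda>z. (cmod (indicator B z *\<^sub>R deriv f z))\<^sup>2) \<in> borel_measurable borel"
    using borel_measurable_power[OF measurable_compose[OF mB borel_measurable_norm], of 2] .
  have eq: "ennreal ((cmod (deriv f z))\<^sup>2) * indicator B z = ennreal ((cmod (indicator B z *\<^sub>R deriv f z))\<^sup>2)" for z
    by (simp add: indicator_def)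
  have "((\<lambda>x. (cmod (indicator B (C x) *\<^sub>R deriv f (C x)))\<^sup>2) has_integral measure lborel (g ` T)) UNIV"
    by (rule has_integral_cong[THEN iffD1, OF _ has_integral_restrict_UNIV[THEN iffD2, OF hi]])
       (simp add: T_def)
  then have "(\<integral>\<^sup>+x. ennreal ((cmod (indicator B (C x) *\<^sub>R deriv f (C x)))\<^sup>2) \<partial>lborel) = ennreal (measure lborel (g ` T))"
    by (rule nn_integral_has_integral_lborel[rotated 2])
      (use measurable_compose[OF mC sqm] in simp_all)
  also have "\<dots> = emeasure lborel (g ` T)" using fin by (simp add: emeasure_eq_ennreal_measure)
  also have "\<dots> = emeasure lborel (f ` B)" using em[OF fB] im by simp
  finally have "emeasure lborel (f ` B) = (\<integral>\<^sup>+x. ennreal ((cmod (indicator B (C x) *\<^sub>R deriv f (C x)))\<^sup>2) \<partial>lborel)" by simp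
  also have "\<dots> = (\<integral>\<^sup>+z. ennreal ((cmod (indicator B z *\<^sub>R deriv f z))\<^sup>2) \<partial>distr lborel borel C)"
    using nn_integral_distr[of C lborel borel] measurable_compose[OF sqm measurable_ennreal] by simp
  finally show ?thesis unfolding dist eq .
qed

text \<open>
  Both sides integrate \<open>F\<close>: the left one against the image under \<open>f\<close> of the measure with
  density \<open>|f'|^2\<close>, the right one against Lebesgue measure on \<open>f ` S\<close>. By the area
  formula the two measures agree on Borel sets.
\<close>

lemma nn_integral_holomorphic_substitution:
  assumes S: "open S" and hol: "f holomorphic_on S" and inj: "inj_on f S"
    and fin: "bounded (f ` S)" and F[measurable]: "F \<in> borel_measurable borel"
  shows "(\<integral>\<^sup>+z\<in>S. F (f z) * ennreal ((cmod (deriv f z))\<^sup>2) \<partial>lborel) = (\<integral>\<^sup>+u\<in>f ` S. F u \<partial>lborel)"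
proof -
  \<comment> \<open>Extending \<open>f\<close> by 0 makes it measurable on the whole plane; the density \<open>J\<close> vanishes
    off \<open>S\<close>.\<close>
  define f' where "f' z = (if z \<in> S then f z else 0)" for z
  define J where "J z = ennreal ((cmod (indicator S z *\<^sub>R deriv f z))\<^sup>2)" for z
  have mS[measurable]: "S \<in> sets borel" using S by simp
  have fS: "open (f ` S)" using open_mapping_thm3[OF hol S inj] by simp
  have f'm[measurable]: "f' \<in> borel_measurable borel"
    unfolding f'_def using holomorphic_on_imp_continuous_on[OF hol] mS by (intro borel_measurable_continuous_on_if) auto
  have J0: "(\<lambda>z. indicator S z *\<^sub>R deriv f z) \<in> borel_measurable borel"
    using holomorphic_on_imp_continuous_on[OF holomorphic_deriv[OF hol S]] S
    by (simp add: borel_measurable_continuous_on_indicator)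
  have Jm[measurable]: "J \<in> borel_measurable borel" unfolding J_def using J0 by measurable
  have eqm: "distr (density lborel J) borel f' = density lborel (indicator (f ` S))"
  proof (rule measure_eqI)
    fix A assume "A \<in> sets (distr (density lborel J) borel f')"
    then have A[measurable]: "A \<in> sets borel" by simp
    define B where "B = S \<inter> f' -` A"
    have B: "B \<in> sets borel" "B \<subseteq> S" unfolding B_def using measurable_sets[OF f'm A] mS by auto
    have fB: "f ` B = f ` S \<inter> A" by (auto simp: B_def f'_def)
    have "emeasure (distr (density lborel J) borel f') A = (\<integral>\<^sup>+z. J z * indicator (f' -` A) z \<partial>lborel)"
      using measurable_sets[OF f'm A] by (simp add: emeasure_distr emeasure_density)
    also have "\<dots> = (\<integral>\<^sup>+z\<in>B. ennreal ((cmod (deriv f z))\<^sup>2) \<partial>lborel)"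
      by (intro nn_integral_cong) (auto simp: J_def B_def indicator_def)
    also have "\<dots> = emeasure lborel (f ` S \<inter> A)"
      using emeasure_injective_holomorphic_image[OF S hol inj B fin] fS unfolding fB by simp
    finally show "emeasure (distr (density lborel J) borel f') A = emeasure (density lborel (indicator (f ` S))) A"
      using fS A by (simp add: emeasure_density indicator_inter_arith[symmetric])
  qed simp
  have "(\<integral>\<^sup>+z\<in>S. F (f z) * ennreal ((cmod (deriv f z))\<^sup>2) \<partial>lborel) = (\<integral>\<^sup>+z. J z * F (f' z) \<partial>lborel)"
    by (intro nn_integral_cong) (auto simp: J_def f'_def indicator_def mult.commute)
  also have "\<dots> = (\<integral>\<^sup>+u. F u \<partial>distr (density lborel J) borel f')"
    by (simp add: nn_integral_distr nn_integral_density)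
  also have "\<dots> = (\<integral>\<^sup>+u\<in>f ` S. F u \<partial>lborel)"
    unfolding eqm using fS by (subst nn_integral_density) (auto simp: mult.commute)
  finally show ?thesis .
qed

section \<open>The weighted area measure of the disc\<close>

locale dirichlet =
  fixes \<alpha> :: real
  assumes alpha_pos: "\<alpha> > 0"
begin

abbreviation "\<mu> \<equiv> disc_area_weighted \<alpha>"

text \<open>
  The density of the measure with respect to Lebesgue measure; dividing by \<open>pi\<close>
  normalizes the area of the disc.
\<close>

definition weight :: "complex \<Rightarrow> real" where
  "weight z = (1 + \<alpha>) * (1 - (cmod z)\<^sup>2) powr \<alpha> / pi"

lemma emeasure_unit_disc: "emeasure lborel (ball (0::complex) 1) = ennreal pi"
proof -
  have "measure lborel (ball (0::complex) 1) = pi"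
    using content_ball[of 1 "0::complex"] by (simp add: unit_ball_vol_numeral unit_ball_vol_2)
  then show ?thesis
    using emeasure_bounded_finite[of "ball (0::complex) 1"] by (simp add: emeasure_eq_ennreal_measure less_top)
qed

lemma sets_mu: "sets \<mu> = sets (restrict_space borel (ball 0 1))"
  unfolding disc_area_weighted_def disc_area_def
  by (simp cong: sets_restrict_space_cong)

lemma space_mu: "space \<mu> = ball 0 1"
  using sets_eq_imp_space_eq[OF sets_mu] by (simp add: space_restrict_space)

lemma measurable_mu: "borel_measurable \<mu> = borel_measurable (restrict_space borel (ball 0 1))"
  by (rule measurable_cong_sets) (auto simp: sets_mu)

lemma weight_nonneg: "0 \<le> weight z"
  using alpha_pos by (simp add: weight_def)

lemma weight_measurable[measurable]: "weight \<in> borel_measurable borel"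
  unfolding weight_def by measurable

text \<open>
  The measure is built by normalizing, restricting and weighting. This lemma reduces
  integration against it to Lebesgue measure once and for all.
\<close>

lemma nn_integral_mu:
  assumes f: "f \<in> borel_measurable \<mu>"
  shows "(\<integral>\<^sup>+z. f z \<partial>\<mu>) = (\<integral>\<^sup>+z\<in>ball 0 1. f z * ennreal (weight z) \<partial>lborel)"
proof -
  have sd: "sets disc_area = sets (restrict_space borel (ball 0 1))"
    unfolding disc_area_def by (simp cong: sets_restrict_space_cong)
  have fd[measurable]: "f \<in> borel_measurable disc_area"
    using f unfolding measurable_mu by (subst measurable_cong_sets[OF sd refl])
  let ?w = "\<lambda>z::complex. ennreal ((1 + \<alpha>) * (1 - (norm z)\<^sup>2) powr \<alpha>)"
  have wb[measurable]: "?w \<in> borel_measurable borel" by measurable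
  have wd: "?w \<in> borel_measurable disc_area"
    by (subst measurable_cong_sets[OF sd refl]) (intro measurable_restrict_space1 wb)
  have fi[measurable]: "(\<lambda>z. f z * indicator (ball 0 1) z) \<in> borel_measurable borel"
    using f unfolding measurable_mu by (subst (asm) borel_measurable_restrict_space_iff_ennreal) auto
  have mlb: "(\<lambda>z. ?w z * (f z * indicator (ball 0 1) z)) \<in> borel_measurable lborel"
    using borel_measurable_times_ennreal[OF wb fi] unfolding measurable_lborel2 .
  have "(\<integral>\<^sup>+z. f z \<partial>\<mu>) = (\<integral>\<^sup>+z. ?w z * f z \<partial>disc_area)"
    unfolding disc_area_weighted_def using wd fd by (rule nn_integral_density)
  also have "\<dots> = (\<integral>\<^sup>+z. (?w z * f z) * indicator (ball 0 1) z \<partial>uniform_measure lborel (ball 0 1))"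
    unfolding disc_area_def by (rule nn_integral_restrict_space) simp
  also have "\<dots> = (\<integral>\<^sup>+z. ?w z * (f z * indicator (ball 0 1) z) \<partial>uniform_measure lborel (ball 0 1))"
    by (simp add: mult.assoc)
  also have "\<dots> = (\<integral>\<^sup>+z. ?w z * (f z * indicator (ball 0 1) z) * indicator (ball 0 1) z \<partial>lborel) / ennreal pi"
    using nn_integral_uniform_measure[OF mlb, of "ball 0 1"] by (simp add: emeasure_unit_disc)
  also have "\<dots> = (\<integral>\<^sup>+z. ?w z * (f z * indicator (ball 0 1) z) * indicator (ball 0 1) z / ennreal pi \<partial>lborel)"
    by (intro nn_integral_divide[symmetric] borel_measurable_times_ennreal[OF mlb] borel_measurable_indicator) simp
  also have "\<dots> = (\<integral>\<^sup>+z\<in>ball 0 1. f z * ennreal (weight z) \<partial>lborel)"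
  proof (rule nn_integral_cong)
    fix z :: complex
    have "ennreal (weight z) = ?w z / ennreal pi"
      unfolding weight_def using alpha_pos by (subst divide_ennreal) auto
    then show "?w z * (f z * indicator (ball 0 1) z) * indicator (ball 0 1) z / ennreal pi = f z * ennreal (weight z) * indicator (ball 0 1) z"
      by (simp add: indicator_def ennreal_times_divide mult.commute)
  qed
  finally show ?thesis .
qed

lemma borel_imp_mu: "f \<in> borel_measurable borel \<Longrightarrow> f \<in> borel_measurable \<mu>"
  unfolding measurable_mu by (rule measurable_restrict_space1)

lemma continuous_imp_mu:
  fixes f :: "complex \<Rightarrow> 'b::topological_space"
  shows "continuous_on (ball 0 1) f \<Longrightarrow> f \<in> borel_measurable \<mu>"
  unfolding measurable_mu by (rule borel_measurable_continuous_on_restrict)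

lemma holomorphic_imp_mu: "f holomorphic_on ball 0 1 \<Longrightarrow> f \<in> borel_measurable \<mu>"
  by (intro continuous_imp_mu holomorphic_on_imp_continuous_on)

lemma extend_measurable:
  fixes H :: "complex \<Rightarrow> ennreal"
  assumes "H \<in> borel_measurable \<mu>"
  shows "(\<lambda>z. H z * indicator (ball 0 1) z) \<in> borel_measurable borel"
  using assms unfolding measurable_mu by (subst (asm) borel_measurable_restrict_space_iff_ennreal) auto

lemma measurable_self_map:
  assumes hol: "f holomorphic_on ball 0 1" and im: "f ` ball 0 1 \<subseteq> ball 0 1"
  shows "f \<in> measurable \<mu> \<mu>"
proof -
  have "f \<in> measurable \<mu> (restrict_space borel (ball 0 1))"
    using holomorphic_imp_mu[OF hol] im by (intro measurable_restrict_space2) (auto simp: space_mu)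
  then show ?thesis by (subst measurable_cong_sets[OF refl sets_mu])
qed

text \<open>
  The change of variables produces the weight at \<open>z\<close>, while the measure supplies the
  weight at \<open>f z\<close>; the function \<open>b\<close> of the image point records their quotient.
\<close>

lemma nn_integral_mu_substitution:
  assumes hol: "f holomorphic_on ball 0 1" and inj: "inj_on f (ball 0 1)" and im: "f ` ball 0 1 \<subseteq> ball 0 1"
    and H: "H \<in> borel_measurable \<mu>" and b[measurable]: "b \<in> borel_measurable borel"
    and wb: "\<And>z. z \<in> ball 0 1 \<Longrightarrow> ennreal (weight z) = b (f z) * ennreal (weight (f z))"
  shows "(\<integral>\<^sup>+z. ennreal ((cmod (deriv f z))\<^sup>2) * H (f z) \<partial>\<mu>) = (\<integral>\<^sup>+u. b u * H u * indicator (f ` ball 0 1) u \<partial>\<mu>)"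
proof -
  define F where "F u = b u * (H u * indicator (ball 0 1) u) * ennreal (weight u)" for u
  have F: "F \<in> borel_measurable borel"
    using borel_measurable_times_ennreal[OF borel_measurable_times_ennreal[OF b extend_measurable[OF H]]
        measurable_compose[OF weight_measurable measurable_ennreal]]
    by (simp add: F_def[abs_def])
  have bd: "bounded (f ` ball 0 1)" using im bounded_ball bounded_subset by blast
  have op: "open (f ` ball 0 1)" using open_mapping_thm3[OF hol _ inj] by simp
  have "(\<lambda>z. H (f z)) \<in> borel_measurable \<mu>"
    using measurable_compose[OF measurable_self_map[OF hol im] H] .
  moreover have "(\<lambda>z. deriv f z) \<in> borel_measurable \<mu>"
    by (intro holomorphic_imp_mu holomorphic_deriv hol) simp
  ultimately have "(\<integral>\<^sup>+z. ennreal ((cmod (deriv f z))\<^sup>2) * H (f z) \<partial>\<mu>)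
      = (\<integral>\<^sup>+z\<in>ball 0 1. ennreal ((cmod (deriv f z))\<^sup>2) * H (f z) * ennreal (weight z) \<partial>lborel)"
    by (intro nn_integral_mu) measurable
  also have "\<dots> = (\<integral>\<^sup>+z\<in>ball 0 1. F (f z) * ennreal ((cmod (deriv f z))\<^sup>2) \<partial>lborel)"
    using im wb by (intro nn_integral_cong) (auto simp: F_def indicator_def image_subset_iff mult_ac)
  also have "\<dots> = (\<integral>\<^sup>+u\<in>f ` ball 0 1. F u \<partial>lborel)"
    by (rule nn_integral_holomorphic_substitution[OF _ hol inj bd F]) simp
  also have "\<dots> = (\<integral>\<^sup>+u\<in>ball 0 1. b u * H u * indicator (f ` ball 0 1) u * ennreal (weight u) \<partial>lborel)"
    using im by (intro nn_integral_cong) (auto simp: F_def indicator_def image_subset_iff mult_ac)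
  also have "\<dots> = (\<integral>\<^sup>+u. b u * H u * indicator (f ` ball 0 1) u \<partial>\<mu>)"
    using op H borel_imp_mu[OF b]
    by (intro nn_integral_mu[symmetric] borel_measurable_times_ennreal borel_imp_mu[OF borel_measurable_indicator]) auto
  finally show ?thesis .
qed

text \<open>
  The one-sided version, for maps whose quotient of weights is only bounded. The factor
  \<open>g\<close> is a function of the image point that multiplies the integrand, and \<open>b\<close> bounds the
  quotient after multiplication by \<open>g\<close>.
\<close>

lemma nn_integral_mu_substitution_le:
  assumes hol: "f holomorphic_on ball 0 1" and inj: "inj_on f (ball 0 1)" and im: "f ` ball 0 1 \<subseteq> ball 0 1"
    and H: "H \<in> borel_measurable \<mu>" and b[measurable]: "b \<in> borel_measurable borel"
    and g[measurable]: "g \<in> borel_measurable borel"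
    and wb: "\<And>z. z \<in> ball 0 1 \<Longrightarrow> g (f z) * ennreal (weight z) \<le> b (f z) * ennreal (weight (f z))"
  shows "(\<integral>\<^sup>+z. ennreal ((cmod (deriv f z))\<^sup>2) * (g (f z) * H (f z)) \<partial>\<mu>) \<le> (\<integral>\<^sup>+u. b u * H u \<partial>\<mu>)"
proof -
  define F where "F u = b u * (H u * indicator (ball 0 1) u) * ennreal (weight u)" for u
  have F: "F \<in> borel_measurable borel"
    using borel_measurable_times_ennreal[OF borel_measurable_times_ennreal[OF b extend_measurable[OF H]]
        measurable_compose[OF weight_measurable measurable_ennreal]]
    by (simp add: F_def[abs_def])
  have bd: "bounded (f ` ball 0 1)" using im bounded_ball bounded_subset by blast
  have "(\<lambda>z. g (f z) * H (f z)) \<in> borel_measurable \<mu>"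
    by (rule borel_measurable_times_ennreal[OF measurable_compose[OF holomorphic_imp_mu[OF hol] g]
          measurable_compose[OF measurable_self_map[OF hol im] H]])
  moreover have "(\<lambda>z. ennreal ((cmod (deriv f z))\<^sup>2)) \<in> borel_measurable \<mu>"
  proof -
    have "deriv f \<in> borel_measurable \<mu>" by (intro holomorphic_imp_mu holomorphic_deriv hol) simp
    then show ?thesis by measurable
  qed
  ultimately have "(\<integral>\<^sup>+z. ennreal ((cmod (deriv f z))\<^sup>2) * (g (f z) * H (f z)) \<partial>\<mu>)
      = (\<integral>\<^sup>+z\<in>ball 0 1. ennreal ((cmod (deriv f z))\<^sup>2) * (g (f z) * H (f z)) * ennreal (weight z) \<partial>lborel)"
    by (intro nn_integral_mu) (rule borel_measurable_times_ennreal)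
  also have "\<dots> \<le> (\<integral>\<^sup>+z\<in>ball 0 1. F (f z) * ennreal ((cmod (deriv f z))\<^sup>2) \<partial>lborel)"
  proof (rule nn_integral_mono)
    fix z :: complex
    have "ennreal ((cmod (deriv f z))\<^sup>2) * H (f z) * (g (f z) * ennreal (weight z))
        \<le> ennreal ((cmod (deriv f z))\<^sup>2) * H (f z) * (b (f z) * ennreal (weight (f z)))" if "z \<in> ball 0 1"
      using wb[OF that] by (rule mult_left_mono) simp
    then show "ennreal ((cmod (deriv f z))\<^sup>2) * (g (f z) * H (f z)) * ennreal (weight z) * indicator (ball 0 1) z
        \<le> F (f z) * ennreal ((cmod (deriv f z))\<^sup>2) * indicator (ball 0 1) z"
      using im by (auto simp: F_def indicator_def image_subset_iff mult_ac)
  qed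
  also have "\<dots> = (\<integral>\<^sup>+u\<in>f ` ball 0 1. F u \<partial>lborel)"
    by (rule nn_integral_holomorphic_substitution[OF _ hol inj bd F]) simp
  also have "\<dots> \<le> (\<integral>\<^sup>+u\<in>ball 0 1. b u * H u * ennreal (weight u) \<partial>lborel)"
    using im by (intro nn_integral_mono) (auto simp: F_def indicator_def)
  also have "\<dots> = (\<integral>\<^sup>+u. b u * H u \<partial>\<mu>)"
    using H borel_imp_mu[OF b] by (intro nn_integral_mu[symmetric] borel_measurable_times_ennreal) auto
  finally show ?thesis .
qed

lemma emeasure_mu_finite: "emeasure \<mu> (space \<mu>) < \<infinity>"
proof -
  have "emeasure \<mu> (space \<mu>) = (\<integral>\<^sup>+z. 1 \<partial>\<mu>)" by simp
  also have "\<dots> = (\<integral>\<^sup>+z\<in>ball 0 1. 1 * ennreal (weight z) \<partial>lborel)" by (rule nn_integral_mu) simp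
  also have "\<dots> \<le> (\<integral>\<^sup>+z. ennreal ((1 + \<alpha>) / pi) * indicator (ball (0::complex) 1) z \<partial>lborel)"
  proof (rule nn_integral_mono)
    fix z :: complex
    have "weight z \<le> (1 + \<alpha>) / pi" if "z \<in> ball 0 1"
    proof -
      have "(1 - (cmod z)\<^sup>2) powr \<alpha> \<le> 1 powr \<alpha>"
        using that alpha_pos power_le_one[of "cmod z" 2] by (intro powr_mono2) auto
      then show ?thesis using alpha_pos by (simp add: weight_def divide_simps)
    qed
    then show "1 * ennreal (weight z) * indicator (ball 0 1) z \<le> ennreal ((1 + \<alpha>) / pi) * indicator (ball 0 1) z"
      by (auto simp: indicator_def intro!: ennreal_leI)
  qed
  also have "\<dots> = ennreal ((1 + \<alpha>) / pi) * emeasure lborel (ball (0::complex) 1)"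
    by (subst nn_integral_cmult_indicator) auto
  also have "\<dots> < \<infinity>" by (simp add: emeasure_unit_disc ennreal_mult_less_top)
  finally show ?thesis .
qed

sublocale finite_measure \<mu>
  using emeasure_mu_finite by (intro finite_measureI) auto

lemma nn_integral_mu_rotate:
  assumes c: "cmod c = 1" and H: "H \<in> borel_measurable \<mu>"
  shows "(\<integral>\<^sup>+z. H (c * z) \<partial>\<mu>) = (\<integral>\<^sup>+z. H z \<partial>\<mu>)"
proof -
  have im: "(*) c ` ball 0 1 = ball 0 1"
  proof (intro equalityI subsetI)
    fix z :: complex assume "z \<in> ball 0 1"
    then have "z / c \<in> ball 0 1" "z = c * (z / c)" using c by (auto simp: norm_divide)
    then show "z \<in> (*) c ` ball 0 1" by blast
  qed (use c in \<open>auto simp: norm_mult\<close>)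
  have "inj_on ((*) c) (ball 0 1)" using c by (auto intro!: inj_onI)
  moreover have "deriv ((*) c) z = c" for z by (rule DERIV_imp_deriv) (auto intro!: derivative_eq_intros)
  moreover have "(*) c holomorphic_on ball 0 1" by (intro holomorphic_intros)
  ultimately have "(\<integral>\<^sup>+z. ennreal ((cmod c)\<^sup>2) * H (c * z) \<partial>\<mu>) = (\<integral>\<^sup>+u. 1 * H u * indicator (ball 0 1) u \<partial>\<mu>)"
    using nn_integral_mu_substitution[of "(*) c" H "\<lambda>_. 1"] im H c by (simp add: weight_def norm_mult)
  also have "\<dots> = (\<integral>\<^sup>+z. H z \<partial>\<mu>)" by (intro nn_integral_cong) (simp add: space_mu)
  finally show ?thesis using c by simp
qed

text \<open>
  If the identity of integrals holds for nonnegative functions, then the image under \<open>t\<close>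
  of the measure with density \<open>J\<close> is \<open>\<mu>\<close> itself, and complex integrals transform in the
  same way.
\<close>

lemma integral_mu_transport:
  assumes t: "t \<in> measurable \<mu> \<mu>" and J: "J \<in> borel_measurable \<mu>" "\<And>z. J z \<ge> 0"
    and eq: "\<And>H. H \<in> borel_measurable \<mu> \<Longrightarrow> (\<integral>\<^sup>+z. ennreal (J z) * H (t z) \<partial>\<mu>) = (\<integral>\<^sup>+z. H z \<partial>\<mu>)"
    and G: "G \<in> borel_measurable \<mu>"
  shows "(\<integral>z. G z \<partial>\<mu>) = (\<integral>z. complex_of_real (J z) * G (t z) \<partial>\<mu>)"
proof -
  have "distr (density \<mu> J) \<mu> t = \<mu>"
  proof (rule measure_eqI)
    fix A assume "A \<in> sets (distr (density \<mu> J) \<mu> t)"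
    then have A: "A \<in> sets \<mu>" by simp
    have "emeasure (distr (density \<mu> J) \<mu> t) A = (\<integral>\<^sup>+z. ennreal (J z) * indicator (t -` A \<inter> space \<mu>) z \<partial>\<mu>)"
      using A t J measurable_sets[OF t A] by (simp add: emeasure_distr emeasure_density)
    also have "\<dots> = (\<integral>\<^sup>+z. ennreal (J z) * indicator A (t z) \<partial>\<mu>)"
      by (intro nn_integral_cong) (auto simp: indicator_def)
    also have "\<dots> = emeasure \<mu> A" using A by (subst eq) auto
    finally show "emeasure (distr (density \<mu> J) \<mu> t) A = emeasure \<mu> A" .
  qed simp
  then have "(\<integral>z. G z \<partial>\<mu>) = (\<integral>z. G z \<partial>distr (density \<mu> J) \<mu> t)" by simp
  also have "\<dots> = (\<integral>z. G (t z) \<partial>density \<mu> J)" using t G by (intro integral_distr) auto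
  also have "\<dots> = (\<integral>z. J z *\<^sub>R G (t z) \<partial>\<mu>)"
    using J measurable_compose[OF t G] by (intro integral_density) auto
  finally show ?thesis by (simp add: scaleR_conv_of_real)
qed

lemma integral_mu_rotate:
  assumes c: "cmod c = 1" and G: "G \<in> borel_measurable \<mu>"
  shows "(\<integral>z. G (c * z) \<partial>\<mu>) = (\<integral>z. (G z :: complex) \<partial>\<mu>)"
proof -
  have "(*) c \<in> measurable \<mu> \<mu>"
    using c by (intro measurable_self_map) (auto intro!: holomorphic_intros simp: norm_mult)
  from integral_mu_transport[OF this, of "\<lambda>_. 1" G] G show ?thesis
    using nn_integral_mu_rotate[OF c] by simp
qed

text \<open>
  Rotation by \<open>c\<close> preserves the integral and multiplies the integrand by
  \<open>c ^ m * cnj (c ^ n)\<close>. For the angle \<open>pi / (m - n)\<close> this factor is -1, so the integral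
  is its own negative. Smaller discs are included because power series will first be
  integrated over them.
\<close>

lemma monomials_orthogonal:
  assumes "m \<noteq> n"
  shows "(\<integral>z. indicator (ball 0 \<rho>) z * (z ^ m * cnj (z ^ n)) \<partial>\<mu>) = (0::complex)"
proof -
  define G where "G z = indicator (ball 0 \<rho>) z * (z ^ m * cnj (z ^ n))" for z :: complex
  define I where "I = (\<integral>z. G z \<partial>\<mu>)"
  define c where "c = cis (pi / (real m - real n))"
  have c1: "cmod c = 1" by (simp add: c_def)
  have "cnj (c ^ n) = cis (- (real n * (pi / (real m - real n))))"
    using cis_cnj[of "real n * (pi / (real m - real n))"] by (simp only: c_def Complex.DeMoivre)
  then have "c ^ m * cnj (c ^ n) = cis (real m * (pi / (real m - real n)) - real n * (pi / (real m - real n)))"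
    by (simp only: c_def Complex.DeMoivre cis_mult diff_conv_add_uminus)
  also have "real m * (pi / (real m - real n)) - real n * (pi / (real m - real n)) = pi"
    using assms by (simp add: divide_simps) (simp add: algebra_simps)
  finally have cc: "c ^ m * cnj (c ^ n) = -1" by simp
  have "continuous_on UNIV (\<lambda>z::complex. z ^ m * cnj (z ^ n))" by (intro continuous_intros)
  then have Gm: "G \<in> borel_measurable \<mu>" unfolding G_def
    by (intro borel_imp_mu borel_measurable_times borel_measurable_indicator borel_measurable_continuous_onI) auto
  have "G (c * z) = (c ^ m * cnj (c ^ n)) * G z" for z
    using c1 by (simp add: G_def indicator_def norm_mult power_mult_distrib)
  then have "G (c * z) = - G z" for z unfolding cc by simp
  then have "I = - I" unfolding I_def using integral_mu_rotate[OF c1 Gm] by simp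
  then show ?thesis by (simp add: I_def G_def)
qed

section \<open>Power series and the weighted area measure\<close>

text \<open>
  The squared norm of \<open>z ^ n\<close> over the disc of radius \<open>\<rho>\<close>.
\<close>

definition moment :: "real \<Rightarrow> nat \<Rightarrow> real" where
  "moment \<rho> n = (\<integral>z. indicator (ball 0 \<rho>) z * (cmod z) ^ (2 * n) \<partial>\<mu>)"

lemma integrable_bounded_mu:
  fixes f :: "complex \<Rightarrow> 'b::{banach,second_countable_topology}"
  assumes "f \<in> borel_measurable \<mu>" "\<And>z. z \<in> ball 0 1 \<Longrightarrow> norm (f z) \<le> B"
  shows "integrable \<mu> f"
  by (rule integrable_const_bound[where B = B]) (use assms in \<open>auto simp: space_mu intro!: AE_I2\<close>)

lemma indicator_ball_mu[measurable]: "indicator (ball (0::complex) \<rho>) \<in> borel_measurable \<mu>"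
  by (intro borel_imp_mu borel_measurable_indicator) simp

lemma integrable_monomials:
  "integrable \<mu> (\<lambda>z. indicator (ball 0 \<rho>) z * (z ^ m * cnj (z ^ n)))"
proof (rule integrable_bounded_mu[where B = 1])
  have "continuous_on UNIV (\<lambda>z::complex. z ^ m * cnj (z ^ n))" by (intro continuous_intros)
  then have "(\<lambda>z::complex. z ^ m * cnj (z ^ n)) \<in> borel_measurable \<mu>"
    by (intro borel_imp_mu borel_measurable_continuous_onI)
  then show "(\<lambda>z::complex. indicator (ball 0 \<rho>) z * (z ^ m * cnj (z ^ n))) \<in> borel_measurable \<mu>"
    by (rule borel_measurable_times[OF indicator_ball_mu])
  show "cmod (indicator (ball 0 \<rho>) z * (z ^ m * cnj (z ^ n))) \<le> 1" if "z \<in> ball 0 1" for z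
    using that by (auto simp: indicator_def norm_mult norm_power intro!: mult_le_one power_le_one)
qed

lemma monomials_integral:
  "(\<integral>z. indicator (ball 0 \<rho>) z * (z ^ m * cnj (z ^ n)) \<partial>\<mu>) = (if m = n then of_real (moment \<rho> n) else 0)"
proof (cases "m = n")
  case True
  have eq: "indicator (ball 0 \<rho>) z * (z ^ n * cnj (z ^ n)) = complex_of_real (indicator (ball 0 \<rho>) z * (cmod z) ^ (2 * n))" for z
  proof -
    have "z ^ n * cnj (z ^ n) = (z * cnj z) ^ n" by (simp add: power_mult_distrib)
    also have "\<dots> = complex_of_real ((cmod z) ^ (2 * n))"
      unfolding complex_norm_square[symmetric] by (simp add: power_mult)
    finally show ?thesis by (simp add: indicator_def)
  qed
  show ?thesis unfolding True eq moment_def by (simp only: integral_complex_of_real) simp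
qed (simp add: monomials_orthogonal del: complex_cnj_power)

lemma polynomial_integrals:
  fixes b :: "nat \<Rightarrow> complex"
  shows "(\<integral>z. indicator (ball 0 \<rho>) z * (cmod (\<Sum>n<N. b n * z ^ n))\<^sup>2 \<partial>\<mu>) = (\<Sum>n<N. (cmod (b n))\<^sup>2 * moment \<rho> n)"
    and "(\<integral>z. indicator (ball 0 \<rho>) z * ((\<Sum>n<N. b n * z ^ n) * cnj (z ^ k)) \<partial>\<mu>) = (if k < N then b k * of_real (moment \<rho> k) else 0)"
proof -
  have eq: "complex_of_real (indicator (ball 0 \<rho>) z * (cmod (\<Sum>n<N. b n * z ^ n))\<^sup>2)
      = (\<Sum>m<N. \<Sum>n<N. (b m * cnj (b n)) * (indicator (ball 0 \<rho>) z * (z ^ m * cnj (z ^ n))))" for z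
  proof -
    have "complex_of_real (indicator (ball 0 \<rho>) z * (cmod (\<Sum>n<N. b n * z ^ n))\<^sup>2)
        = indicator (ball 0 \<rho>) z * ((\<Sum>n<N. b n * z ^ n) * cnj (\<Sum>n<N. b n * z ^ n))"
      unfolding complex_norm_square[symmetric] by (simp add: indicator_def)
    also have "\<dots> = (\<Sum>m<N. \<Sum>n<N. indicator (ball 0 \<rho>) z * ((b m * z ^ m) * cnj (b n * z ^ n)))"
      unfolding cnj_sum sum_product by (simp only: sum_distrib_left)
    finally show ?thesis by (simp add: mult_ac)
  qed
  have "complex_of_real (\<integral>z. indicator (ball 0 \<rho>) z * (cmod (\<Sum>n<N. b n * z ^ n))\<^sup>2 \<partial>\<mu>)
      = (\<Sum>m<N. \<Sum>n<N. (b m * cnj (b n)) * (if m = n then of_real (moment \<rho> n) else 0))"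
    unfolding integral_complex_of_real[symmetric] eq
    by (subst Bochner_Integration.integral_sum; (subst Bochner_Integration.integral_sum)?)
      (auto intro!: integrable_sum integrable_mult_right integrable_monomials simp: monomials_integral simp del: complex_cnj_power)
  also have "\<dots> = (\<Sum>m<N. b m * cnj (b m) * of_real (moment \<rho> m))"
    by (simp add: if_distrib[of "\<lambda>x. _ * x"] cong: if_cong)
  also have "\<dots> = complex_of_real (\<Sum>n<N. (cmod (b n))\<^sup>2 * moment \<rho> n)"
    unfolding complex_norm_square[symmetric] by simp
  finally show "(\<integral>z. indicator (ball 0 \<rho>) z * (cmod (\<Sum>n<N. b n * z ^ n))\<^sup>2 \<partial>\<mu>) = (\<Sum>n<N. (cmod (b n))\<^sup>2 * moment \<rho> n)"
    using of_real_eq_iff by blast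
  have "indicator (ball 0 \<rho>) z * ((\<Sum>n<N. b n * z ^ n) * cnj (z ^ k))
      = (\<Sum>n<N. b n * (indicator (ball 0 \<rho>) z * (z ^ n * cnj (z ^ k))))" for z
    by (simp add: sum_distrib_left sum_distrib_right mult_ac)
  then have "(\<integral>z. indicator (ball 0 \<rho>) z * ((\<Sum>n<N. b n * z ^ n) * cnj (z ^ k)) \<partial>\<mu>)
      = (\<Sum>n<N. b n * (if n = k then of_real (moment \<rho> k) else 0))"
    by (simp add: integrable_monomials monomials_integral del: complex_cnj_power)
  then show "(\<integral>z. indicator (ball 0 \<rho>) z * ((\<Sum>n<N. b n * z ^ n) * cnj (z ^ k)) \<partial>\<mu>) = (if k < N then b k * of_real (moment \<rho> k) else 0)"
    by (simp add: if_distrib[of "\<lambda>x. _ * x"] cong: if_cong)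
qed

text \<open>
  On a smaller disc a power series converges uniformly, so the formulas for polynomials
  pass to the limit.
\<close>

lemma power_series_small_disc:
  fixes b :: "nat \<Rightarrow> complex"
  assumes F: "\<And>z. z \<in> ball 0 1 \<Longrightarrow> (\<lambda>n. b n * z ^ n) sums F z" and \<rho>: "0 \<le> \<rho>" "\<rho> < 1"
  shows "(\<lambda>n. (cmod (b n))\<^sup>2 * moment \<rho> n) sums (\<integral>z. indicator (ball 0 \<rho>) z * (cmod (F z))\<^sup>2 \<partial>\<mu>)"
    and "(\<integral>z. indicator (ball 0 \<rho>) z * (F z * cnj (z ^ k)) \<partial>\<mu>) = b k * of_real (moment \<rho> k)"
proof -
  have "F holomorphic_on ball 0 1" by (rule power_series_holomorphic[of 0 1 b]) (use F in simp)
  then have Fm[measurable]: "F \<in> borel_measurable \<mu>" by (rule holomorphic_imp_mu)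
  have pm[measurable]: "(\<lambda>z. \<Sum>n<N. b n * z ^ n) \<in> borel_measurable \<mu>" for N
    by (intro holomorphic_imp_mu holomorphic_intros)
  have km: "(\<lambda>z. cnj (z ^ k)) \<in> borel_measurable \<mu>"
    by (intro continuous_imp_mu continuous_intros)
  have "\<exists>r. \<rho> < r \<and> r < 1" using \<rho> by (intro dense)
  then obtain r where r: "\<rho> < r" "r < 1" by blast
  have "summable (\<lambda>n. b n * (of_real r) ^ n)" using F[of "of_real r"] r \<rho> by (auto simp: sums_iff)
  then have abs: "summable (\<lambda>n. norm (b n * of_real \<rho> ^ n))" by (rule powser_insidea) (use r \<rho> in auto)
  define C where "C = (\<Sum>n. norm (b n * of_real \<rho> ^ n))"
  have bd: "cmod (\<Sum>n<N. b n * z ^ n) \<le> C" if "z \<in> ball 0 \<rho>" for z N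
  proof -
    have "cmod (\<Sum>n<N. b n * z ^ n) \<le> (\<Sum>n<N. norm (b n * of_real \<rho> ^ n))"
      using that \<rho> by (intro sum_norm_le) (auto simp: norm_mult norm_power intro!: mult_left_mono power_mono)
    also have "\<dots> \<le> C" unfolding C_def by (rule sum_le_suminf[OF abs]) auto
    finally show ?thesis .
  qed
  have C0: "0 \<le> C" unfolding C_def by (rule suminf_nonneg[OF abs]) auto
  have lim: "(\<lambda>N. \<Sum>n<N. b n * z ^ n) \<longlonglongrightarrow> F z" if "z \<in> ball 0 1" for z
    using F[OF that] by (simp add: sums_def)
  have "(\<lambda>N. \<integral>z. indicator (ball 0 \<rho>) z * (cmod (\<Sum>n<N. b n * z ^ n))\<^sup>2 \<partial>\<mu>)
     \<longlonglongrightarrow> (\<integral>z. indicator (ball 0 \<rho>) z * (cmod (F z))\<^sup>2 \<partial>\<mu>)"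
  proof (rule integral_dominated_convergence[where w = "\<lambda>_. C\<^sup>2"])
    show "AE z in \<mu>. (\<lambda>N. indicator (ball 0 \<rho>) z * (cmod (\<Sum>n<N. b n * z ^ n))\<^sup>2) \<longlonglongrightarrow> indicator (ball 0 \<rho>) z * (cmod (F z))\<^sup>2"
      using lim by (intro AE_I2 tendsto_intros) (auto simp: space_mu)
    show "AE z in \<mu>. norm (indicator (ball 0 \<rho>) z * (cmod (\<Sum>n<N. b n * z ^ n))\<^sup>2) \<le> C\<^sup>2" for N
      using bd C0 by (intro AE_I2) (auto simp: indicator_def intro!: power_mono)
  qed (auto intro!: borel_measurable_times indicator_ball_mu borel_measurable_power measurable_compose[OF _ borel_measurable_norm] Fm pm)
  then show "(\<lambda>n. (cmod (b n))\<^sup>2 * moment \<rho> n) sums (\<integral>z. indicator (ball 0 \<rho>) z * (cmod (F z))\<^sup>2 \<partial>\<mu>)"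
    by (simp add: sums_def polynomial_integrals)
  have l2: "(\<lambda>N. \<integral>z. indicator (ball 0 \<rho>) z * ((\<Sum>n<N. b n * z ^ n) * cnj (z ^ k)) \<partial>\<mu>)
     \<longlonglongrightarrow> (\<integral>z. indicator (ball 0 \<rho>) z * (F z * cnj (z ^ k)) \<partial>\<mu>)"
  proof (rule integral_dominated_convergence[where w = "\<lambda>_. C"])
    show "(\<lambda>z. indicator (ball 0 \<rho>) z * (F z * cnj (z ^ k))) \<in> borel_measurable \<mu>"
      by (intro borel_measurable_times indicator_ball_mu Fm km)
    show "(\<lambda>z. indicator (ball 0 \<rho>) z * ((\<Sum>n<N. b n * z ^ n) * cnj (z ^ k))) \<in> borel_measurable \<mu>" for N
      by (intro borel_measurable_times indicator_ball_mu pm km)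
    show "AE z in \<mu>. (\<lambda>N. indicator (ball 0 \<rho>) z * ((\<Sum>n<N. b n * z ^ n) * cnj (z ^ k))) \<longlonglongrightarrow> indicator (ball 0 \<rho>) z * (F z * cnj (z ^ k))"
      using lim by (intro AE_I2 tendsto_mult tendsto_const) (auto simp: space_mu)
    show "AE z in \<mu>. norm (indicator (ball 0 \<rho>) z * ((\<Sum>n<N. b n * z ^ n) * cnj (z ^ k))) \<le> C" for N
    proof (rule AE_I2)
      fix z assume "z \<in> space \<mu>"
      then have "cmod (z ^ k) \<le> 1" by (auto simp: space_mu norm_power intro!: power_le_one)
      then have "cmod (\<Sum>n<N. b n * z ^ n) * cmod (z ^ k) \<le> C" if "z \<in> ball 0 \<rho>"
        using mult_mono[OF bd[OF that] _ C0] by fastforce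
      then show "norm (indicator (ball 0 \<rho>) z * ((\<Sum>n<N. b n * z ^ n) * cnj (z ^ k))) \<le> C"
        using C0 by (auto simp: indicator_def norm_mult norm_power)
    qed
  qed auto
  have "(\<lambda>N. if k < N then b k * complex_of_real (moment \<rho> k) else 0) \<longlonglongrightarrow> b k * of_real (moment \<rho> k)"
    by (intro tendsto_eventually eventually_sequentiallyI[of "Suc k"]) auto
  with l2 show "(\<integral>z. indicator (ball 0 \<rho>) z * (F z * cnj (z ^ k)) \<partial>\<mu>) = b k * of_real (moment \<rho> k)"
    unfolding polynomial_integrals by (rule LIMSEQ_unique)
qed

definition radius :: "nat \<Rightarrow> real" where "radius j = 1 - 1 / real (j + 2)"

lemma radius: "0 \<le> radius j" "radius j < 1" "j \<le> j' \<Longrightarrow> radius j \<le> radius j'"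
  by (auto simp: radius_def intro!: divide_left_mono)

lemma in_ball_radius:
  assumes "z \<in> ball (0::complex) 1" shows "eventually (\<lambda>j. z \<in> ball 0 (radius j)) sequentially"
proof -
  have "(\<lambda>j. 1 - 1 / real (j + 2)) \<longlonglongrightarrow> 1" by real_asymp
  then have "eventually (\<lambda>j. cmod z < radius j) sequentially"
    unfolding radius_def using assms by (intro order_tendstoD) auto
  then show ?thesis by simp
qed

lemma indicator_radius_SUP:
  "(SUP j. f z * indicator (ball 0 (radius j)) z) = (f z * indicator (ball 0 1) z :: ennreal)" for z :: complex
proof (rule LIMSEQ_unique[OF LIMSEQ_SUP])
  show "incseq (\<lambda>j. f z * indicator (ball 0 (radius j)) z)"
    using radius(3) by (intro monoI mult_left_mono) (auto simp: indicator_def split: if_splits intro: less_le_trans)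
  show "(\<lambda>j. f z * indicator (ball 0 (radius j)) z) \<longlonglongrightarrow> f z * indicator (ball 0 1) z"
  proof (cases "z \<in> ball 0 1")
    case True
    then show ?thesis using in_ball_radius[OF True]
      by (intro tendsto_eventually) (auto elim!: eventually_mono)
  next
    case False
    then have "z \<notin> ball 0 (radius j)" for j using radius(2)[of j] by auto
    then show ?thesis using False by simp
  qed
qed

lemma nn_integral_exhaust:
  assumes [measurable]: "f \<in> borel_measurable \<mu>"
  shows "(SUP j. \<integral>\<^sup>+z. f z * indicator (ball 0 (radius j)) z \<partial>\<mu>) = (\<integral>\<^sup>+z. f z \<partial>\<mu>)"
proof -
  have "(\<integral>\<^sup>+z. f z \<partial>\<mu>) = (\<integral>\<^sup>+z. (SUP j. f z * indicator (ball 0 (radius j)) z) \<partial>\<mu>)"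
    unfolding indicator_radius_SUP by (intro nn_integral_cong) (auto simp: space_mu)
  also have "\<dots> = (SUP j. \<integral>\<^sup>+z. f z * indicator (ball 0 (radius j)) z \<partial>\<mu>)"
  proof (rule nn_integral_monotone_convergence_SUP)
    show "incseq (\<lambda>j z. f z * indicator (ball 0 (radius j)) z)"
      using radius(3) by (intro monoI le_funI mult_left_mono) (auto simp: indicator_def split: if_splits intro: less_le_trans)
  qed measurable
  finally show ?thesis by simp
qed

lemma moment_nonneg: "0 \<le> moment \<rho> n"
  unfolding moment_def by (intro Bochner_Integration.integral_nonneg) auto

lemma ennreal_moment: "ennreal (moment \<rho> n) = (\<integral>\<^sup>+z. ennreal ((cmod z) ^ (2 * n)) * indicator (ball 0 \<rho>) z \<partial>\<mu>)"
proof -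
  have "integrable \<mu> (\<lambda>z. indicator (ball 0 \<rho>) z * (cmod z) ^ (2 * n))"
    by (rule integrable_bounded_mu[where B = 1])
      (auto simp: indicator_def intro!: power_le_one borel_measurable_times indicator_ball_mu borel_imp_mu)
  then have "(\<integral>\<^sup>+z. ennreal (indicator (ball 0 \<rho>) z * (cmod z) ^ (2 * n)) \<partial>\<mu>) = ennreal (moment \<rho> n)"
    unfolding moment_def by (rule nn_integral_eq_integral) auto
  then show ?thesis by (simp add: ennreal_mult ennreal_indicator mult.commute)
qed

lemma moment_SUP: "(SUP j. ennreal (moment (radius j) n)) = ennreal (moment 1 n)"
proof -
  have "(SUP j. ennreal (moment (radius j) n)) = (\<integral>\<^sup>+z. ennreal ((cmod z) ^ (2 * n)) \<partial>\<mu>)"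
    unfolding ennreal_moment by (rule nn_integral_exhaust) (auto intro!: borel_imp_mu)
  also have "\<dots> = ennreal (moment 1 n)" unfolding ennreal_moment
    by (intro nn_integral_cong) (auto simp: space_mu)
  finally show ?thesis .
qed

lemma moment_mono: "\<rho> \<le> \<rho>' \<Longrightarrow> moment \<rho> n \<le> moment \<rho>' n"
proof -
  assume "\<rho> \<le> \<rho>'"
  then have "ennreal (moment \<rho> n) \<le> ennreal (moment \<rho>' n)"
    unfolding ennreal_moment by (intro nn_integral_mono mult_left_mono) (auto simp: indicator_def)
  then show ?thesis using moment_nonneg by simp
qed

text \<open>
  Parseval's identity, obtained from smaller discs by monotone convergence. It is an
  identity in \<open>[0, \<infinity>]\<close>, so that it can also be used to prove that a power series is
  square integrable.
\<close>

lemma nn_integral_power_series: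
  fixes b :: "nat \<Rightarrow> complex"
  assumes F: "\<And>z. z \<in> ball 0 1 \<Longrightarrow> (\<lambda>n. b n * z ^ n) sums F z"
  shows "(\<integral>\<^sup>+z. ennreal ((cmod (F z))\<^sup>2) \<partial>\<mu>) = (\<Sum>n. ennreal ((cmod (b n))\<^sup>2 * moment 1 n))"
proof -
  have Fh: "F holomorphic_on ball 0 1" by (rule power_series_holomorphic[of 0 1 b]) (use F in simp)
  then have Fm[measurable]: "F \<in> borel_measurable \<mu>" by (rule holomorphic_imp_mu)
  have disc: "(\<integral>\<^sup>+z. ennreal ((cmod (F z))\<^sup>2) * indicator (ball 0 (radius j)) z \<partial>\<mu>)
      = (\<Sum>n. ennreal ((cmod (b n))\<^sup>2) * ennreal (moment (radius j) n))" for j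
  proof -
    have "compact (F ` cball 0 (radius j))"
      using radius[of j] by (intro compact_continuous_image holomorphic_on_imp_continuous_on holomorphic_on_subset[OF Fh]) auto
    then obtain B where B: "\<And>z. z \<in> cball 0 (radius j) \<Longrightarrow> cmod (F z) \<le> B"
      using compact_imp_bounded bounded_iff by (metis imageI)
    have "integrable \<mu> (\<lambda>z. indicator (ball 0 (radius j)) z * (cmod (F z))\<^sup>2)"
    proof (rule integrable_bounded_mu[where B = "B\<^sup>2"])
      show "(\<lambda>z. indicator (ball 0 (radius j)) z * (cmod (F z))\<^sup>2) \<in> borel_measurable \<mu>"
        by (rule borel_measurable_times[OF indicator_ball_mu]) measurable
    qed (use B in \<open>auto simp: indicator_def intro!: power_mono\<close>)
    then have "(\<integral>\<^sup>+z. ennreal (indicator (ball 0 (radius j)) z * (cmod (F z))\<^sup>2) \<partial>\<mu>)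
        = ennreal (\<integral>z. indicator (ball 0 (radius j)) z * (cmod (F z))\<^sup>2 \<partial>\<mu>)"
      by (rule nn_integral_eq_integral) auto
    also have "\<dots> = (\<Sum>n. ennreal ((cmod (b n))\<^sup>2 * moment (radius j) n))"
      using power_series_small_disc(1)[OF F radius(1,2)[of j]] moment_nonneg
      by (intro suminf_ennreal_eq[symmetric]) auto
    finally show ?thesis by (simp add: ennreal_mult ennreal_indicator mult.commute moment_nonneg)
  qed
  have "(\<integral>\<^sup>+z. ennreal ((cmod (F z))\<^sup>2) \<partial>\<mu>) = (SUP j. \<integral>\<^sup>+z. ennreal ((cmod (F z))\<^sup>2) * indicator (ball 0 (radius j)) z \<partial>\<mu>)"
    by (rule nn_integral_exhaust[symmetric]) measurable
  also have "\<dots> = (SUP j. \<Sum>n. ennreal ((cmod (b n))\<^sup>2) * ennreal (moment (radius j) n))" unfolding disc ..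
  also have "\<dots> = (\<Sum>n. SUP j. ennreal ((cmod (b n))\<^sup>2) * ennreal (moment (radius j) n))"
    by (intro ennreal_suminf_SUP_eq[symmetric] monoI mult_left_mono ennreal_leI moment_mono radius(3)) auto
  also have "\<dots> = (\<Sum>n. ennreal ((cmod (b n))\<^sup>2 * moment 1 n))"
    by (simp add: SUP_mult_left_ennreal[symmetric] moment_SUP ennreal_mult moment_nonneg)
  finally show ?thesis .
qed

text \<open>
  The formula on smaller discs extends by dominated convergence with the majorant
  \<open>1 + |F|^2\<close>, which is integrable because the measure is finite.
\<close>

lemma integral_power_series_monomial:
  fixes b :: "nat \<Rightarrow> complex"
  assumes F: "\<And>z. z \<in> ball 0 1 \<Longrightarrow> (\<lambda>n. b n * z ^ n) sums F z"
    and int: "integrable \<mu> (\<lambda>z. (cmod (F z))\<^sup>2)"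
  shows "(\<integral>z. F z * cnj (z ^ k) \<partial>\<mu>) = b k * of_real (moment 1 k)"
proof -
  have Fh: "F holomorphic_on ball 0 1" by (rule power_series_holomorphic[of 0 1 b]) (use F in simp)
  then have Fm[measurable]: "F \<in> borel_measurable \<mu>" by (rule holomorphic_imp_mu)
  have km: "(\<lambda>z. cnj (z ^ k)) \<in> borel_measurable \<mu>" by (intro continuous_imp_mu continuous_intros)
  have "(\<lambda>j. \<integral>z. indicator (ball 0 (radius j)) z * (F z * cnj (z ^ k)) \<partial>\<mu>) \<longlonglongrightarrow> (\<integral>z. F z * cnj (z ^ k) \<partial>\<mu>)"
  proof (rule integral_dominated_convergence[where w = "\<lambda>z. 1 + (cmod (F z))\<^sup>2"])
    show "(\<lambda>z. F z * cnj (z ^ k)) \<in> borel_measurable \<mu>" by (intro borel_measurable_times Fm km)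
    show "(\<lambda>z. indicator (ball 0 (radius j)) z * (F z * cnj (z ^ k))) \<in> borel_measurable \<mu>" for j
      by (intro borel_measurable_times indicator_ball_mu Fm km)
    show "integrable \<mu> (\<lambda>z. 1 + (cmod (F z))\<^sup>2)" using int by simp
    show "AE z in \<mu>. (\<lambda>j. indicator (ball 0 (radius j)) z * (F z * cnj (z ^ k))) \<longlonglongrightarrow> F z * cnj (z ^ k)"
    proof (rule AE_I2)
      fix z assume "z \<in> space \<mu>"
      then have "eventually (\<lambda>j. indicator (ball 0 (radius j)) z * (F z * cnj (z ^ k)) = F z * cnj (z ^ k)) sequentially"
        unfolding space_mu by (rule eventually_mono[OF in_ball_radius]) simp
      then show "(\<lambda>j. indicator (ball 0 (radius j)) z * (F z * cnj (z ^ k))) \<longlonglongrightarrow> F z * cnj (z ^ k)"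
        by (rule tendsto_eventually)
    qed
    show "AE z in \<mu>. norm (indicator (ball 0 (radius j)) z * (F z * cnj (z ^ k))) \<le> 1 + (cmod (F z))\<^sup>2" for j
    proof (rule AE_I2)
      fix z assume "z \<in> space \<mu>"
      then have "cmod (z ^ k) \<le> 1" by (auto simp: space_mu norm_power intro!: power_le_one)
      then have "cmod (F z * cnj (z ^ k)) \<le> cmod (F z)" by (simp add: norm_mult mult_left_le del: complex_cnj_power)
      also have "\<dots> \<le> 1 + (cmod (F z))\<^sup>2"
        using zero_le_power2[of "cmod (F z) - 1"] norm_ge_zero[of "F z"] by (simp add: power2_diff del: norm_ge_zero)
      finally show "norm (indicator (ball 0 (radius j)) z * (F z * cnj (z ^ k))) \<le> 1 + (cmod (F z))\<^sup>2"
        by (auto simp: indicator_def)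
    qed
  qed
  then have l1: "(\<lambda>j. b k * complex_of_real (moment (radius j) k)) \<longlonglongrightarrow> (\<integral>z. F z * cnj (z ^ k) \<partial>\<mu>)"
    using power_series_small_disc(2)[OF F radius(1,2)] by simp
  have "(\<lambda>j. ennreal (moment (radius j) k)) \<longlonglongrightarrow> ennreal (moment 1 k)"
    unfolding moment_SUP[symmetric] by (intro LIMSEQ_SUP monoI ennreal_leI moment_mono radius(3))
  then have "(\<lambda>j. moment (radius j) k) \<longlonglongrightarrow> moment 1 k"
    by (subst (asm) tendsto_ennreal_iff) (auto simp: moment_nonneg)
  then have "(\<lambda>j. b k * complex_of_real (moment (radius j) k)) \<longlonglongrightarrow> b k * of_real (moment 1 k)"
    by (intro tendsto_intros)
  then show ?thesis using l1 LIMSEQ_unique by blast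
qed

section \<open>The Dirichlet space and its orthonormal basis\<close>

abbreviation "D \<equiv> dirichlet_space \<alpha>"

lemma D_iff: "f \<in> D \<longleftrightarrow> f holomorphic_on ball 0 1 \<and> (\<forall>z. z \<notin> ball 0 1 \<longrightarrow> f z = 0) \<and>
    integrable \<mu> (\<lambda>z. (cmod (deriv f z))\<^sup>2)"
  by (simp add: dirichlet_space_def)

lemma D_holo: "f \<in> D \<Longrightarrow> f holomorphic_on ball 0 1"
  and D_zero: "f \<in> D \<Longrightarrow> z \<notin> ball 0 1 \<Longrightarrow> f z = 0"
  and D_int: "f \<in> D \<Longrightarrow> integrable \<mu> (\<lambda>z. (cmod (deriv f z))\<^sup>2)"
  by (auto simp: D_iff)

lemma D_deriv_holo: "f \<in> D \<Longrightarrow> deriv f holomorphic_on ball 0 1"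
  by (intro holomorphic_deriv D_holo) auto

lemma D_deriv_meas: "f \<in> D \<Longrightarrow> deriv f \<in> borel_measurable \<mu>"
  by (intro holomorphic_imp_mu D_deriv_holo)

lemma D_has_deriv: "f \<in> D \<Longrightarrow> z \<in> ball 0 1 \<Longrightarrow> (f has_field_derivative deriv f z) (at z)"
  by (rule holomorphic_derivI[OF D_holo]) auto

lemma deriv_lincomb:
  assumes "f \<in> D" "g \<in> D" "z \<in> ball 0 1"
  shows "deriv (\<lambda>z. a * f z + b * g z) z = a * deriv f z + b * deriv g z"
  by (rule DERIV_imp_deriv) (auto intro!: derivative_eq_intros D_has_deriv assms)

lemma cmod_mult_le: "cmod (x * y) \<le> (cmod x)\<^sup>2 + (cmod y)\<^sup>2"
  using zero_le_power2[of "cmod x - cmod y"] mult_nonneg_nonneg[OF norm_ge_zero norm_ge_zero, of x y]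
  unfolding power2_diff norm_mult by linarith

lemma L2_product_integrable:
  assumes F: "F \<in> borel_measurable \<mu>" "integrable \<mu> (\<lambda>z. (cmod (F z))\<^sup>2)"
    and G: "G \<in> borel_measurable \<mu>" "integrable \<mu> (\<lambda>z. (cmod (G z))\<^sup>2)"
  shows "integrable \<mu> (\<lambda>z. F z * cnj (G z))"
proof (rule Bochner_Integration.integrable_bound)
  show "integrable \<mu> (\<lambda>z. (cmod (F z))\<^sup>2 + (cmod (G z))\<^sup>2)" using F G by simp
  have "(\<lambda>z. cnj (G z)) \<in> borel_measurable \<mu>"
    using G(1) by (rule measurable_compose) (intro borel_measurable_continuous_onI continuous_intros)
  then show "(\<lambda>z. F z * cnj (G z)) \<in> borel_measurable \<mu>" using F(1) by (intro borel_measurable_times)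
  show "AE z in \<mu>. norm (F z * cnj (G z)) \<le> norm ((cmod (F z))\<^sup>2 + (cmod (G z))\<^sup>2)"
    using cmod_mult_le[of "F z" "cnj (G z)" for z] by (intro AE_I2) simp
qed

lemma D_product_integrable: "f \<in> D \<Longrightarrow> g \<in> D \<Longrightarrow> integrable \<mu> (\<lambda>z. deriv f z * cnj (deriv g z))"
  by (intro L2_product_integrable D_deriv_meas D_int)

lemma L2_lincomb_integrable:
  assumes F: "F \<in> borel_measurable \<mu>" "integrable \<mu> (\<lambda>z. (cmod (F z))\<^sup>2)"
    and G: "G \<in> borel_measurable \<mu>" "integrable \<mu> (\<lambda>z. (cmod (G z))\<^sup>2)"
  shows "integrable \<mu> (\<lambda>z. (cmod (a * F z + b * G z))\<^sup>2)"
proof (rule Bochner_Integration.integrable_bound)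
  show "integrable \<mu> (\<lambda>z. 2 * (cmod a)\<^sup>2 * (cmod (F z))\<^sup>2 + 2 * (cmod b)\<^sup>2 * (cmod (G z))\<^sup>2)" using F G by simp
  show "(\<lambda>z. (cmod (a * F z + b * G z))\<^sup>2) \<in> borel_measurable \<mu>" using F(1) G(1) by measurable
  have "(cmod (a * F z + b * G z))\<^sup>2 \<le> 2 * (cmod a)\<^sup>2 * (cmod (F z))\<^sup>2 + 2 * (cmod b)\<^sup>2 * (cmod (G z))\<^sup>2" for z
  proof -
    have "(cmod (a * F z + b * G z))\<^sup>2 \<le> (cmod a * cmod (F z) + cmod b * cmod (G z))\<^sup>2"
      by (intro power_mono) (auto simp: norm_mult[symmetric] norm_triangle_ineq)
    also have "\<dots> \<le> 2 * (cmod a * cmod (F z))\<^sup>2 + 2 * (cmod b * cmod (G z))\<^sup>2"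
      using zero_le_power2[of "cmod a * cmod (F z) - cmod b * cmod (G z)"] by (simp add: power2_diff power2_sum)
    finally show ?thesis by (simp add: power_mult_distrib mult.assoc)
  qed
  then show "AE z in \<mu>. norm ((cmod (a * F z + b * G z))\<^sup>2) \<le> norm (2 * (cmod a)\<^sup>2 * (cmod (F z))\<^sup>2 + 2 * (cmod b)\<^sup>2 * (cmod (G z))\<^sup>2)"
    by (intro AE_I2) simp
qed

lemma D_lincomb:
  assumes f: "f \<in> D" and g: "g \<in> D" shows "(\<lambda>z. a * f z + b * g z) \<in> D"
  unfolding D_iff
proof (intro conjI allI impI)
  show "(\<lambda>z. a * f z + b * g z) holomorphic_on ball 0 1" using f g by (intro holomorphic_intros D_holo)
  show "a * f z + b * g z = 0" if "z \<notin> ball 0 1" for z using D_zero[OF f that] D_zero[OF g that] by simp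
  have "integrable \<mu> (\<lambda>z. (cmod (a * deriv f z + b * deriv g z))\<^sup>2)"
    using f g by (intro L2_lincomb_integrable D_deriv_meas D_int)
  then show "integrable \<mu> (\<lambda>z. (cmod (deriv (\<lambda>z. a * f z + b * g z) z))\<^sup>2)"
    by (rule Bochner_Integration.integrable_cong[THEN iffD1, OF refl, rotated])
      (simp add: space_mu deriv_lincomb[OF f g])
qed

lemma inner_lincomb:
  assumes f: "f \<in> D" and g: "g \<in> D" and h: "h \<in> D"
  shows "dirichlet_inner \<alpha> (\<lambda>z. a * f z + b * g z) h = a * dirichlet_inner \<alpha> f h + b * dirichlet_inner \<alpha> g h"
proof -
  have "(\<integral>z. deriv (\<lambda>z. a * f z + b * g z) z * cnj (deriv h z) \<partial>\<mu>)
     = (\<integral>z. a * (deriv f z * cnj (deriv h z)) + b * (deriv g z * cnj (deriv h z)) \<partial>\<mu>)"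
    by (intro Bochner_Integration.integral_cong) (auto simp: space_mu deriv_lincomb[OF f g] algebra_simps)
  also have "\<dots> = a * (\<integral>z. deriv f z * cnj (deriv h z) \<partial>\<mu>) + b * (\<integral>z. deriv g z * cnj (deriv h z) \<partial>\<mu>)"
    using D_product_integrable[OF f h] D_product_integrable[OF g h] by simp
  finally show ?thesis by (simp add: dirichlet_inner_def algebra_simps)
qed

lemma inner_commute: "dirichlet_inner \<alpha> f g = cnj (dirichlet_inner \<alpha> g f)"
  unfolding dirichlet_inner_def complex_cnj_add Bochner_Integration.integral_cnj[symmetric] by (simp add: mult.commute)

lemma Re_inner_self: "Re (dirichlet_inner \<alpha> f f) = (cmod (f 0))\<^sup>2 + (\<integral>z. (cmod (deriv f z))\<^sup>2 \<partial>\<mu>)"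
proof -
  have "deriv f z * cnj (deriv f z) = complex_of_real ((cmod (deriv f z))\<^sup>2)" for z
    by (simp add: complex_norm_square del: of_real_power)
  moreover have "f 0 * cnj (f 0) = complex_of_real ((cmod (f 0))\<^sup>2)"
    by (simp add: complex_norm_square del: of_real_power)
  ultimately show ?thesis unfolding dirichlet_inner_def
    by (simp only: integral_complex_of_real plus_complex.simps Re_complex_of_real)
qed

lemma norm_eq_sqrt_inner: "dirichlet_norm \<alpha> f = sqrt (Re (dirichlet_inner \<alpha> f f))"
  by (simp add: dirichlet_norm_def Re_inner_self)

text \<open>
  Operators that act naturally on derivatives are transferred to the space by taking
  this primitive, which vanishes outside the disc as all elements of the space do.
\<close>

definition primitive :: "(complex \<Rightarrow> complex) \<Rightarrow> complex \<Rightarrow> complex" where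
  "primitive G = (\<lambda>z. if z \<in> ball 0 1 then contour_integral (linepath 0 z) G else 0)"

lemma primitive_0 [simp]: "primitive G 0 = 0"
  by (simp add: primitive_def)

lemma primitive_has_derivative:
  assumes G: "G holomorphic_on ball 0 1" and z: "z \<in> ball 0 1"
  shows "(primitive G has_field_derivative G z) (at z)"
proof -
  obtain g where g: "\<And>x. x \<in> ball 0 1 \<Longrightarrow> (g has_field_derivative G x) (at x within ball 0 1)"
    using holomorphic_convex_primitive'[OF convex_ball open_ball G] by blast
  have eq: "primitive G x = g x - g 0" if x: "x \<in> ball 0 1" for x
  proof -
    have "path_image (linepath 0 x) \<subseteq> ball 0 1"
      unfolding path_image_linepath using x by (intro closed_segment_subset) auto
    then have "(G has_contour_integral g (pathfinish (linepath 0 x)) - g (pathstart (linepath 0 x))) (linepath 0 x)"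
      by (rule contour_integral_primitive[OF g valid_path_linepath, rotated]) simp_all
    then show ?thesis using x by (simp add: primitive_def contour_integral_unique)
  qed
  have "((\<lambda>x. g x - g 0) has_field_derivative G z) (at z)"
    using DERIV_diff[OF g[OF z] DERIV_const[of "g 0"]] at_within_open[OF z open_ball] by simp
  then show ?thesis
  proof (rule DERIV_cong_ev[THEN iffD2, OF refl _ refl, rotated])
    show "eventually (\<lambda>x. primitive G x = g x - g 0) (nhds z)"
      using eventually_nhds_in_open[OF open_ball z] by eventually_elim (rule eq)
  qed
qed

lemma deriv_primitive: "G holomorphic_on ball 0 1 \<Longrightarrow> z \<in> ball 0 1 \<Longrightarrow> deriv (primitive G) z = G z"
  using primitive_has_derivative DERIV_imp_deriv by blast

lemma primitive_in_D:
  assumes G: "G holomorphic_on ball 0 1" and int: "integrable \<mu> (\<lambda>z. (cmod (G z))\<^sup>2)"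
  shows "primitive G \<in> D"
  unfolding D_iff
proof (intro conjI allI impI)
  show "primitive G holomorphic_on ball 0 1"
    using primitive_has_derivative[OF G] by (subst holomorphic_on_open) blast+
  show "primitive G z = 0" if "z \<notin> ball 0 1" for z using that by (simp add: primitive_def)
  show "integrable \<mu> (\<lambda>z. (cmod (deriv (primitive G) z))\<^sup>2)"
    using int by (rule Bochner_Integration.integrable_cong[THEN iffD1, OF refl, rotated])
      (simp add: space_mu deriv_primitive[OF G])
qed

definition const_disc :: "complex \<Rightarrow> complex \<Rightarrow> complex" where
  "const_disc c = (\<lambda>z. if z \<in> ball 0 1 then c else 0)"

lemma const_disc_0 [simp]: "const_disc c 0 = c"
  by (simp add: const_disc_def)

lemma deriv_const_disc: "z \<in> ball 0 1 \<Longrightarrow> deriv (const_disc c) z = 0"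
proof -
  assume z: "z \<in> ball 0 1"
  have "(const_disc c has_field_derivative 0) (at z)"
  proof (rule DERIV_cong_ev[THEN iffD2, OF refl _ refl])
    show "eventually (\<lambda>x. const_disc c x = c) (nhds z)"
      using eventually_nhds_in_open[OF open_ball z] by eventually_elim (simp add: const_disc_def)
  qed simp
  then show ?thesis using DERIV_imp_deriv by blast
qed

lemma const_disc_in_D: "const_disc c \<in> D"
proof -
  have "integrable \<mu> (\<lambda>z. (cmod (deriv (const_disc c) z))\<^sup>2) \<longleftrightarrow> integrable \<mu> (\<lambda>z. 0::real)"
    by (rule Bochner_Integration.integrable_cong) (simp_all add: space_mu deriv_const_disc)
  moreover have "const_disc c holomorphic_on ball 0 1"
    by (rule holomorphic_transform[of "\<lambda>_. c"]) (auto simp: const_disc_def)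
  ultimately show ?thesis by (auto simp: D_iff const_disc_def)
qed

text \<open>
  Moments decay more slowly than any geometric sequence of ratio less than 1, because a
  small disc beyond radius \<open>r\<close> carries positive mass and \<open>|z| ^ (2 * n) \<ge> r ^ (2 * n)\<close>
  holds there. This makes coefficient bounds relative to the moments strong enough for
  convergence in the whole disc.
\<close>

lemma moment_pos_ge:
  assumes r: "0 < r" "r < 1"
  obtains \<kappa> where "\<kappa> > 0" "\<And>n. moment 1 n \<ge> \<kappa> * r ^ (2 * n)"
proof -
  \<comment> \<open>The disc of centre \<open>c\<close> and radius \<open>\<delta>\<close> lies in the annulus \<open>r \<le> |z| \<le> (3 + r) / 4\<close>,
    where the weight is at least \<open>w0\<close>.\<close>
  define c where "c = complex_of_real ((1 + r) / 2)"
  define \<delta> where "\<delta> = (1 - r) / 4"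
  have \<delta>: "\<delta> > 0" using r by (simp add: \<delta>_def)
  have cn: "cmod c = (1 + r) / 2" unfolding c_def norm_of_real using r by simp
  define w0 where "w0 = (1 + \<alpha>) * (1 - ((3 + r) / 4)\<^sup>2) powr \<alpha> / pi"
  have q: "((3 + r) / 4)\<^sup>2 < 1" using r by (intro power_less_one_iff[THEN iffD2]) auto
  have w0: "w0 > 0" using alpha_pos q by (simp add: w0_def)
  have sub: "r \<le> cmod z" "cmod z < 1" "w0 \<le> weight z" if z: "z \<in> ball c \<delta>" for z
  proof -
    have "cmod (z - c) < \<delta>" using z by (simp add: dist_norm norm_minus_commute)
    then have a: "cmod z < (1 + r) / 2 + \<delta>" "(1 + r) / 2 - \<delta> < cmod z"
      using norm_triangle_ineq2[of z c] norm_triangle_ineq2[of c z] cn by (auto simp: norm_minus_commute)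
    then have b: "r \<le> cmod z" "cmod z \<le> (3 + r) / 4" using r by (auto simp: \<delta>_def field_simps)
    then show "r \<le> cmod z" "cmod z < 1" using r by auto
    have "(cmod z)\<^sup>2 \<le> ((3 + r) / 4)\<^sup>2" using b by (intro power_mono) auto
    then have "(1 - ((3 + r) / 4)\<^sup>2) powr \<alpha> \<le> (1 - (cmod z)\<^sup>2) powr \<alpha>"
      using q alpha_pos by (intro powr_mono2) auto
    then show "w0 \<le> weight z" using alpha_pos by (simp add: w0_def weight_def divide_right_mono)
  qed
  define \<kappa> where "\<kappa> = w0 * measure lborel (ball c \<delta>)"
  have fin: "emeasure lborel (ball c \<delta>) = ennreal (measure lborel (ball c \<delta>))"
    using emeasure_bounded_finite[of "ball c \<delta>"] by (simp add: emeasure_eq_ennreal_measure less_top)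
  have mp: "measure lborel (ball c \<delta>) > 0" using content_ball_pos[OF \<delta>] by simp
  show ?thesis
  proof (rule that[of \<kappa>])
    show "\<kappa> > 0" using w0 mp by (simp add: \<kappa>_def)
    fix n
    have "ennreal (\<kappa> * r ^ (2 * n)) = ennreal (r ^ (2 * n) * w0) * emeasure lborel (ball c \<delta>)"
      unfolding fin \<kappa>_def using w0 mp r by (subst ennreal_mult[symmetric]) (auto simp: mult_ac)
    also have "\<dots> = (\<integral>\<^sup>+z. ennreal (r ^ (2 * n) * w0) * indicator (ball c \<delta>) z \<partial>lborel)"
      by (subst nn_integral_cmult_indicator) auto
    also have "\<dots> \<le> (\<integral>\<^sup>+z\<in>ball 0 1. ennreal ((cmod z) ^ (2 * n)) * ennreal (weight z) \<partial>lborel)"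
    proof (rule nn_integral_mono)
      fix z
      have "ennreal (r ^ (2 * n) * w0) \<le> ennreal ((cmod z) ^ (2 * n)) * ennreal (weight z)" if "z \<in> ball c \<delta>"
        unfolding ennreal_mult[symmetric, OF zero_le_power[OF norm_ge_zero] weight_nonneg]
        using sub[OF that] w0 r by (intro ennreal_leI mult_mono power_mono) auto
      then show "ennreal (r ^ (2 * n) * w0) * indicator (ball c \<delta>) z
          \<le> ennreal ((cmod z) ^ (2 * n)) * ennreal (weight z) * indicator (ball 0 1) z"
        using sub(2) by (cases "z \<in> ball c \<delta>") auto
    qed
    also have "\<dots> = (\<integral>\<^sup>+z. ennreal ((cmod z) ^ (2 * n)) \<partial>\<mu>)"
      by (rule nn_integral_mu[symmetric]) (auto intro!: borel_imp_mu)
    also have "\<dots> = ennreal (moment 1 n)" unfolding ennreal_moment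
      by (intro nn_integral_cong) (auto simp: space_mu)
    finally show "\<kappa> * r ^ (2 * n) \<le> moment 1 n" using moment_nonneg by simp
  qed
qed

lemma moment_pos: "moment 1 n > 0"
proof -
  obtain \<kappa> where "\<kappa> > 0" "moment 1 n \<ge> \<kappa> * (1/2) ^ (2 * n)" using moment_pos_ge[of "1/2"] by auto
  then show ?thesis by (meson less_le_trans mult_pos_pos zero_less_power half_gt_zero zero_less_one)
qed

text \<open>
  The constant 1, followed by the primitives of the normalized monomials: in this inner
  product the monomials of positive degree are orthogonal because their derivatives are.
\<close>

primrec basis :: "nat \<Rightarrow> complex \<Rightarrow> complex" where
  "basis 0 = const_disc 1"
| "basis (Suc k) = primitive (\<lambda>z. of_real (1 / sqrt (moment 1 k)) * z ^ k)"

declare basis.simps(2) [simp del]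

lemma basis_Suc_0 [simp]: "basis (Suc k) 0 = 0"
  by (simp add: basis.simps)

lemma monomial_holo: "(\<lambda>z. c * z ^ k) holomorphic_on S"
  by (intro holomorphic_intros)

lemma monomial_square_integrable: "integrable \<mu> (\<lambda>z. (cmod (c * z ^ k))\<^sup>2)"
proof (rule integrable_bounded_mu[where B = "(cmod c)\<^sup>2"])
  show "(\<lambda>z. (cmod (c * z ^ k))\<^sup>2) \<in> borel_measurable \<mu>"
    by (intro continuous_imp_mu continuous_intros)
  show "norm ((cmod (c * z ^ k))\<^sup>2) \<le> (cmod c)\<^sup>2" if "z \<in> ball 0 1" for z
    using that by (auto simp: norm_mult norm_power intro!: power_mono mult_left_le power_le_one)
qed

lemma basis_in_D: "basis n \<in> D"
proof (cases n)
  case (Suc k)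
  then show ?thesis unfolding Suc basis.simps by (intro primitive_in_D monomial_holo monomial_square_integrable)
qed (simp add: const_disc_in_D)

lemma deriv_basis: "z \<in> ball 0 1 \<Longrightarrow> deriv (basis (Suc k)) z = of_real (1 / sqrt (moment 1 k)) * z ^ k"
  unfolding basis.simps by (rule deriv_primitive[OF monomial_holo])

lemma inner_basis_0: "dirichlet_inner \<alpha> f (basis 0) = f 0"
proof -
  have "(\<integral>z. deriv f z * cnj (deriv (basis 0) z) \<partial>\<mu>) = (\<integral>z. 0 \<partial>\<mu>)"
    by (rule Bochner_Integration.integral_cong) (simp_all add: space_mu deriv_const_disc)
  then show ?thesis by (simp add: dirichlet_inner_def const_disc_def)
qed

lemma inner_basis_Suc:
  assumes "f \<in> D" and F: "\<And>z. z \<in> ball 0 1 \<Longrightarrow> (\<lambda>n. b n * z ^ n) sums deriv f z"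
  shows "dirichlet_inner \<alpha> f (basis (Suc k)) = b k * of_real (sqrt (moment 1 k))"
proof -
  have I: "(\<integral>z. deriv f z * cnj (z ^ k) \<partial>\<mu>) = b k * of_real (moment 1 k)"
    by (rule integral_power_series_monomial[OF _ D_int[OF assms(1)]]) (rule F)
  have "(\<integral>z. deriv f z * cnj (deriv (basis (Suc k)) z) \<partial>\<mu>)
      = (\<integral>z. of_real (1 / sqrt (moment 1 k)) * (deriv f z * cnj (z ^ k)) \<partial>\<mu>)"
    by (rule Bochner_Integration.integral_cong) (auto simp: space_mu deriv_basis simp del: basis.simps)
  also have "\<dots> = of_real (1 / sqrt (moment 1 k)) * (b k * of_real (moment 1 k))"
    unfolding integral_mult_right_zero I ..
  also have "\<dots> = b k * of_real (moment 1 k / sqrt (moment 1 k))" by simp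
  also have "moment 1 k / sqrt (moment 1 k) = sqrt (moment 1 k)"
    using moment_nonneg by (rule real_div_sqrt)
  finally show ?thesis by (simp add: dirichlet_inner_def)
qed

lemma deriv_series:
  assumes "f \<in> D"
  obtains b where "\<And>z. z \<in> ball 0 1 \<Longrightarrow> (\<lambda>n. b n * z ^ n) sums deriv f z"
  using holomorphic_power_series[OF D_deriv_holo[OF assms]]
    that[of "\<lambda>n. (deriv ^^ n) (deriv f) 0 / fact n"] by simp

lemma D_parseval:
  assumes f: "f \<in> D"
  shows "(\<lambda>n. (cmod (dirichlet_inner \<alpha> f (basis n)))\<^sup>2) sums Re (dirichlet_inner \<alpha> f f)"
proof -
  obtain b where b: "\<And>z. z \<in> ball 0 1 \<Longrightarrow> (\<lambda>n. b n * z ^ n) sums deriv f z" using deriv_series[OF f] by blast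
  have "(\<Sum>n. ennreal ((cmod (b n))\<^sup>2 * moment 1 n)) = (\<integral>\<^sup>+z. ennreal ((cmod (deriv f z))\<^sup>2) \<partial>\<mu>)"
    using nn_integral_power_series[OF b] by simp
  also have "\<dots> = ennreal (\<integral>z. (cmod (deriv f z))\<^sup>2 \<partial>\<mu>)"
    by (intro nn_integral_eq_integral D_int f) auto
  finally have eq: "(\<Sum>n. ennreal ((cmod (b n))\<^sup>2 * moment 1 n)) = ennreal (\<integral>z. (cmod (deriv f z))\<^sup>2 \<partial>\<mu>)" .
  have "summable (\<lambda>n. (cmod (b n))\<^sup>2 * moment 1 n)"
    by (rule summable_suminf_not_top) (auto simp: eq moment_nonneg)
  moreover from this have "(\<Sum>n. (cmod (b n))\<^sup>2 * moment 1 n) = (\<integral>z. (cmod (deriv f z))\<^sup>2 \<partial>\<mu>)"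
    using eq moment_nonneg by (simp add: suminf_ennreal2 suminf_nonneg)
  ultimately have s: "(\<lambda>n. (cmod (b n))\<^sup>2 * moment 1 n) sums (\<integral>z. (cmod (deriv f z))\<^sup>2 \<partial>\<mu>)"
    by (simp add: sums_iff)
  have "(cmod (dirichlet_inner \<alpha> f (basis (Suc n))))\<^sup>2 = (cmod (b n))\<^sup>2 * moment 1 n" for n
    by (subst inner_basis_Suc[OF f b]) (auto simp: norm_mult power_mult_distrib moment_nonneg)
  then have "(\<lambda>n. (cmod (dirichlet_inner \<alpha> f (basis (Suc n))))\<^sup>2) sums (\<integral>z. (cmod (deriv f z))\<^sup>2 \<partial>\<mu>)"
    using s by simp
  then have "(\<lambda>n. (cmod (dirichlet_inner \<alpha> f (basis n)))\<^sup>2) sums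
      ((\<integral>z. (cmod (deriv f z))\<^sup>2 \<partial>\<mu>) + (cmod (dirichlet_inner \<alpha> f (basis 0)))\<^sup>2)"
    by (rule sums_Suc_iff[THEN iffD1])
  then show ?thesis unfolding Re_inner_self inner_basis_0 by (simp only: add.commute)
qed

lemma D_definite:
  assumes f: "f \<in> D" and 0: "dirichlet_inner \<alpha> f f = 0"
  shows "f = (\<lambda>z. 0)"
proof -
  have "(\<lambda>n. (cmod (dirichlet_inner \<alpha> f (basis n)))\<^sup>2) sums 0" using D_parseval[OF f] 0 by simp
  then have "\<forall>n. (cmod (dirichlet_inner \<alpha> f (basis n)))\<^sup>2 = 0"
    unfolding sums_iff using suminf_eq_zero_iff[of "\<lambda>n. (cmod (dirichlet_inner \<alpha> f (basis n)))\<^sup>2"]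
      zero_le_power2 by blast
  then have z: "dirichlet_inner \<alpha> f (basis n) = 0" for n by simp
  obtain b where b: "\<And>z. z \<in> ball 0 1 \<Longrightarrow> (\<lambda>n. b n * z ^ n) sums deriv f z" using deriv_series[OF f] by blast
  have "b n = 0" for n using z[of "Suc n"] inner_basis_Suc[OF f b, of n] moment_pos[of n] by simp
  then have d: "deriv f z = 0" if "z \<in> ball 0 1" for z using b[OF that] by (simp add: sums_iff)
  have "f z = 0" for z
  proof (cases "z \<in> ball 0 1")
    case True
    have "\<And>x. x \<in> ball 0 1 \<Longrightarrow> (f has_field_derivative 0) (at x within ball 0 1)"
      using D_has_deriv[OF f] d by (metis has_field_derivative_at_within)
    then obtain c where "\<And>x. x \<in> ball 0 1 \<Longrightarrow> f x = c"
      using has_field_derivative_zero_constant[OF convex_ball] by metis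
    then show ?thesis using z[of 0] True inner_basis_0[of f] by (metis centre_in_ball zero_less_one)
  qed (simp add: D_zero[OF f])
  then show ?thesis by blast
qed

lemma inner_basis_basis: "dirichlet_inner \<alpha> (basis m) (basis n) = (if m = n then 1 else 0)"
proof -
  have *: "dirichlet_inner \<alpha> (basis m) (basis n) = (if m = n then 1 else 0)" if "m \<ge> n" for m n
  proof (cases m)
    case 0
    then show ?thesis using that by (simp add: inner_basis_0[unfolded basis.simps])
  next
    case (Suc k)
    define b where "b j = (if j = k then 1 / complex_of_real (sqrt (moment 1 k)) else 0)" for j
    have b: "(\<lambda>j. b j * z ^ j) sums deriv (basis (Suc k)) z" if "z \<in> ball 0 1" for z
    proof -
      have "(\<lambda>j. if j = k then of_real (1 / sqrt (moment 1 k)) * z ^ k else 0) sums (of_real (1 / sqrt (moment 1 k)) * z ^ k)"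
        by (rule sums_single)
      also have "(\<lambda>j. if j = k then of_real (1 / sqrt (moment 1 k)) * z ^ k else 0) = (\<lambda>j. b j * z ^ j)"
        by (auto simp: b_def)
      finally show ?thesis using that by (simp only: deriv_basis)
    qed
    show ?thesis
    proof (cases n)
      case 0
      then show ?thesis using Suc inner_basis_0[of "basis m"] by simp
    next
      case n: (Suc i)
      show ?thesis unfolding n Suc using inner_basis_Suc[OF basis_in_D b, of i] moment_pos[of k] moment_pos[of i]
        by (simp add: b_def)
    qed
  qed
  show ?thesis using *[of m n] *[of n m] inner_commute[of "basis m" "basis n"] by (cases "m \<ge> n") auto
qed

text \<open>
  The prescribed coefficients determine a power series \<open>F\<close> for the derivative. It
  converges in the disc because the coefficients are bounded and the moments decay
  slowly; Parseval's identity shows that it is square integrable; its primitive plus a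
  constant is the function sought.
\<close>

lemma D_riesz_fischer:
  assumes C: "\<And>N. (\<Sum>n<N. (cmod (c n))\<^sup>2) \<le> C"
  shows "\<exists>h\<in>D. \<forall>n. dirichlet_inner \<alpha> h (basis n) = c n"
proof -
  define b where "b n = c (Suc n) / of_real (sqrt (moment 1 n))" for n
  define F where "F z = (\<Sum>n. b n * z ^ n)" for z
  have C0: "0 \<le> C" using C[of 0] by simp
  have cb: "cmod (c n) \<le> sqrt C" for n
  proof -
    have "(cmod (c n))\<^sup>2 \<le> (\<Sum>n<Suc n. (cmod (c n))\<^sup>2)" by (simp add: sum_nonneg)
    also have "\<dots> \<le> C" by (rule C)
    finally show ?thesis by (rule real_le_rsqrt)
  qed
  have F: "(\<lambda>n. b n * z ^ n) sums F z" if z: "z \<in> ball 0 1" for z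
  proof -
    obtain r where r: "cmod z < r" "r < 1" using z dense[of "cmod z" 1] by auto
    then have r0: "0 < r" using norm_ge_zero[of z] by linarith
    obtain \<kappa> where \<kappa>: "\<kappa> > 0" "\<And>n. moment 1 n \<ge> \<kappa> * r ^ (2 * n)" using moment_pos_ge[OF r0 r(2)] by blast
    have bound: "norm (b n * z ^ n) \<le> sqrt C / sqrt \<kappa> * (cmod z / r) ^ n" for n
    proof -
      have "sqrt \<kappa> * r ^ n = sqrt (\<kappa> * r ^ (2 * n))"
        using r0 by (simp add: real_sqrt_mult power_mult real_sqrt_power power2_eq_square power_mult_distrib)

      also have "\<dots> \<le> sqrt (moment 1 n)" using \<kappa> by simp
      finally have "cmod (c (Suc n)) / sqrt (moment 1 n) \<le> sqrt C / (sqrt \<kappa> * r ^ n)"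
        using cb[of "Suc n"] \<kappa>(1) r0 C0 by (intro frac_le) auto
      then have "cmod (c (Suc n)) / sqrt (moment 1 n) * cmod z ^ n \<le> sqrt C / (sqrt \<kappa> * r ^ n) * cmod z ^ n"
        by (intro mult_right_mono) auto
      then show ?thesis using moment_nonneg[of 1 n]
        by (simp add: b_def norm_mult norm_divide norm_power power_divide)
    qed
    have "summable (\<lambda>n. sqrt C / sqrt \<kappa> * (cmod z / r) ^ n)"
      using r r0 by (intro summable_mult summable_geometric) auto
    then have "summable (\<lambda>n. b n * z ^ n)" by (rule summable_comparison_test'[OF _ bound])
    then show ?thesis by (simp add: F_def summable_sums)
  qed
  have Fh: "F holomorphic_on ball 0 1" by (rule power_series_holomorphic[of 0 1 b]) (use F in simp)
  have bc: "(cmod (b n))\<^sup>2 * moment 1 n = (cmod (c (Suc n)))\<^sup>2" for n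
    using moment_pos[of n] by (simp add: b_def norm_divide power_divide)
  have "(\<integral>\<^sup>+z. ennreal ((cmod (F z))\<^sup>2) \<partial>\<mu>) = (\<Sum>n. ennreal ((cmod (b n))\<^sup>2 * moment 1 n))"
    by (rule nn_integral_power_series) (rule F)
  also have "\<dots> = (\<Sum>n. ennreal ((cmod (c (Suc n)))\<^sup>2))" unfolding bc ..
  also have "\<dots> \<le> ennreal C"
  proof (rule suminf_le_const)
    fix N
    have "(\<Sum>n<N. (cmod (c (Suc n)))\<^sup>2) \<le> (\<Sum>n<Suc N. (cmod (c n))\<^sup>2)"
      unfolding sum.lessThan_Suc_shift by simp
    also have "\<dots> \<le> C" by (rule C)
    finally show "(\<Sum>n<N. ennreal ((cmod (c (Suc n)))\<^sup>2)) \<le> ennreal C" by (simp add: ennreal_leI)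
  qed auto
  finally have fin: "(\<integral>\<^sup>+z. ennreal ((cmod (F z))\<^sup>2) \<partial>\<mu>) < \<infinity>" using le_less_trans by fastforce
  have Fint: "integrable \<mu> (\<lambda>z. (cmod (F z))\<^sup>2)"
    using holomorphic_imp_mu[OF Fh] fin by (intro integrableI_bounded) auto
  define g where "g = primitive F"
  have g: "g \<in> D" unfolding g_def by (rule primitive_in_D[OF Fh Fint])
  define h where "h = (\<lambda>z. c 0 * basis 0 z + 1 * g z)"
  have h: "h \<in> D" unfolding h_def by (rule D_lincomb[OF basis_in_D g])
  have gs: "(\<lambda>n. b n * z ^ n) sums deriv g z" if "z \<in> ball 0 1" for z
    using F[OF that] deriv_primitive[OF Fh that] by (simp add: g_def)
  have "dirichlet_inner \<alpha> h (basis n) = c n" for n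
  proof (cases n)
    case 0
    have "h 0 = c 0" by (simp add: h_def g_def)
    then show ?thesis unfolding 0 inner_basis_0 .
  next
    case (Suc k)
    have gb: "dirichlet_inner \<alpha> g (basis (Suc k)) = b k * of_real (sqrt (moment 1 k))"
      by (rule inner_basis_Suc[OF g]) (rule gs)
    have "dirichlet_inner \<alpha> h (basis (Suc k)) = c 0 * dirichlet_inner \<alpha> (basis 0) (basis (Suc k)) + 1 * dirichlet_inner \<alpha> g (basis (Suc k))"
      unfolding h_def by (rule inner_lincomb[OF basis_in_D g basis_in_D])
    also have "\<dots> = c (Suc k)"
      unfolding inner_basis_basis gb using moment_pos[of k] by (simp add: b_def)
    finally show ?thesis by (simp add: Suc)
  qed
  then show ?thesis using h by blast
qed

sublocale function_hilbert_space D "dirichlet_inner \<alpha>" basis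
proof (unfold_locales, goal_cases)
  case 1 then show ?case by (rule D_lincomb)
next
  case 2 then show ?case by (rule inner_lincomb)
next
  case 3 show ?case by (rule inner_commute)
next
  case 4 show ?case by (rule basis_in_D)
next
  case 5 show ?case by (rule inner_basis_basis)
next
  case 6 then show ?case by (rule D_parseval)
next
  case 7 then show ?case by (rule D_definite)
next
  case 8 then show ?case by (rule D_riesz_fischer)
qed

lemma nrm_eq: "nrm f = dirichlet_norm \<alpha> f"
  by (simp add: nrm_def norm_eq_sqrt_inner)

lemma dist_eq: "dirichlet_dist \<alpha> = (\<lambda>f g. nrm (\<lambda>z. f z - g z))"
  by (simp add: fun_eq_iff dirichlet_dist_def nrm_eq)

text \<open>
  A metric has to be symmetric on all functions, also on those outside the space. At a
  point where neither function has a derivative, both values of \<open>deriv\<close> are the same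
  default.
\<close>

lemma norm_deriv_uminus: "cmod (deriv (\<lambda>z. - f z) z) = cmod (deriv f z)"
proof (cases "\<exists>d. (f has_field_derivative d) (at z)")
  case True
  then obtain d where d: "(f has_field_derivative d) (at z)" by blast
  show ?thesis using DERIV_imp_deriv[OF d] DERIV_imp_deriv[OF DERIV_minus[OF d]] by simp
next
  case False
  moreover from False have "\<not> (\<exists>d. ((\<lambda>z. - f z) has_field_derivative d) (at z))"
    using DERIV_minus[of "\<lambda>z. - f z" _ z UNIV] by auto
  ultimately show ?thesis by (simp add: deriv_def)
qed

lemma metric_space_D: "Metric_space D (\<lambda>f g. nrm (\<lambda>z. f z - g z))"
proof
  fix f g h
  show "0 \<le> nrm (\<lambda>z. f z - g z)" by (simp add: nrm_eq dirichlet_norm_def)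
  show "nrm (\<lambda>z. f z - g z) = nrm (\<lambda>z. g z - f z)"
    unfolding nrm_eq dirichlet_norm_def
    using norm_deriv_uminus[of "\<lambda>z. f z - g z"] by (simp add: norm_minus_commute)
  assume f: "f \<in> D" and g: "g \<in> D"
  show "nrm (\<lambda>z. f z - g z) = 0 \<longleftrightarrow> f = g" using nrm_eq_0[OF diff_in[OF f g]] by (auto simp: fun_eq_iff)
  assume h: "h \<in> D"
  show "nrm (\<lambda>z. f z - h z) \<le> nrm (\<lambda>z. f z - g z) + nrm (\<lambda>z. g z - h z)"
    using nrm_triangle[OF diff_in[OF f g] diff_in[OF g h]] by simp
qed

section \<open>Uniform estimates for tails\<close>

text \<open>
  Square integrability without holomorphy: multiplication by conjugates of polynomials
  leads outside the holomorphic functions.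
\<close>

definition L2 :: "(complex \<Rightarrow> complex) \<Rightarrow> bool" where
  "L2 F \<longleftrightarrow> F \<in> borel_measurable \<mu> \<and> integrable \<mu> (\<lambda>z. (cmod (F z))\<^sup>2)"

definition L2norm :: "(complex \<Rightarrow> complex) \<Rightarrow> real" where
  "L2norm F = sqrt (\<integral>z. (cmod (F z))\<^sup>2 \<partial>\<mu>)"

lemma L2norm_nonneg: "0 \<le> L2norm F"
  by (simp add: L2norm_def)

lemma L2norm_sq: "(L2norm F)\<^sup>2 = (\<integral>z. (cmod (F z))\<^sup>2 \<partial>\<mu>)"
  by (simp add: L2norm_def)

lemma L2_inner_integrable: "L2 F \<Longrightarrow> L2 G \<Longrightarrow> integrable \<mu> (\<lambda>z. F z * cnj (G z))"
  by (simp add: L2_def L2_product_integrable)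

lemma L2_cauchy_schwarz:
  assumes F: "L2 F" and G: "L2 G"
  shows "cmod (\<integral>z. F z * cnj (G z) \<partial>\<mu>) \<le> L2norm F * L2norm G"
proof -
  note m[measurable] = F[unfolded L2_def, THEN conjunct1] G[unfolded L2_def, THEN conjunct1]
  have int: "integrable \<mu> (\<lambda>z. cmod (F z) * cmod (G z))"
    using integrable_norm[OF L2_inner_integrable[OF F G]] by (simp add: norm_mult)
  have "cmod (\<integral>z. F z * cnj (G z) \<partial>\<mu>) \<le> (\<integral>z. cmod (F z) * cmod (G z) \<partial>\<mu>)" (is "_ \<le> ?I")
    using integral_norm_bound[of \<mu> "\<lambda>z. F z * cnj (G z)"] by (simp add: norm_mult)
  moreover have "?I \<le> L2norm F * L2norm G"
  proof (rule power2_le_imp_le)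
    have I0: "0 \<le> ?I" by (intro Bochner_Integration.integral_nonneg) auto
    have "ennreal (?I\<^sup>2) = (\<integral>\<^sup>+z. ennreal (cmod (F z) * cmod (G z)) \<partial>\<mu>)\<^sup>2"
      using nn_integral_eq_integral[OF int] I0 by (simp add: ennreal_power)
    also have "\<dots> = (\<integral>\<^sup>+z. ennreal (cmod (F z)) * ennreal (cmod (G z)) \<partial>\<mu>)\<^sup>2"
      by (simp add: ennreal_mult)
    also have "\<dots> \<le> (\<integral>\<^sup>+z. ennreal (cmod (F z)) ^ 2 \<partial>\<mu>) * (\<integral>\<^sup>+z. ennreal (cmod (G z)) ^ 2 \<partial>\<mu>)"
      by (rule Cauchy_Schwarz_nn_integral) measurable
    also have "(\<integral>\<^sup>+z. ennreal (cmod (F z)) ^ 2 \<partial>\<mu>) = ennreal ((L2norm F)\<^sup>2)"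
      using F nn_integral_eq_integral[of \<mu> "\<lambda>z. (cmod (F z))\<^sup>2"] by (simp add: L2_def ennreal_power L2norm_sq)
    also have "(\<integral>\<^sup>+z. ennreal (cmod (G z)) ^ 2 \<partial>\<mu>) = ennreal ((L2norm G)\<^sup>2)"
      using G nn_integral_eq_integral[of \<mu> "\<lambda>z. (cmod (G z))\<^sup>2"] by (simp add: L2_def ennreal_power L2norm_sq)
    also have "ennreal ((L2norm F)\<^sup>2) * ennreal ((L2norm G)\<^sup>2) = ennreal ((L2norm F * L2norm G)\<^sup>2)"
      by (simp add: ennreal_mult power_mult_distrib)
    finally show "?I\<^sup>2 \<le> (L2norm F * L2norm G)\<^sup>2" by (subst (asm) ennreal_le_iff) auto
  qed (simp add: L2norm_nonneg)
  ultimately show ?thesis by linarith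
qed

lemma L2_triangle_diff:
  assumes F: "L2 F" and G: "L2 G"
  shows "L2norm (\<lambda>z. F z - G z) \<le> L2norm F + L2norm G"
proof (rule power2_le_imp_le)
  define h where "h z = Re (F z * cnj (G z))" for z
  have eq: "(cmod (F z - G z))\<^sup>2 = (cmod (F z))\<^sup>2 + (cmod (G z))\<^sup>2 - 2 * h z" for z
    unfolding h_def by (simp add: cmod_power2 power2_diff)
  have iR: "integrable \<mu> h"
    unfolding h_def[abs_def] using L2_inner_integrable[OF F G] by (rule integrable_Re)
  have "(L2norm (\<lambda>z. F z - G z))\<^sup>2 = (L2norm F)\<^sup>2 + (L2norm G)\<^sup>2 - 2 * (\<integral>z. h z \<partial>\<mu>)"
    unfolding L2norm_sq eq using F G iR by (simp add: L2_def)
  also have "(\<integral>z. h z \<partial>\<mu>) = Re (\<integral>z. F z * cnj (G z) \<partial>\<mu>)"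
    unfolding h_def[abs_def] using L2_inner_integrable[OF F G] by (rule integral_Re)
  finally have "(L2norm (\<lambda>z. F z - G z))\<^sup>2 = (L2norm F)\<^sup>2 + (L2norm G)\<^sup>2 - 2 * Re (\<integral>z. F z * cnj (G z) \<partial>\<mu>)" .
  moreover have "- Re (\<integral>z. F z * cnj (G z) \<partial>\<mu>) \<le> L2norm F * L2norm G"
    using L2_cauchy_schwarz[OF F G] abs_Re_le_cmod[of "\<integral>z. F z * cnj (G z) \<partial>\<mu>"] by linarith
  ultimately show "(L2norm (\<lambda>z. F z - G z))\<^sup>2 \<le> (L2norm F + L2norm G)\<^sup>2"
    by (simp add: power2_sum)
qed (simp add: L2norm_nonneg)

lemma D_L2: "f \<in> D \<Longrightarrow> L2 (deriv f)"
  by (simp add: L2_def D_deriv_meas D_int)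

lemma nrm_sq_D: "f \<in> D \<Longrightarrow> (nrm f)\<^sup>2 = (cmod (f 0))\<^sup>2 + (L2norm (deriv f))\<^sup>2"
  by (simp add: nrm_sq Re_inner_self L2norm_sq)

lemma nrm_D_vanishing: "f \<in> D \<Longrightarrow> f 0 = 0 \<Longrightarrow> nrm f = L2norm (deriv f)"
  using nrm_sq_D[of f] power2_eq_iff_nonneg[OF nrm_nonneg L2norm_nonneg, of f "deriv f"] by simp

lemma L2norm_le_nrm: "f \<in> D \<Longrightarrow> L2norm (deriv f) \<le> nrm f"
proof (rule power2_le_imp_le)
  assume f: "f \<in> D"
  show "(L2norm (deriv f))\<^sup>2 \<le> (nrm f)\<^sup>2" unfolding nrm_sq_D[OF f] by simp
  show "0 \<le> nrm f" by (rule nrm_nonneg[OF f])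
qed

lemma L2norm_cong: "(\<And>z. z \<in> ball 0 1 \<Longrightarrow> F z = G z) \<Longrightarrow> L2norm F = L2norm G"
  unfolding L2norm_def by (intro arg_cong[where f = sqrt] Bochner_Integration.integral_cong) (auto simp: space_mu)

lemma D_eqI:
  assumes "f \<in> D" "g \<in> D" "f 0 = g 0" "\<And>z. z \<in> ball 0 1 \<Longrightarrow> deriv f z = deriv g z"
  shows "f = g"
proof -
  have d: "(\<lambda>z. f z - g z) \<in> D" using assms by (intro diff_in)
  have "deriv (\<lambda>z. f z - g z) z = 0" if "z \<in> ball 0 1" for z
    using deriv_lincomb[OF assms(1,2) that, of 1 "-1"] assms(4)[OF that] by simp
  then have "L2norm (deriv (\<lambda>z. f z - g z)) = L2norm (\<lambda>_. 0)" by (intro L2norm_cong)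
  then have "nrm (\<lambda>z. f z - g z) = 0" using nrm_D_vanishing[OF d] assms(3) by (simp add: L2norm_def)
  then show ?thesis using nrm_eq_0[OF d] by (simp add: fun_eq_iff)
qed

text \<open>
  One summable sequence bounds the rescaled Taylor coefficients of the derivatives of
  all \<open>f\<close> in the unit ball. Indeed the coefficient at \<open>n\<close> is at most
  \<open>nrm f / sqrt (moment 1 n)\<close> by Cauchy-Schwarz, and the moments decay more slowly than
  \<open>\<rho> ^ (2 * n)\<close> for some \<open>\<rho>\<close> between \<open>r\<close> and 1.
\<close>

lemma taylor_coeff_bound:
  assumes r: "0 < r" "r < 1"
  shows "\<exists>u. summable u \<and> (\<forall>n. 0 \<le> u n) \<and>
    (\<forall>f\<in>D. \<forall>b. (\<forall>z\<in>ball 0 1. (\<lambda>n. b n * z ^ n) sums deriv f z) \<longrightarrow>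
       (\<forall>n. cmod (b n) * r ^ n \<le> nrm f * u n))"
proof -
  obtain \<rho> where \<rho>: "r < \<rho>" "\<rho> < 1" using r dense by blast
  then have \<rho>0: "0 < \<rho>" using r by linarith
  obtain \<kappa> where \<kappa>: "\<kappa> > 0" "\<And>n. moment 1 n \<ge> \<kappa> * \<rho> ^ (2 * n)" using moment_pos_ge[OF \<rho>0 \<rho>(2)] by blast
  show ?thesis
  proof (intro exI[of _ "\<lambda>n. (r / \<rho>) ^ n / sqrt \<kappa>"] conjI allI ballI impI)
    show "summable (\<lambda>n. (r / \<rho>) ^ n / sqrt \<kappa>)"
      using r \<rho> by (intro summable_divide summable_geometric) auto
    show "0 \<le> (r / \<rho>) ^ n / sqrt \<kappa>" for n using r \<rho>0 \<kappa> by simp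
    fix f b n assume f: "f \<in> D" and b: "\<forall>z\<in>ball 0 1. (\<lambda>n. b n * z ^ n) sums deriv f z"
    have "sqrt \<kappa> * \<rho> ^ n = sqrt (\<kappa> * \<rho> ^ (2 * n))"
      using \<rho>0 by (simp add: real_sqrt_mult power_mult real_sqrt_power power2_eq_square power_mult_distrib)
    also have "\<dots> \<le> sqrt (moment 1 n)" using \<kappa> by simp
    finally have 1: "sqrt \<kappa> * \<rho> ^ n \<le> sqrt (moment 1 n)" .
    have "dirichlet_inner \<alpha> f (basis (Suc n)) = b n * of_real (sqrt (moment 1 n))"
      by (rule inner_basis_Suc[OF f b[rule_format]])
    then have "cmod (b n) * sqrt (moment 1 n) \<le> nrm f"
      using cauchy_schwarz[OF f basis_in_D, of "Suc n"] moment_nonneg by (simp add: norm_mult nrm_e)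
    moreover have "cmod (b n) * (sqrt \<kappa> * \<rho> ^ n) \<le> cmod (b n) * sqrt (moment 1 n)"
      using 1 by (intro mult_left_mono) auto
    ultimately have "cmod (b n) * (sqrt \<kappa> * \<rho> ^ n) \<le> nrm f" by linarith
    then have "cmod (b n) * (sqrt \<kappa> * \<rho> ^ n) * (r ^ n / (sqrt \<kappa> * \<rho> ^ n)) \<le> nrm f * (r ^ n / (sqrt \<kappa> * \<rho> ^ n))"
      using r \<rho>0 \<kappa> by (intro mult_right_mono) auto
    then show "cmod (b n) * r ^ n \<le> nrm f * ((r / \<rho>) ^ n / sqrt \<kappa>)"
      using \<kappa>(1) \<rho>0 by (simp add: power_divide mult.commute)
  qed
qed

lemma series_bound:
  fixes c :: "nat \<Rightarrow> complex"
  assumes s: "(\<lambda>n. c n * z ^ n) sums S" and z: "cmod z \<le> r" and v: "\<And>n. cmod (c n) * r ^ n \<le> v n" "summable v"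
  shows "cmod S \<le> suminf v"
proof -
  have b: "norm (c n * z ^ n) \<le> v n" for n
  proof -
    have "norm (c n * z ^ n) \<le> cmod (c n) * r ^ n"
      using z by (auto simp: norm_mult norm_power intro!: mult_left_mono power_mono)
    then show ?thesis using v(1)[of n] by linarith
  qed
  have "S = (\<Sum>n. c n * z ^ n)" using s by (simp add: sums_iff)
  also have "cmod \<dots> \<le> suminf v" by (rule norm_suminf_le[OF b v(2)])
  finally show ?thesis .
qed

lemma deriv_bound:
  assumes "r < 1"
  obtains C where "C \<ge> 0" "\<And>f z. f \<in> D \<Longrightarrow> cmod z \<le> r \<Longrightarrow> cmod (deriv f z) \<le> C * nrm f"
proof -
  define r' where "r' = max r (1/2)"
  have r': "0 < r'" "r' < 1" using assms by (auto simp: r'_def)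
  obtain u where u1: "summable u" and u2: "\<forall>n. 0 \<le> u n" and u3: "\<forall>f\<in>D. \<forall>b.
      (\<forall>z\<in>ball 0 1. (\<lambda>n. b n * z ^ n) sums deriv f z) \<longrightarrow> (\<forall>n. cmod (b n) * r' ^ n \<le> nrm f * u n)"
    using taylor_coeff_bound[OF r'] by (elim exE conjE) (rule that)
  show ?thesis
  proof (rule that[of "suminf u"])
    show "suminf u \<ge> 0" using u2 by (intro suminf_nonneg u1) auto
    fix f z assume f: "f \<in> D" and z: "cmod z \<le> r"
    obtain b where b: "\<And>z. z \<in> ball 0 1 \<Longrightarrow> (\<lambda>n. b n * z ^ n) sums deriv f z" using deriv_series[OF f] by blast
    have "z \<in> ball 0 1" "cmod z \<le> r'" using z assms by (auto simp: r'_def)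
    moreover have "cmod (b n) * r' ^ n \<le> nrm f * u n" for n using u3 f b by blast
    ultimately have "cmod (deriv f z) \<le> (\<Sum>n. nrm f * u n)"
      by (intro series_bound[OF b _ _ summable_mult[OF u1]])
    then show "cmod (deriv f z) \<le> suminf u * nrm f" using suminf_mult[OF u1, of "nrm f"] by (simp add: mult.commute)
  qed
qed

text \<open>
  On compact subsets of the disc the derivatives of tails are small, uniformly for \<open>f\<close>
  in the unit ball, even after division by \<open>z ^ k\<close>: tails have no Taylor coefficients of
  low order, and the others are bounded by a remainder of a convergent series. The
  factor \<open>z ^ k\<close> is used in the comparison of \<open>V p\<close> with its adjoint; elsewhere \<open>k = 0\<close>.
\<close>

lemma tail_factor:
  assumes "r < 1" "\<epsilon> > 0"
  obtains N0 where "\<And>N f. N0 \<le> N \<Longrightarrow> f \<in> D \<Longrightarrow> R N f 0 = 0 \<and> (\<exists>X. X holomorphic_on ball 0 1 \<and>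
     (\<forall>z\<in>ball 0 1. deriv (R N f) z = z ^ k * X z) \<and> (\<forall>z. cmod z \<le> r \<longrightarrow> cmod (X z) \<le> \<epsilon> * nrm f))"
proof -
  \<comment> \<open>A positive radius is needed, as its powers appear as divisors.\<close>
  define r' where "r' = max r (1/2)"
  have r': "0 < r'" "r' < 1" using assms by (auto simp: r'_def)
  obtain u where u1: "summable u" and u2: "\<forall>n. 0 \<le> u n" and u3: "\<forall>f\<in>D. \<forall>b.
      (\<forall>z\<in>ball 0 1. (\<lambda>n. b n * z ^ n) sums deriv f z) \<longrightarrow> (\<forall>n. cmod (b n) * r' ^ n \<le> nrm f * u n)"
    using taylor_coeff_bound[OF r'] by (elim exE conjE) (rule that)
  have "(\<lambda>N. \<Sum>n. u (n + N)) \<longlonglongrightarrow> 0" by (rule suminf_exist_split2[OF u1])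
  then have "eventually (\<lambda>N. (\<Sum>n. u (n + N)) < \<epsilon> * r' ^ k) sequentially"
    using assms r' by (intro order_tendstoD) auto
  then obtain N1 where N1: "\<And>N. N \<ge> N1 \<Longrightarrow> (\<Sum>n. u (n + N)) < \<epsilon> * r' ^ k"
    by (auto simp: eventually_sequentially)
  show ?thesis
  proof (rule that[of "Suc (N1 + k)"], intro conjI)
    fix N f assume N: "Suc (N1 + k) \<le> N" and f: "f \<in> D"
    have Rf: "R N f \<in> D" using R_in[OF f] .
    have "R N f 0 = dirichlet_inner \<alpha> (R N f) (basis 0)" by (rule inner_basis_0[symmetric])
    also have "\<dots> = 0" using N f by (subst ip_R) auto
    finally show "R N f 0 = 0" .
    obtain b where b: "\<And>z. z \<in> ball 0 1 \<Longrightarrow> (\<lambda>n. b n * z ^ n) sums deriv (R N f) z" using deriv_series[OF Rf] by blast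
    have b0: "b n = 0" if "Suc n < N" for n
    proof -
      have "dirichlet_inner \<alpha> (R N f) (basis (Suc n)) = b n * of_real (sqrt (moment 1 n))"
        by (rule inner_basis_Suc[OF Rf]) (rule b)
      moreover have "dirichlet_inner \<alpha> (R N f) (basis (Suc n)) = 0" using that f by (subst ip_R) auto
      ultimately show ?thesis using moment_pos[of n] by simp
    qed
    \<comment> \<open>The coefficients of \<open>X\<close> are those of the derivative shifted by \<open>k\<close>; they vanish up to
      index \<open>N - k - 2\<close>.\<close>
    define v where "v n = (if n + k + 1 < N then 0 else nrm (R N f) * u (n + k) / r' ^ k)" for n
    have bv: "cmod (b (n + k)) * r' ^ n \<le> v n" for n
    proof (cases "n + k + 1 < N")
      case True then show ?thesis using b0[of "n + k"] by (simp add: v_def)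
    next
      case False
      have "cmod (b (n + k)) * r' ^ (n + k) \<le> nrm (R N f) * u (n + k)" using u3 Rf b by blast
      then show ?thesis using r' False by (simp add: v_def power_add field_simps)
    qed
    have su: "summable (\<lambda>n. nrm (R N f) * u (n + k) / r' ^ k)"
      using u1 by (intro summable_divide summable_mult) (simp add: summable_iff_shift)
    have sv: "summable v"
      using nrm_nonneg[OF Rf] u2 r' by (intro summable_comparison_test'[OF su, of 0]) (auto simp: v_def)
    have "suminf v \<le> \<epsilon> * nrm f"
    proof -
      obtain q where q: "N = Suc (q + k)" "q \<ge> N1" using N by (intro that[of "N - Suc k"]) auto
      have "suminf v = (\<Sum>n. v (n + q)) + (\<Sum>n<q. v n)" by (rule suminf_split_initial_segment[OF sv])
      also have "(\<Sum>n<q. v n) = 0" using q by (intro sum.neutral) (auto simp: v_def)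
      also have "(\<Sum>n. v (n + q)) = (\<Sum>n. nrm (R N f) / r' ^ k * u (n + (q + k)))"
        using q by (intro suminf_cong) (auto simp: v_def add.assoc)
      also have "\<dots> = nrm (R N f) / r' ^ k * (\<Sum>n. u (n + (q + k)))"
        using u1 by (intro suminf_mult) (simp add: summable_iff_shift)
      also have "\<dots> \<le> nrm (R N f) / r' ^ k * (\<epsilon> * r' ^ k)"
        using N1[of "q + k"] q nrm_nonneg[OF Rf] r' by (intro mult_left_mono) auto
      also have "\<dots> = \<epsilon> * nrm (R N f)" using r' by simp
      also have "\<dots> \<le> \<epsilon> * nrm f" using nrm_R_le[OF f] assms by (intro mult_left_mono) auto
      finally show ?thesis by simp
    qed
    define X where "X z = (\<Sum>n. b (n + k) * z ^ n)" for z
    have X: "(\<lambda>n. b (n + k) * z ^ n) sums X z" if z: "z \<in> ball 0 1" for z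
    proof (cases "z = 0")
      case True
      then show ?thesis unfolding X_def by (intro summable_sums) (rule summable_finite[of "{0}"], auto)
    next
      case False
      have "summable (\<lambda>n. b (n + k) * z ^ (n + k))"
        using sums_summable[OF b[OF z]] summable_iff_shift[of "\<lambda>n. b n * z ^ n" k] by simp
      then have "summable (\<lambda>n. b (n + k) * z ^ (n + k) / z ^ k)" by (rule summable_divide)
      then show ?thesis unfolding X_def using False by (intro summable_sums) (simp add: power_add)
    qed
    show "\<exists>X. X holomorphic_on ball 0 1 \<and> (\<forall>z\<in>ball 0 1. deriv (R N f) z = z ^ k * X z) \<and>
       (\<forall>z. cmod z \<le> r \<longrightarrow> cmod (X z) \<le> \<epsilon> * nrm f)"
    proof (intro exI conjI ballI allI impI)
      show "X holomorphic_on ball 0 1" by (rule power_series_holomorphic[of 0 1 "\<lambda>n. b (n + k)"]) (use X in simp)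
      show "deriv (R N f) z = z ^ k * X z" if z: "z \<in> ball 0 1" for z
      proof -
        have "(\<lambda>n. z ^ k * (b (n + k) * z ^ n)) sums (z ^ k * X z)" by (intro sums_mult X z)
        then have "(\<lambda>n. b (n + k) * z ^ (n + k)) sums (z ^ k * X z)" by (simp add: power_add mult_ac)
        then have "(\<lambda>n. b n * z ^ n) sums (z ^ k * X z + (\<Sum>n<k. b n * z ^ n))"
          using sums_iff_shift[of "\<lambda>n. b n * z ^ n" k] by simp
        moreover have "(\<Sum>n<k. b n * z ^ n) = 0" using b0 N by (intro sum.neutral) auto
        ultimately show ?thesis using b[OF z] sums_unique2 by fastforce
      qed
      show "cmod (X z) \<le> \<epsilon> * nrm f" if z: "cmod z \<le> r" for z
      proof -
        have "z \<in> ball 0 1" "cmod z \<le> r'" using z assms by (auto simp: r'_def)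
        then have "cmod (X z) \<le> suminf v" using series_bound[OF X _ bv sv] by blast
        then show ?thesis using \<open>suminf v \<le> \<epsilon> * nrm f\<close> by linarith
      qed
    qed
  qed
qed

lemma increment_bound:
  assumes f: "f \<in> D" and w: "w \<in> ball 0 1" and B: "\<And>z. cmod z \<le> cmod w \<Longrightarrow> cmod (deriv f z) \<le> B"
  shows "cmod (f w - f 0) \<le> B"
proof -
  have "norm (f w - f 0) \<le> B * norm (w - 0)"
  proof (rule field_differentiable_bound[where S = "cball 0 (cmod w)"])
    fix z :: complex assume "z \<in> cball 0 (cmod w)"
    then have "z \<in> ball 0 1" using w by auto
    then show "(f has_field_derivative deriv f z) (at z within cball 0 (cmod w))"
      using D_has_deriv[OF f] has_field_derivative_at_within by blast
  qed (use B in auto)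
  also have "\<dots> \<le> B"
    using B[of 0] w norm_ge_zero[of "deriv f 0"] by (auto intro!: mult_left_le order_trans[OF norm_ge_zero])
  finally show ?thesis .
qed

lemma eval_bound:
  assumes w: "w \<in> ball 0 1"
  obtains C where "\<And>f. f \<in> D \<Longrightarrow> cmod (f w) \<le> C * nrm f"
proof -
  obtain C where C: "C \<ge> 0" "\<And>f z. f \<in> D \<Longrightarrow> cmod z \<le> cmod w \<Longrightarrow> cmod (deriv f z) \<le> C * nrm f"
    using deriv_bound[of "cmod w"] w by auto
  have "cmod (f w) \<le> (C + 1) * nrm f" if f: "f \<in> D" for f
  proof -
    have "cmod (f 0) \<le> nrm f" using cauchy_schwarz[OF f basis_in_D, of 0] nrm_e[of 0] by (simp add: inner_basis_0 del: basis.simps)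
    moreover have "cmod (f w - f 0) \<le> C * nrm f" by (rule increment_bound[OF f w C(2)[OF f]])
    ultimately show ?thesis using norm_triangle_sub[of "f w" "f 0"] by (simp add: algebra_simps)
  qed
  then show ?thesis using that by blast
qed

section \<open>Composition operators and multiplication of the derivative\<close>

text \<open>
  The bound on the weights together with injectivity makes composition bounded on the
  space, by change of variables.
\<close>

definition univalent :: "(complex \<Rightarrow> complex) \<Rightarrow> bool" where
  "univalent \<phi> \<longleftrightarrow> \<phi> holomorphic_on ball 0 1 \<and> inj_on \<phi> (ball 0 1) \<and> \<phi> ` ball 0 1 \<subseteq> ball 0 1 \<and>
     (\<exists>C. \<forall>z\<in>ball 0 1. weight z \<le> C * weight (\<phi> z))"

abbreviation "Comp \<equiv> composition_operator"

lemma univalent_ball: "univalent \<phi> \<Longrightarrow> z \<in> ball 0 1 \<Longrightarrow> \<phi> z \<in> ball 0 1"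
  unfolding univalent_def by blast

lemma univalentD:
  assumes "univalent \<phi>"
  obtains C where "C > 0" "\<And>z. z \<in> ball 0 1 \<Longrightarrow> weight z \<le> C * weight (\<phi> z)"
proof -
  obtain C where C: "\<forall>z\<in>ball 0 1. weight z \<le> C * weight (\<phi> z)" using assms unfolding univalent_def by blast
  have "weight z \<le> max C 1 * weight (\<phi> z)" if "z \<in> ball 0 1" for z
    using C that mult_right_mono[of C "max C 1" "weight (\<phi> z)"] weight_nonneg[of "\<phi> z"] by force
  then show ?thesis by (intro that[of "max C 1"]) auto
qed

lemma Comp_has_derivative:
  assumes u: "univalent \<phi>" and f: "f \<in> D" and z: "z \<in> ball 0 1"
  shows "(Comp \<phi> f has_field_derivative deriv f (\<phi> z) * deriv \<phi> z) (at z)"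
proof -
  have "(\<phi> has_field_derivative deriv \<phi> z) (at z)"
    using u z by (intro holomorphic_derivI[where S = "ball 0 1"]) (auto simp: univalent_def)
  from DERIV_chain2[OF D_has_deriv[OF f univalent_ball[OF u z]] this]
  have d: "((\<lambda>x. f (\<phi> x)) has_field_derivative deriv f (\<phi> z) * deriv \<phi> z) (at z)" .
  show ?thesis
  proof (rule DERIV_cong_ev[THEN iffD2, OF refl _ refl d])
    show "eventually (\<lambda>x. Comp \<phi> f x = f (\<phi> x)) (nhds z)"
      using eventually_nhds_in_open[OF open_ball z] by eventually_elim (simp add: composition_operator_def)
  qed
qed

lemma deriv_Comp:
  "univalent \<phi> \<Longrightarrow> f \<in> D \<Longrightarrow> z \<in> ball 0 1 \<Longrightarrow> deriv (Comp \<phi> f) z = deriv f (\<phi> z) * deriv \<phi> z"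
  using Comp_has_derivative DERIV_imp_deriv by blast

text \<open>
  The change of variables for square-integrable \<open>F\<close>, with real integrals; boundedness of
  \<open>b\<close> yields the integrability that these need.
\<close>

lemma substitution_integral_le:
  assumes u: "univalent \<phi>" and F: "L2 F"
    and g: "g \<in> borel_measurable borel" "\<And>u. 0 \<le> g u" and b: "b \<in> borel_measurable borel" "\<And>u. 0 \<le> b u"
    and B: "\<And>u. u \<in> ball 0 1 \<Longrightarrow> b u \<le> B"
    and wb: "\<And>z. z \<in> ball 0 1 \<Longrightarrow> g (\<phi> z) * weight z \<le> b (\<phi> z) * weight (\<phi> z)"
  shows "integrable \<mu> (\<lambda>z. (cmod (deriv \<phi> z))\<^sup>2 * (g (\<phi> z) * (cmod (F (\<phi> z)))\<^sup>2))" (is ?int)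
    and "integrable \<mu> (\<lambda>z. b z * (cmod (F z))\<^sup>2)"
    and "(\<integral>z. (cmod (deriv \<phi> z))\<^sup>2 * (g (\<phi> z) * (cmod (F (\<phi> z)))\<^sup>2) \<partial>\<mu>) \<le> (\<integral>z. b z * (cmod (F z))\<^sup>2 \<partial>\<mu>)"
proof -
  have hol: "\<phi> holomorphic_on ball 0 1" and inj: "inj_on \<phi> (ball 0 1)" and im: "\<phi> ` ball 0 1 \<subseteq> ball 0 1"
    using u by (auto simp: univalent_def)
  have Fm: "F \<in> borel_measurable \<mu>" and Fi: "integrable \<mu> (\<lambda>z. (cmod (F z))\<^sup>2)" using F by (auto simp: L2_def)
  have Hm: "(\<lambda>z. (cmod (F z))\<^sup>2) \<in> borel_measurable \<mu>" using Fm by measurable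
  show ib: "integrable \<mu> (\<lambda>z. b z * (cmod (F z))\<^sup>2)"
  proof (rule Bochner_Integration.integrable_bound)
    show "integrable \<mu> (\<lambda>z. B * (cmod (F z))\<^sup>2)" using Fi by simp
    show "(\<lambda>z. b z * (cmod (F z))\<^sup>2) \<in> borel_measurable \<mu>"
      by (rule borel_measurable_times[OF borel_imp_mu[OF b(1)] Hm])
    show "AE z in \<mu>. norm (b z * (cmod (F z))\<^sup>2) \<le> norm (B * (cmod (F z))\<^sup>2)"
    proof (rule AE_I2)
      fix z assume "z \<in> space \<mu>"
      then have "0 \<le> b z" "b z \<le> B" using B b(2) by (auto simp: space_mu)
      then show "norm (b z * (cmod (F z))\<^sup>2) \<le> norm (B * (cmod (F z))\<^sup>2)"
        by (auto simp: abs_mult intro!: mult_right_mono)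
    qed
  qed
  have fphi: "(\<lambda>z. F (\<phi> z)) \<in> borel_measurable \<mu>"
    by (rule measurable_compose[OF measurable_self_map[OF hol im] Fm])
  have gphi: "(\<lambda>z. g (\<phi> z)) \<in> borel_measurable \<mu>"
    by (rule measurable_compose[OF holomorphic_imp_mu[OF hol] g(1)])
  have dphi: "deriv \<phi> \<in> borel_measurable \<mu>" by (intro holomorphic_imp_mu holomorphic_deriv hol) simp
  have m: "(\<lambda>z. (cmod (deriv \<phi> z))\<^sup>2 * (g (\<phi> z) * (cmod (F (\<phi> z)))\<^sup>2)) \<in> borel_measurable \<mu>"
    using fphi dphi by (intro borel_measurable_times gphi borel_measurable_power measurable_compose[OF _ borel_measurable_norm])
  have le: "(\<integral>\<^sup>+z. ennreal ((cmod (deriv \<phi> z))\<^sup>2 * (g (\<phi> z) * (cmod (F (\<phi> z)))\<^sup>2)) \<partial>\<mu>) \<le> ennreal (\<integral>z. b z * (cmod (F z))\<^sup>2 \<partial>\<mu>)"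
  proof -
    have "(\<integral>\<^sup>+z. ennreal ((cmod (deriv \<phi> z))\<^sup>2 * (g (\<phi> z) * (cmod (F (\<phi> z)))\<^sup>2)) \<partial>\<mu>)
        = (\<integral>\<^sup>+z. ennreal ((cmod (deriv \<phi> z))\<^sup>2) * (ennreal (g (\<phi> z)) * ennreal ((cmod (F (\<phi> z)))\<^sup>2)) \<partial>\<mu>)"
      using g(2) by (simp add: ennreal_mult)
    also have "\<dots> \<le> (\<integral>\<^sup>+z. ennreal (b z) * ennreal ((cmod (F z))\<^sup>2) \<partial>\<mu>)"
    proof (rule nn_integral_mu_substitution_le[OF hol inj im])
      show "(\<lambda>z. ennreal ((cmod (F z))\<^sup>2)) \<in> borel_measurable \<mu>" using Hm by measurable
      show "(\<lambda>u. ennreal (b u)) \<in> borel_measurable borel" using b(1) by measurable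
      show "(\<lambda>u. ennreal (g u)) \<in> borel_measurable borel" using g(1) by measurable
      show "ennreal (g (\<phi> z)) * ennreal (weight z) \<le> ennreal (b (\<phi> z)) * ennreal (weight (\<phi> z))" if "z \<in> ball 0 1" for z
        using wb[OF that] g(2) b(2) weight_nonneg by (simp add: ennreal_mult[symmetric] ennreal_leI)
    qed
    also have "\<dots> = (\<integral>\<^sup>+z. ennreal (b z * (cmod (F z))\<^sup>2) \<partial>\<mu>)" using b(2) by (simp add: ennreal_mult)
    also have "\<dots> = ennreal (\<integral>z. b z * (cmod (F z))\<^sup>2 \<partial>\<mu>)"
      using b(2) by (intro nn_integral_eq_integral ib) auto
    finally show ?thesis .
  qed
  have nn: "0 \<le> (cmod (deriv \<phi> z))\<^sup>2 * (g (\<phi> z) * (cmod (F (\<phi> z)))\<^sup>2)" for z using g(2) by simp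
  show ii: ?int
  proof (rule integrableI_bounded[OF m])
    show "(\<integral>\<^sup>+z. ennreal (norm ((cmod (deriv \<phi> z))\<^sup>2 * (g (\<phi> z) * (cmod (F (\<phi> z)))\<^sup>2))) \<partial>\<mu>) < \<infinity>"
      using le nn by (simp add: le_less_trans[OF _ ennreal_less_top])
  qed
  have "ennreal (\<integral>z. (cmod (deriv \<phi> z))\<^sup>2 * (g (\<phi> z) * (cmod (F (\<phi> z)))\<^sup>2) \<partial>\<mu>) \<le> ennreal (\<integral>z. b z * (cmod (F z))\<^sup>2 \<partial>\<mu>)"
    using le nn_integral_eq_integral[OF ii] nn by simp
  then show "(\<integral>z. (cmod (deriv \<phi> z))\<^sup>2 * (g (\<phi> z) * (cmod (F (\<phi> z)))\<^sup>2) \<partial>\<mu>) \<le> (\<integral>z. b z * (cmod (F z))\<^sup>2 \<partial>\<mu>)"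
    using b(2) by (subst (asm) ennreal_le_iff) (auto intro!: Bochner_Integration.integral_nonneg)
qed

lemma Comp_in_D:
  assumes u: "univalent \<phi>" and f: "f \<in> D" shows "Comp \<phi> f \<in> D"
  unfolding D_iff
proof (intro conjI allI impI)
  show "Comp \<phi> f holomorphic_on ball 0 1"
    using Comp_has_derivative[OF u f] by (subst holomorphic_on_open) blast+
  show "Comp \<phi> f z = 0" if "z \<notin> ball 0 1" for z using that by (simp add: composition_operator_def)
  obtain C where C: "C > 0" "\<And>z. z \<in> ball 0 1 \<Longrightarrow> weight z \<le> C * weight (\<phi> z)" using univalentD[OF u] by blast
  have "integrable \<mu> (\<lambda>z. (cmod (deriv \<phi> z))\<^sup>2 * (1 * (cmod (deriv f (\<phi> z)))\<^sup>2))"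
    using C by (intro substitution_integral_le(1)[OF u D_L2[OF f], where b = "\<lambda>_. C" and B = C]) auto
  then show "integrable \<mu> (\<lambda>z. (cmod (deriv (Comp \<phi> f) z))\<^sup>2)"
    by (rule Bochner_Integration.integrable_cong[THEN iffD1, OF refl, rotated])
      (simp add: space_mu deriv_Comp[OF u f] norm_mult power_mult_distrib mult.commute)
qed

lemma nrm_Comp_le:
  assumes u: "univalent \<phi>" and f: "f \<in> D"
    and b: "b \<in> borel_measurable borel" "\<And>u. 0 \<le> b u" and B: "\<And>u. u \<in> ball 0 1 \<Longrightarrow> b u \<le> B"
    and wb: "\<And>z. z \<in> ball 0 1 \<Longrightarrow> weight z \<le> b (\<phi> z) * weight (\<phi> z)"
  shows "(nrm (Comp \<phi> f))\<^sup>2 \<le> (cmod (f (\<phi> 0)))\<^sup>2 + (\<integral>z. b z * (cmod (deriv f z))\<^sup>2 \<partial>\<mu>)"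
proof -
  have "(L2norm (deriv (Comp \<phi> f)))\<^sup>2 = (\<integral>z. (cmod (deriv \<phi> z))\<^sup>2 * (1 * (cmod (deriv f (\<phi> z)))\<^sup>2) \<partial>\<mu>)"
    unfolding L2norm_sq by (rule Bochner_Integration.integral_cong)
      (simp_all add: space_mu deriv_Comp[OF u f] norm_mult power_mult_distrib mult.commute)
  also have "\<dots> \<le> (\<integral>z. b z * (cmod (deriv f z))\<^sup>2 \<partial>\<mu>)"
    using wb by (intro substitution_integral_le(3)[OF u D_L2[OF f] _ _ b B]) auto
  finally show ?thesis using nrm_sq_D[OF Comp_in_D[OF u f]] by (simp add: composition_operator_def)
qed

lemma Comp_lincomb: "Comp \<phi> (\<lambda>z. a * f z + b * g z) = (\<lambda>z. a * Comp \<phi> f z + b * Comp \<phi> g z)"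
  by (auto simp: composition_operator_def)

lemma bounded_Comp:
  assumes u: "univalent \<phi>" shows "bounded_op (Comp \<phi>)"
proof -
  obtain C where C: "C > 0" "\<And>z. z \<in> ball 0 1 \<Longrightarrow> weight z \<le> C * weight (\<phi> z)" using univalentD[OF u] by blast
  have "\<phi> 0 \<in> ball 0 1" by (rule univalent_ball[OF u]) simp
  then obtain E where E: "\<And>f. f \<in> D \<Longrightarrow> cmod (f (\<phi> 0)) \<le> E * nrm f" using eval_bound by blast
  show ?thesis
  proof (rule bounded_opI[where M = "sqrt (E\<^sup>2 + C)"])
    fix f assume f: "f \<in> D"
    have "(nrm (Comp \<phi> f))\<^sup>2 \<le> (cmod (f (\<phi> 0)))\<^sup>2 + (\<integral>z. C * (cmod (deriv f z))\<^sup>2 \<partial>\<mu>)"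
      using C by (intro nrm_Comp_le[OF u f, where B = C]) auto
    also have "(\<integral>z. C * (cmod (deriv f z))\<^sup>2 \<partial>\<mu>) = C * (L2norm (deriv f))\<^sup>2" by (simp add: L2norm_sq)
    also have "\<dots> \<le> C * (nrm f)\<^sup>2"
      using L2norm_le_nrm[OF f] C(1) L2norm_nonneg by (intro mult_left_mono power_mono) auto
    also have "(cmod (f (\<phi> 0)))\<^sup>2 \<le> (E * nrm f)\<^sup>2" using E[OF f] by (intro power_mono) auto
    finally have "(nrm (Comp \<phi> f))\<^sup>2 \<le> (E\<^sup>2 + C) * (nrm f)\<^sup>2" by (simp add: power_mult_distrib algebra_simps)
    then have "nrm (Comp \<phi> f) \<le> sqrt ((E\<^sup>2 + C) * (nrm f)\<^sup>2)" by (rule real_le_rsqrt)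
    then show "nrm (Comp \<phi> f) \<le> sqrt (E\<^sup>2 + C) * nrm f" using nrm_nonneg[OF f] by (simp add: real_sqrt_mult)
  qed (auto simp: Comp_in_D[OF u] Comp_lincomb)
qed

text \<open>
  The analogue for this space of the analytic Toeplitz operator with symbol \<open>p\<close>. It
  discards the constant term, so that \<open>V 1\<close> fixes exactly the functions that vanish at
  0.
\<close>

definition V :: "complex poly \<Rightarrow> (complex \<Rightarrow> complex) \<Rightarrow> complex \<Rightarrow> complex" where
  "V p f = primitive (\<lambda>z. poly p z * deriv f z)"

lemma poly_bound: obtains B where "B > 0" "\<And>z. z \<in> cball 0 1 \<Longrightarrow> cmod (poly p z) \<le> B"
proof -
  have "compact (poly p ` cball 0 1)" by (intro compact_continuous_image continuous_intros) simp
  then obtain B where "\<forall>x\<in>poly p ` cball 0 1. norm x \<le> B" using compact_imp_bounded bounded_iff by metis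
  then show ?thesis by (intro that[of "max B 1"]) (auto simp: le_max_iff_disj)
qed

lemma L2_bounded_mult:
  assumes F: "L2 F" and a: "a \<in> borel_measurable \<mu>" "\<And>z. z \<in> ball 0 1 \<Longrightarrow> cmod (a z) \<le> B"
  shows "L2 (\<lambda>z. a z * F z)" "L2norm (\<lambda>z. a z * F z) \<le> B * L2norm F"
proof -
  have Fm: "F \<in> borel_measurable \<mu>" and Fi: "integrable \<mu> (\<lambda>z. (cmod (F z))\<^sup>2)" using F by (auto simp: L2_def)
  have m: "(\<lambda>z. a z * F z) \<in> borel_measurable \<mu>" by (rule borel_measurable_times[OF a(1) Fm])
  have le: "(cmod (a z * F z))\<^sup>2 \<le> B\<^sup>2 * (cmod (F z))\<^sup>2" if "z \<in> ball 0 1" for z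
    using a(2)[OF that] by (auto simp: norm_mult power_mult_distrib intro!: mult_right_mono power_mono)
  have i: "integrable \<mu> (\<lambda>z. (cmod (a z * F z))\<^sup>2)"
  proof (rule Bochner_Integration.integrable_bound)
    show "integrable \<mu> (\<lambda>z. B\<^sup>2 * (cmod (F z))\<^sup>2)" using Fi by simp
    show "(\<lambda>z. (cmod (a z * F z))\<^sup>2) \<in> borel_measurable \<mu>"
      using m by (intro borel_measurable_power measurable_compose[OF _ borel_measurable_norm])
    show "AE z in \<mu>. norm ((cmod (a z * F z))\<^sup>2) \<le> norm (B\<^sup>2 * (cmod (F z))\<^sup>2)"
      using le by (intro AE_I2) (auto simp: space_mu)
  qed
  show "L2 (\<lambda>z. a z * F z)" using m i by (simp add: L2_def)
  have B0: "0 \<le> B" using a(2)[of 0] order_trans[OF norm_ge_zero] by (metis centre_in_ball zero_less_one)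
  have "(L2norm (\<lambda>z. a z * F z))\<^sup>2 \<le> (\<integral>z. B\<^sup>2 * (cmod (F z))\<^sup>2 \<partial>\<mu>)"
    unfolding L2norm_sq using le Fi by (intro integral_mono i) (auto simp: space_mu)
  also have "\<dots> = (B * L2norm F)\<^sup>2" by (simp add: L2norm_sq power_mult_distrib)
  finally show "L2norm (\<lambda>z. a z * F z) \<le> B * L2norm F"
    by (rule power2_le_imp_le) (use B0 L2norm_nonneg in auto)
qed

lemma poly_meas: "poly p \<in> borel_measurable \<mu>"
  by (intro continuous_imp_mu continuous_intros)

lemma V_holo: "f \<in> D \<Longrightarrow> (\<lambda>z. poly p z * deriv f z) holomorphic_on ball 0 1"
  by (intro holomorphic_intros D_deriv_holo)

lemma V_in_D: "f \<in> D \<Longrightarrow> V p f \<in> D"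
proof -
  assume f: "f \<in> D"
  obtain B where B: "B > 0" "\<And>z. z \<in> cball 0 1 \<Longrightarrow> cmod (poly p z) \<le> B" using poly_bound by blast
  have "L2 (\<lambda>z. poly p z * deriv f z)"
    using B by (intro L2_bounded_mult(1)[OF D_L2[OF f] poly_meas, of _ B]) auto
  then show ?thesis unfolding V_def by (intro primitive_in_D V_holo f) (auto simp: L2_def)
qed

lemma V_0 [simp]: "V p f 0 = 0"
  by (simp add: V_def)

lemma deriv_V: "f \<in> D \<Longrightarrow> z \<in> ball 0 1 \<Longrightarrow> deriv (V p f) z = poly p z * deriv f z"
  unfolding V_def by (rule deriv_primitive[OF V_holo])

lemma nrm_V: "f \<in> D \<Longrightarrow> nrm (V p f) = L2norm (\<lambda>z. poly p z * deriv f z)"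
  using nrm_D_vanishing[OF V_in_D] L2norm_cong[OF deriv_V] by simp

lemma bounded_V: "bounded_op (V p)"
proof -
  obtain B where B: "B > 0" "\<And>z. z \<in> cball 0 1 \<Longrightarrow> cmod (poly p z) \<le> B" using poly_bound by blast
  show ?thesis
  proof (rule bounded_opI[where M = B])
    fix f assume f: "f \<in> D"
    have "nrm (V p f) \<le> B * L2norm (deriv f)"
      unfolding nrm_V[OF f] using B by (intro L2_bounded_mult(2)[OF D_L2[OF f] poly_meas]) auto
    also have "\<dots> \<le> B * nrm f" using L2norm_le_nrm[OF f] B by (intro mult_left_mono) auto
    finally show "nrm (V p f) \<le> B * nrm f" .
  next
    fix f g a b assume f: "f \<in> D" and g: "g \<in> D"
    show "V p (\<lambda>z. a * f z + b * g z) = (\<lambda>z. a * V p f z + b * V p g z)"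
    proof (rule D_eqI)
      show "deriv (V p (\<lambda>z. a * f z + b * g z)) z = deriv (\<lambda>z. a * V p f z + b * V p g z) z" if z: "z \<in> ball 0 1" for z
        unfolding deriv_V[OF lincomb[OF f g] z] deriv_lincomb[OF f g z] deriv_lincomb[OF V_in_D[OF f] V_in_D[OF g] z]
          deriv_V[OF f z] deriv_V[OF g z] by (simp add: algebra_simps)
    qed (use f g in \<open>auto intro: V_in_D lincomb\<close>)
  qed (rule V_in_D)
qed

section \<open>Domination modulo compact operators\<close>

text \<open>
  The square of \<open>nrm (Comp \<phi> (V p x))\<close> is a point value at \<open>\<phi> 0\<close> plus an integral over
  the image of \<open>\<phi>\<close>. For a tail \<open>x\<close> the point value and the part of the integral over
  \<open>|u| \<le> \<rho>\<close> are small, because derivatives of tails are small on compact sets. In the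
  rest of the integral the hypothesis compares the weights, which bounds it by the
  integral that defines \<open>nrm (V q x)\<close>.
\<close>

lemma ess_dom_Comp_V:
  assumes u: "univalent \<phi>" and \<rho>: "\<rho> < 1"
    and wb: "\<And>z. z \<in> ball 0 1 \<Longrightarrow> \<rho> < cmod (\<phi> z) \<Longrightarrow>
      (cmod (poly p (\<phi> z)))\<^sup>2 * weight z \<le> (cmod (poly q (\<phi> z)))\<^sup>2 * weight (\<phi> z)"
  shows "ess_dom (\<lambda>f. Comp \<phi> (V p f)) (V q)"
  unfolding ess_dom_def
proof (intro allI impI)
  fix \<epsilon> :: real assume eps: "\<epsilon> > 0"
  obtain C where C: "C > 0" "\<And>z. z \<in> ball 0 1 \<Longrightarrow> weight z \<le> C * weight (\<phi> z)" using univalentD[OF u] by blast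
  obtain B where B: "B > 0" "\<And>z. z \<in> cball 0 1 \<Longrightarrow> cmod (poly p z) \<le> B" using poly_bound by blast
  obtain Bq where Bq: "Bq > 0" "\<And>z. z \<in> cball 0 1 \<Longrightarrow> cmod (poly q z) \<le> Bq" using poly_bound by blast
  have p0: "\<phi> 0 \<in> ball 0 1" by (rule univalent_ball[OF u]) simp
  \<comment> \<open>The radius includes \<open>|\<phi> 0|\<close> so that the point value at \<open>\<phi> 0\<close> is small too.\<close>
  define r where "r = max \<rho> (cmod (\<phi> 0))"
  have r: "r < 1" using \<rho> p0 by (simp add: r_def)
  define M0 where "M0 = measure \<mu> (space \<mu>)"
  have M0: "M0 \<ge> 0" by (simp add: M0_def)
  \<comment> \<open>The point value contributes \<open>B^2\<close> and the inner part of the integral \<open>C * B^2 * M0\<close> to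
    the factor of \<open>\<delta>^2\<close>.\<close>
  define E where "E = B\<^sup>2 + C * B\<^sup>2 * M0"
  have E: "E > 0" using C(1) M0 B(1) by (simp add: E_def add_pos_nonneg)
  define \<delta> where "\<delta> = \<epsilon> / sqrt E"
  have \<delta>: "\<delta> > 0" using eps E by (simp add: \<delta>_def)
  have \<delta>2: "\<delta>\<^sup>2 * E = \<epsilon>\<^sup>2" using E by (simp add: \<delta>_def power_divide)
  obtain N where N: "\<And>n f. N \<le> n \<Longrightarrow> f \<in> D \<Longrightarrow> R n f 0 = 0 \<and> (\<exists>X. X holomorphic_on ball 0 1 \<and>
     (\<forall>z\<in>ball 0 1. deriv (R n f) z = z ^ 0 * X z) \<and> (\<forall>z. cmod z \<le> r \<longrightarrow> cmod (X z) \<le> \<delta> * nrm f))"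
    using tail_factor[OF r \<delta>, of 0] by blast
  have "nrm (Comp \<phi> (V p (R N f))) \<le> nrm (V q (R N f)) + \<epsilon> * nrm f" if f: "f \<in> D" for f
  proof -
    define x where "x = R N f"
    have x: "x \<in> D" unfolding x_def by (rule R_in[OF f])
    have Vx: "V p x \<in> D" by (rule V_in_D[OF x])
    have xr: "cmod (deriv x z) \<le> \<delta> * nrm f" if "cmod z \<le> r" for z
    proof -
      obtain X where X: "\<forall>z\<in>ball 0 1. deriv x z = z ^ 0 * X z" "\<forall>z. cmod z \<le> r \<longrightarrow> cmod (X z) \<le> \<delta> * nrm f"
        using N[OF order_refl f] unfolding x_def by blast
      then show "cmod (deriv x z) \<le> \<delta> * nrm f" using that r by simp
    qed
    have "cmod (V p x (\<phi> 0) - V p x 0) \<le> B * (\<delta> * nrm f)"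
    proof (rule increment_bound[OF Vx p0])
      fix z assume z: "cmod z \<le> cmod (\<phi> 0)"
      then have "z \<in> ball 0 1" using p0 by simp
      then have "cmod (deriv (V p x) z) = cmod (poly p z) * cmod (deriv x z)" by (simp add: deriv_V[OF x] norm_mult)
      also have "\<dots> \<le> B * (\<delta> * nrm f)"
        using z xr[of z] B \<open>z \<in> ball 0 1\<close> by (intro mult_mono) (auto simp: r_def le_max_iff_disj)
      finally show "cmod (deriv (V p x) z) \<le> B * (\<delta> * nrm f)" .
    qed
    then have ev: "cmod (V p x (\<phi> 0)) \<le> B * (\<delta> * nrm f)" by simp
    define g where "g u = (cmod (poly p u))\<^sup>2 * indicator (ball 0 1) u" for u :: complex
    define b where "b u = (cmod (poly q u))\<^sup>2 + C * B\<^sup>2 * indicator (cball 0 \<rho>) u" for u :: complex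
    have gm: "g \<in> borel_measurable borel" unfolding g_def
      by (intro borel_measurable_times borel_measurable_power borel_measurable_indicator
          borel_measurable_continuous_onI continuous_intros) auto
    have bm: "b \<in> borel_measurable borel" unfolding b_def
      by (intro borel_measurable_add borel_measurable_power borel_measurable_times borel_measurable_indicator
          borel_measurable_continuous_onI continuous_intros) auto
    have g0: "0 \<le> g u" for u by (simp add: g_def)
    have b0: "0 \<le> b u" for u using C(1) by (simp add: b_def)
    have bB: "b u \<le> Bq\<^sup>2 + C * B\<^sup>2" if "u \<in> ball 0 1" for u
      unfolding b_def using Bq(2)[of u] that C(1) by (intro add_mono power_mono) (auto simp: indicator_def)
    have wb': "g (\<phi> z) * weight z \<le> b (\<phi> z) * weight (\<phi> z)" if z: "z \<in> ball 0 1" for z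
    proof (cases "\<rho> < cmod (\<phi> z)")
      case True
      then show ?thesis using wb[OF z] univalent_ball[OF u z] by (simp add: b_def g_def)
    next
      case False
      have pz: "\<phi> z \<in> ball 0 1" by (rule univalent_ball[OF u z])
      have "g (\<phi> z) * weight z \<le> B\<^sup>2 * (C * weight (\<phi> z))"
        using pz B(2)[of "\<phi> z"] C(2)[OF z] by (intro mult_mono) (auto simp: g_def weight_nonneg intro!: power_mono)
      also have "\<dots> \<le> b (\<phi> z) * weight (\<phi> z)"
        using False mult_nonneg_nonneg[OF zero_le_power2[of "cmod (poly q (\<phi> z))"] weight_nonneg[of "\<phi> z"]]
        by (simp add: b_def algebra_simps)
      finally show ?thesis .
    qed
    have L: "L2 (deriv x)" by (rule D_L2[OF x])
    have di: "integrable \<mu> (\<lambda>z. (cmod (poly q z * deriv x z))\<^sup>2)"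
      using L2_bounded_mult(1)[OF L poly_meas, of q Bq] Bq by (simp add: L2_def)
    have "(L2norm (deriv (Comp \<phi> (V p x))))\<^sup>2 = (\<integral>z. (cmod (deriv \<phi> z))\<^sup>2 * (g (\<phi> z) * (cmod (deriv x (\<phi> z)))\<^sup>2) \<partial>\<mu>)"
      unfolding L2norm_sq
    proof (rule Bochner_Integration.integral_cong[OF refl])
      fix z assume "z \<in> space \<mu>"
      then have z: "z \<in> ball 0 1" by (simp add: space_mu)
      have pz: "\<phi> z \<in> ball 0 1" by (rule univalent_ball[OF u z])
      have "deriv (Comp \<phi> (V p x)) z = poly p (\<phi> z) * deriv x (\<phi> z) * deriv \<phi> z"
        using deriv_Comp[OF u Vx z] deriv_V[OF x pz] by simp
      then show "(cmod (deriv (Comp \<phi> (V p x)) z))\<^sup>2 = (cmod (deriv \<phi> z))\<^sup>2 * (g (\<phi> z) * (cmod (deriv x (\<phi> z)))\<^sup>2)"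
        using pz by (simp add: g_def norm_mult power_mult_distrib mult_ac)
    qed
    also have "\<dots> \<le> (\<integral>z. b z * (cmod (deriv x z))\<^sup>2 \<partial>\<mu>)"
      by (rule substitution_integral_le(3)[OF u L gm g0 bm b0 bB wb'])
    also have "\<dots> \<le> (\<integral>z. (cmod (poly q z * deriv x z))\<^sup>2 + C * B\<^sup>2 * (\<delta> * nrm f)\<^sup>2 \<partial>\<mu>)"
    proof (rule integral_mono)
      show "integrable \<mu> (\<lambda>z. b z * (cmod (deriv x z))\<^sup>2)"
        by (rule substitution_integral_le(2)[OF u L gm g0 bm b0 bB wb'])
      show "integrable \<mu> (\<lambda>z. (cmod (poly q z * deriv x z))\<^sup>2 + C * B\<^sup>2 * (\<delta> * nrm f)\<^sup>2)" using di by simp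
      fix z assume "z \<in> space \<mu>"
      have "C * B\<^sup>2 * indicator (cball 0 \<rho>) z * (cmod (deriv x z))\<^sup>2 \<le> C * B\<^sup>2 * (\<delta> * nrm f)\<^sup>2"
      proof (cases "z \<in> cball 0 \<rho>")
        case True
        then have "cmod z \<le> r" by (simp add: r_def le_max_iff_disj)
        then show ?thesis using True xr[of z] C(1) by (auto intro!: mult_left_mono power_mono)
      qed (use C(1) in auto)
      then show "b z * (cmod (deriv x z))\<^sup>2 \<le> (cmod (poly q z * deriv x z))\<^sup>2 + C * B\<^sup>2 * (\<delta> * nrm f)\<^sup>2"
        unfolding b_def by (simp add: norm_mult power_mult_distrib distrib_right)
    qed
    also have "\<dots> = (nrm (V q x))\<^sup>2 + C * B\<^sup>2 * M0 * (\<delta> * nrm f)\<^sup>2"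
      using di by (simp add: nrm_V[OF x] L2norm_sq M0_def)
    finally have L2: "(L2norm (deriv (Comp \<phi> (V p x))))\<^sup>2 \<le> (nrm (V q x))\<^sup>2 + C * B\<^sup>2 * M0 * (\<delta> * nrm f)\<^sup>2" .
    have CV: "Comp \<phi> (V p x) \<in> D" by (rule Comp_in_D[OF u Vx])
    have "(nrm (Comp \<phi> (V p x)))\<^sup>2 = (cmod (V p x (\<phi> 0)))\<^sup>2 + (L2norm (deriv (Comp \<phi> (V p x))))\<^sup>2"
      unfolding nrm_sq_D[OF CV] by (simp add: composition_operator_def)
    also have "\<dots> \<le> (B * (\<delta> * nrm f))\<^sup>2 + ((nrm (V q x))\<^sup>2 + C * B\<^sup>2 * M0 * (\<delta> * nrm f)\<^sup>2)"
      using L2 ev by (intro add_mono power_mono) auto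
    also have "\<dots> = (nrm (V q x))\<^sup>2 + (\<delta>\<^sup>2 * E) * (nrm f)\<^sup>2"
      by (simp add: E_def power_mult_distrib algebra_simps)
    also have "\<dots> = (nrm (V q x))\<^sup>2 + (\<epsilon> * nrm f)\<^sup>2" unfolding \<delta>2 by (simp add: power_mult_distrib)
    also have "\<dots> \<le> (nrm (V q x) + \<epsilon> * nrm f)\<^sup>2"
      using eps nrm_nonneg[OF V_in_D[OF x]] nrm_nonneg[OF f] by (simp add: power2_sum)
    finally show ?thesis unfolding x_def[symmetric]
      by (rule power2_le_imp_le) (use eps nrm_nonneg[OF V_in_D[OF x]] nrm_nonneg[OF f] in auto)
  qed
  then show "\<exists>N. \<forall>f\<in>D. nrm (Comp \<phi> (V p (R N f))) \<le> nrm (V q (R N f)) + \<epsilon> * nrm f" by blast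
qed

text \<open>
  The case \<open>p = 1\<close>, because \<open>V 1\<close> fixes the functions that vanish at 0, and tails do.
\<close>

lemma ess_dom_Comp:
  assumes u: "univalent \<phi>" and \<rho>: "\<rho> < 1"
    and wb: "\<And>z. z \<in> ball 0 1 \<Longrightarrow> \<rho> < cmod (\<phi> z) \<Longrightarrow> weight z \<le> (cmod (poly q (\<phi> z)))\<^sup>2 * weight (\<phi> z)"
  shows "ess_dom (Comp \<phi>) (V q)"
  unfolding ess_dom_def
proof (intro allI impI)
  fix \<epsilon> :: real assume "\<epsilon> > 0"
  then obtain N where N: "\<And>n f. N \<le> n \<Longrightarrow> f \<in> D \<Longrightarrow>
      nrm (Comp \<phi> (V 1 (R n f))) \<le> nrm (V q (R n f)) + \<epsilon> * nrm f"
    using ess_domD[OF ess_dom_Comp_V[OF u \<rho>, of 1 q]] wb by auto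
  have "nrm (Comp \<phi> (R (Suc N) f)) \<le> nrm (V q (R (Suc N) f)) + \<epsilon> * nrm f" if f: "f \<in> D" for f
  proof -
    have Rf: "R (Suc N) f \<in> D" by (rule R_in[OF f])
    have "R (Suc N) f 0 = dirichlet_inner \<alpha> (R (Suc N) f) (basis 0)" by (rule inner_basis_0[symmetric])
    also have "\<dots> = 0" using f by (subst ip_R) auto
    finally have "V 1 (R (Suc N) f) = R (Suc N) f"
      using Rf by (intro D_eqI V_in_D) (auto simp: deriv_V)
    then show ?thesis using N[of "Suc N" f] f by simp
  qed
  then show "\<exists>N. \<forall>f\<in>D. nrm (Comp \<phi> (R N f)) \<le> nrm (V q (R N f)) + \<epsilon> * nrm f" by blast
qed

text \<open>
  The case of a constant polynomial \<open>q\<close>, since \<open>V\<close> of a constant \<open>m\<close> has norm at most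
  \<open>m\<close>.
\<close>

lemma ess_le_Comp_V:
  assumes u: "univalent \<phi>" and \<rho>: "\<rho> < 1" and m: "0 \<le> m"
    and wb: "\<And>z. z \<in> ball 0 1 \<Longrightarrow> \<rho> < cmod (\<phi> z) \<Longrightarrow> (cmod (poly p (\<phi> z)))\<^sup>2 * weight z \<le> m\<^sup>2 * weight (\<phi> z)"
  shows "ess_le (\<lambda>f. Comp \<phi> (V p f)) m"
proof (rule ess_dom_imp_le[OF ess_dom_Comp_V[OF u \<rho>, of p "[:of_real m:]"] _ m])
  show "ess_le (V [:of_real m:]) m"
    unfolding ess_le_def
  proof (intro allI impI exI ballI)
    fix \<epsilon> :: real and f assume eps: "\<epsilon> > 0" and f: "f \<in> D"
    have x: "R 0 f \<in> D" by (rule R_in[OF f])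
    have "nrm (V [:of_real m:] (R 0 f)) \<le> m * L2norm (deriv (R 0 f))"
      unfolding nrm_V[OF x] using m by (intro L2_bounded_mult(2)[OF D_L2[OF x] poly_meas]) auto
    also have "\<dots> \<le> (m + \<epsilon>) * nrm f"
      using order_trans[OF L2norm_le_nrm[OF x] nrm_R_le[OF f]] m eps L2norm_nonneg by (intro mult_mono) auto
    finally show "nrm (V [:of_real m:] (R 0 f)) \<le> (m + \<epsilon>) * nrm f" .
  qed
qed (use wb m in auto)

text \<open>
  The operator \<open>V p\<close> does not commute with its adjoint, but it is essentially normal,
  and one of the two inequalities is proved here. For a tail \<open>x\<close> let \<open>U = cnj p * x'\<close>,
  which has the same \<open>L2norm\<close> as the derivative \<open>p * x'\<close> of \<open>V p x\<close>. On the circle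
  \<open>cnj (p z) * z ^ k\<close> is a polynomial \<open>q\<close>, so if \<open>x' = z ^ k * X\<close> then \<open>U\<close> differs from
  the holomorphic function \<open>q * X = y'\<close> by \<open>E = d * X\<close>, where \<open>d\<close> vanishes on the
  circle. This error is small: \<open>X\<close> is small inside the disc and \<open>d\<close> is small near the
  circle. As the inner product of \<open>U\<close> with \<open>y'\<close> is that of \<open>W x\<close> with \<open>y\<close>, the square of
  the norm of \<open>U\<close> is at most \<open>nrm (W x) * nrm y\<close> up to a small error, while \<open>nrm y\<close> is
  close to the norm of \<open>U\<close>; division by the latter gives the claim.
\<close>

lemma ess_dom_V_adjoint:
  assumes ad: "adjoint_pair (V p) W"
  shows "ess_dom (V p) W"
  unfolding ess_dom_def
proof (intro allI impI)
  fix \<epsilon> :: real assume eps: "\<epsilon> > 0"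
  define k where "k = degree p"
  \<comment> \<open>The coefficients of \<open>q\<close> are those of \<open>p\<close>, conjugated and in reverse order.\<close>
  define q where "q = reflect_poly (map_poly cnj p)"
  define d where "d z = cnj (poly p z) * z ^ k - poly q z" for z
  have d0: "d z = 0" if z: "cmod z = 1" for z
  proof -
    have zz: "inverse z = cnj z" using z complex_norm_square[of z] by (intro inverse_unique) simp
    have "poly q z = z ^ degree (map_poly cnj p) * poly (map_poly cnj p) (cnj z)"
      unfolding q_def using z zz by (subst poly_reflect_poly_nz) auto
    also have "degree (map_poly cnj p) = k" by (simp add: k_def degree_map_poly)
    also have "poly (map_poly cnj p) (cnj z) = cnj (poly p z)" by (rule poly_cnj[symmetric])
    finally show ?thesis by (simp add: d_def mult.commute)
  qed
  have dc: "continuous_on UNIV d" unfolding d_def by (intro continuous_intros)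
  obtain Bd where Bd: "Bd > 0" "\<And>z. z \<in> cball 0 1 \<Longrightarrow> cmod (d z) \<le> Bd"
  proof -
    have "compact (d ` cball 0 1)" by (intro compact_continuous_image continuous_on_subset[OF dc]) auto
    then obtain B where "\<forall>x\<in>d ` cball 0 1. norm x \<le> B" using compact_imp_bounded bounded_iff by metis
    then show ?thesis by (intro that[of "max B 1"]) (auto simp: le_max_iff_disj)
  qed
  define \<eta> where "\<eta> = \<epsilon> / (4 * 2 ^ k)"
  have \<eta>: "\<eta> > 0" using eps by (simp add: \<eta>_def)
  \<comment> \<open>Beyond radius \<open>1/2\<close> the division by \<open>z ^ k\<close> costs at most a factor \<open>2 ^ k\<close>, which \<open>\<eta>\<close>
    compensates.\<close>
  obtain \<rho> where \<rho>: "1/2 \<le> \<rho>" "\<rho> < 1" "\<And>z. \<rho> < cmod z \<Longrightarrow> cmod z < 1 \<Longrightarrow> cmod (d z) \<le> \<eta>"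
  proof -
    define K where "K = {z \<in> cball 0 1. \<eta> \<le> cmod (d z)}"
    have "closed {z. \<eta> \<le> cmod (d z)}" by (intro closed_Collect_le continuous_intros dc)
    moreover have "K = cball 0 1 \<inter> {z. \<eta> \<le> cmod (d z)}" by (auto simp: K_def)
    ultimately have "compact K" using compact_Int_closed[OF compact_cball] by metis
    show ?thesis
    proof (cases "K = {}")
      case True
      show ?thesis
      proof (rule that[of "1/2"])
        fix z :: complex assume z: "cmod z < 1"
        have "z \<notin> K" using True by simp
        then show "cmod (d z) \<le> \<eta>" using z by (simp add: K_def)
      qed auto
    next
      case False
      obtain z0 where z0: "z0 \<in> K" "\<And>z. z \<in> K \<Longrightarrow> cmod z \<le> cmod z0"
        using continuous_attains_sup[OF \<open>compact K\<close> False, of cmod] by (auto intro: continuous_intros)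
      have "cmod z0 \<noteq> 1" using z0(1) d0[of z0] \<eta> by (auto simp: K_def)
      then have z01: "cmod z0 < 1" using z0(1) by (simp add: K_def)
      show ?thesis
      proof (rule that[of "max (1/2) (cmod z0)"])
        fix z assume z: "max (1/2) (cmod z0) < cmod z" "cmod z < 1"
        then have "z \<notin> K" using z0(2)[of z] by auto
        then show "cmod (d z) \<le> \<eta>" using z by (simp add: K_def)
      qed (use z01 in auto)
    qed
  qed
  define M0 where "M0 = measure \<mu> (space \<mu>)"
  have M0: "M0 \<ge> 0" by (simp add: M0_def)
  define Q where "Q = 1 + M0"
  have Q: "Q > 0" "M0 \<le> Q" using M0 by (auto simp: Q_def)
  define \<delta> where "\<delta> = \<epsilon> / (4 * Bd * sqrt Q)"
  have \<delta>: "\<delta> > 0" using eps Bd Q by (simp add: \<delta>_def)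
  have \<delta>B: "Bd\<^sup>2 * \<delta>\<^sup>2 * M0 \<le> (\<epsilon> / 4)\<^sup>2"
  proof -
    have "Bd\<^sup>2 * \<delta>\<^sup>2 * Q = (\<epsilon> / 4)\<^sup>2"
      using Bd(1) Q(1) by (simp add: \<delta>_def power_divide power_mult_distrib)
    moreover have "Bd\<^sup>2 * \<delta>\<^sup>2 * M0 \<le> Bd\<^sup>2 * \<delta>\<^sup>2 * Q" using Q(2) by (intro mult_left_mono) auto
    ultimately show ?thesis by simp
  qed
  obtain N where N: "\<And>n f. N \<le> n \<Longrightarrow> f \<in> D \<Longrightarrow> R n f 0 = 0 \<and> (\<exists>X. X holomorphic_on ball 0 1 \<and>
     (\<forall>z\<in>ball 0 1. deriv (R n f) z = z ^ k * X z) \<and> (\<forall>z. cmod z \<le> \<rho> \<longrightarrow> cmod (X z) \<le> \<delta> * nrm f))"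
    using tail_factor[OF \<rho>(2) \<delta>, of k] by blast
  have "nrm (V p (R N f)) \<le> nrm (W (R N f)) + \<epsilon> * nrm f" if f: "f \<in> D" for f
  proof -
    define x where "x = R N f"
    have x: "x \<in> D" unfolding x_def by (rule R_in[OF f])
    obtain X where Xh: "X holomorphic_on ball 0 1" and Xd: "\<And>z. z \<in> ball 0 1 \<Longrightarrow> deriv x z = z ^ k * X z"
      and Xr: "\<And>z. cmod z \<le> \<rho> \<Longrightarrow> cmod (X z) \<le> \<delta> * nrm f"
      using N[OF order_refl f] unfolding x_def by blast
    have Xm: "X \<in> borel_measurable \<mu>" by (rule holomorphic_imp_mu[OF Xh])
    have dxi: "integrable \<mu> (\<lambda>z. (cmod (deriv x z))\<^sup>2)" by (rule D_int[OF x])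
    have Xbig: "(cmod (X z))\<^sup>2 \<le> (2 ^ k)\<^sup>2 * (cmod (deriv x z))\<^sup>2" if z: "z \<in> ball 0 1" "\<rho> < cmod z" for z
    proof -
      have "(1/2) ^ k \<le> cmod z ^ k" using z \<rho>(1) by (intro power_mono) auto
      then have "(1/2) ^ k * cmod (X z) \<le> cmod (deriv x z)"
        unfolding Xd[OF z(1)] norm_mult norm_power by (intro mult_right_mono) auto
      then have "2 ^ k * ((1/2) ^ k * cmod (X z)) \<le> 2 ^ k * cmod (deriv x z)" by (intro mult_left_mono) auto
      then have "cmod (X z) \<le> 2 ^ k * cmod (deriv x z)" by (simp add: power_one_over)
      then show ?thesis by (simp only: power_mult_distrib[symmetric]) (rule power_mono, auto)
    qed
    have L2X: "L2 X"
      unfolding L2_def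
    proof (rule conjI[OF Xm], rule Bochner_Integration.integrable_bound)
      show "integrable \<mu> (\<lambda>z. (\<delta> * nrm f)\<^sup>2 + (2 ^ k)\<^sup>2 * (cmod (deriv x z))\<^sup>2)" using dxi by simp
      show "(\<lambda>z. (cmod (X z))\<^sup>2) \<in> borel_measurable \<mu>" using Xm by measurable
      show "AE z in \<mu>. norm ((cmod (X z))\<^sup>2) \<le> norm ((\<delta> * nrm f)\<^sup>2 + (2 ^ k)\<^sup>2 * (cmod (deriv x z))\<^sup>2)"
      proof (rule AE_I2)
        fix z assume "z \<in> space \<mu>"
        then have z: "z \<in> ball 0 1" by (simp add: space_mu)
        have "(cmod (X z))\<^sup>2 \<le> (\<delta> * nrm f)\<^sup>2 + (2 ^ k)\<^sup>2 * (cmod (deriv x z))\<^sup>2"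
        proof (cases "cmod z \<le> \<rho>")
          case True
          then have "(cmod (X z))\<^sup>2 \<le> (\<delta> * nrm f)\<^sup>2" using Xr by (intro power_mono) auto
          then show ?thesis by (simp add: add_increasing2)
        next
          case False
          then show ?thesis using Xbig[OF z] by (simp add: add_increasing)
        qed
        then show "norm ((cmod (X z))\<^sup>2) \<le> norm ((\<delta> * nrm f)\<^sup>2 + (2 ^ k)\<^sup>2 * (cmod (deriv x z))\<^sup>2)" by simp
      qed
    qed
    define y where "y = primitive (\<lambda>z. poly q z * X z)"
    have yh: "(\<lambda>z. poly q z * X z) holomorphic_on ball 0 1" by (intro holomorphic_intros Xh)
    obtain Bq where Bq: "Bq > 0" "\<And>z. z \<in> cball 0 1 \<Longrightarrow> cmod (poly q z) \<le> Bq" using poly_bound by blast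
    have yL: "L2 (\<lambda>z. poly q z * X z)"
      using Bq by (intro L2_bounded_mult(1)[OF L2X poly_meas, of _ Bq]) auto
    have y: "y \<in> D" unfolding y_def using yL by (intro primitive_in_D yh) (simp add: L2_def)
    have y0: "y 0 = 0" by (simp add: y_def)
    have dy: "deriv y z = poly q z * X z" if "z \<in> ball 0 1" for z
      unfolding y_def by (rule deriv_primitive[OF yh that])
    define U where "U z = cnj (poly p z) * deriv x z" for z
    obtain Bp where Bp: "Bp > 0" "\<And>z. z \<in> cball 0 1 \<Longrightarrow> cmod (poly p z) \<le> Bp" using poly_bound by blast
    have cpm: "(\<lambda>z. cnj (poly p z)) \<in> borel_measurable \<mu>" by (intro continuous_imp_mu continuous_intros)
    have UL: "L2 U" unfolding U_def
      using Bp by (intro L2_bounded_mult(1)[OF D_L2[OF x] cpm, of Bp]) auto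
    have Unorm: "L2norm U = nrm (V p x)"
      unfolding nrm_V[OF x] L2norm_def U_def by (simp add: norm_mult)
    define E where "E z = d z * X z" for z
    have dm: "d \<in> borel_measurable \<mu>" by (intro continuous_imp_mu continuous_on_subset[OF dc]) auto
    have EL: "L2 E" unfolding E_def
      using Bd by (intro L2_bounded_mult(1)[OF L2X dm, of Bd]) auto
    have UE: "U z - E z = deriv y z" if "z \<in> ball 0 1" for z
      unfolding U_def E_def d_def dy[OF that] Xd[OF that] by (simp add: algebra_simps)
    have UE': "E z = U z - deriv y z" if "z \<in> ball 0 1" for z using UE[OF that] by (simp add: algebra_simps)
    have En: "L2norm E \<le> \<epsilon> / 2 * nrm f"
    proof -
      have "(L2norm E)\<^sup>2 \<le> (\<integral>z. Bd\<^sup>2 * (\<delta> * nrm f)\<^sup>2 + \<eta>\<^sup>2 * ((2 ^ k)\<^sup>2 * (cmod (deriv x z))\<^sup>2) \<partial>\<mu>)"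
        unfolding L2norm_sq
      proof (rule integral_mono)
        show "integrable \<mu> (\<lambda>z. (cmod (E z))\<^sup>2)" using EL by (simp add: L2_def)
        show "integrable \<mu> (\<lambda>z. Bd\<^sup>2 * (\<delta> * nrm f)\<^sup>2 + \<eta>\<^sup>2 * ((2 ^ k)\<^sup>2 * (cmod (deriv x z))\<^sup>2))" using dxi by simp
        fix z assume "z \<in> space \<mu>"
        then have z: "z \<in> ball 0 1" by (simp add: space_mu)
        show "(cmod (E z))\<^sup>2 \<le> Bd\<^sup>2 * (\<delta> * nrm f)\<^sup>2 + \<eta>\<^sup>2 * ((2 ^ k)\<^sup>2 * (cmod (deriv x z))\<^sup>2)"
        proof (cases "cmod z \<le> \<rho>")
          case True
          have "(cmod (E z))\<^sup>2 \<le> Bd\<^sup>2 * (\<delta> * nrm f)\<^sup>2"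
            unfolding E_def norm_mult power_mult_distrib[of "cmod (d z)"]
            using Xr[OF True] Bd z by (intro mult_mono power_mono) auto
          then show ?thesis by (simp add: add_increasing2)
        next
          case False
          have "(cmod (E z))\<^sup>2 \<le> \<eta>\<^sup>2 * ((2 ^ k)\<^sup>2 * (cmod (deriv x z))\<^sup>2)"
            unfolding E_def norm_mult power_mult_distrib[of "cmod (d z)"]
            using Xbig[OF z] \<rho>(3)[of z] False z by (intro mult_mono power_mono) auto
          then show ?thesis by (simp add: add_increasing)
        qed
      qed
      also have "\<dots> = Bd\<^sup>2 * \<delta>\<^sup>2 * M0 * (nrm f)\<^sup>2 + (\<eta> * 2 ^ k)\<^sup>2 * (L2norm (deriv x))\<^sup>2"
        using dxi by (simp add: L2norm_sq M0_def power_mult_distrib mult_ac)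
      also have "\<eta> * 2 ^ k = \<epsilon> / 4" by (simp add: \<eta>_def)
      also have "(L2norm (deriv x))\<^sup>2 \<le> (nrm f)\<^sup>2"
        using order_trans[OF L2norm_le_nrm[OF x] nrm_R_le[OF f, of N, folded x_def]] L2norm_nonneg
        by (intro power_mono) auto
      also have "Bd\<^sup>2 * \<delta>\<^sup>2 * M0 * (nrm f)\<^sup>2 \<le> (\<epsilon> / 4)\<^sup>2 * (nrm f)\<^sup>2" by (intro mult_right_mono \<delta>B) auto
      finally have "(L2norm E)\<^sup>2 \<le> (\<epsilon> / 4)\<^sup>2 * (nrm f)\<^sup>2 + (\<epsilon> / 4)\<^sup>2 * (nrm f)\<^sup>2" by (simp add: mult_left_mono)
      also have "\<dots> \<le> (\<epsilon> / 2 * nrm f)\<^sup>2" by (simp add: power_mult_distrib power_divide)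
      finally show ?thesis by (rule power2_le_imp_le) (use eps nrm_nonneg[OF f] in auto)
    qed
    have ny: "nrm y \<le> nrm (V p x) + L2norm E"
    proof -
      have "nrm y = L2norm (deriv y)" by (rule nrm_D_vanishing[OF y y0])
      also have "\<dots> = L2norm (\<lambda>z. U z - E z)" using UE by (intro L2norm_cong) auto
      also have "\<dots> \<le> L2norm U + L2norm E" by (rule L2_triangle_diff[OF UL EL])
      finally show ?thesis by (simp add: Unorm)
    qed
    have W: "bounded_op W" using ad by (simp add: adjoint_pair_def)
    have Wx: "W x \<in> D" by (rule bounded_op_in[OF W x])
    have Uy: "cmod (\<integral>z. U z * cnj (deriv y z) \<partial>\<mu>) \<le> nrm (W x) * nrm y"
    proof -
      have "(\<integral>z. U z * cnj (deriv y z) \<partial>\<mu>) = (\<integral>z. deriv x z * cnj (deriv (V p y) z) \<partial>\<mu>)"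
        by (rule Bochner_Integration.integral_cong) (simp_all add: space_mu deriv_V[OF y] U_def mult_ac)
      also have "\<dots> = dirichlet_inner \<alpha> x (V p y)" by (simp add: dirichlet_inner_def)
      also have "\<dots> = dirichlet_inner \<alpha> (W x) y"
        using adjoint_pair_sym[OF ad] x y by (simp add: adjoint_pair_def)
      finally show ?thesis using cauchy_schwarz[OF Wx y] by simp
    qed
    have "(L2norm U)\<^sup>2 = cmod (\<integral>z. U z * cnj (U z) \<partial>\<mu>)"
    proof -
      have "(\<integral>z. U z * cnj (U z) \<partial>\<mu>) = (\<integral>z. complex_of_real ((cmod (U z))\<^sup>2) \<partial>\<mu>)"
        by (simp only: complex_norm_square)
      also have "\<dots> = complex_of_real ((L2norm U)\<^sup>2)" unfolding L2norm_sq by (rule integral_complex_of_real)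
      finally show ?thesis by (simp add: norm_power)
    qed
    also have "(\<integral>z. U z * cnj (U z) \<partial>\<mu>) = (\<integral>z. U z * cnj (deriv y z) + U z * cnj (E z) \<partial>\<mu>)"
      by (rule Bochner_Integration.integral_cong) (simp_all add: space_mu UE' algebra_simps)
    also have "\<dots> = (\<integral>z. U z * cnj (deriv y z) \<partial>\<mu>) + (\<integral>z. U z * cnj (E z) \<partial>\<mu>)"
      by (intro Bochner_Integration.integral_add L2_inner_integrable UL EL D_L2 y)
    also have "cmod \<dots> \<le> nrm (W x) * nrm y + L2norm U * L2norm E"
      by (rule order_trans[OF norm_triangle_ineq add_mono[OF Uy L2_cauchy_schwarz[OF UL EL]]])
    finally have main: "(L2norm U)\<^sup>2 \<le> nrm (W x) * nrm y + L2norm U * L2norm E" .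
    \<comment> \<open>With \<open>u\<close>, \<open>s\<close>, \<open>e\<close> for the three norms: if \<open>s + 2 e < u\<close> then
      \<open>u^2 \<le> s (u + e) + u e \<le> u (s + 2 e) < u^2\<close>.\<close>
    have "nrm (V p x) \<le> nrm (W x) + 2 * L2norm E"
    proof (rule ccontr)
      assume "\<not> ?thesis"
      then have gt: "nrm (W x) + 2 * L2norm E < L2norm U" by (simp add: Unorm)
      have S0: "0 \<le> nrm (W x)" and E0: "0 \<le> L2norm E" using nrm_nonneg[OF Wx] L2norm_nonneg by auto
      have U0: "0 < L2norm U" using gt S0 E0 by linarith
      have "(L2norm U)\<^sup>2 \<le> nrm (W x) * (L2norm U + L2norm E) + L2norm U * L2norm E"
        using main ny S0 mult_left_mono[of "nrm y" "L2norm U + L2norm E" "nrm (W x)"] by (simp add: Unorm)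
      also have "nrm (W x) * L2norm E \<le> L2norm U * L2norm E" using gt S0 E0 by (intro mult_right_mono) auto
      then have "nrm (W x) * (L2norm U + L2norm E) + L2norm U * L2norm E \<le> L2norm U * (nrm (W x) + 2 * L2norm E)"
        by (simp add: algebra_simps)
      also have "\<dots> < L2norm U * L2norm U" using gt U0 by (intro mult_strict_left_mono)
      finally show False by (simp add: power2_eq_square)
    qed
    then show ?thesis using En unfolding x_def[symmetric] by simp
  qed
  then show "\<exists>N. \<forall>f\<in>D. nrm (V p (R N f)) \<le> nrm (W (R N f)) + \<epsilon> * nrm f" by blast
qed

end

section \<open>Polynomials of prescribed size at contact points\<close>

text \<open>
  On the circle \<open>cnj z\<close> is the inverse of \<open>z\<close>, so a real polynomial in the coordinates
  of \<open>z\<close> is a Laurent polynomial in \<open>z\<close>, and a power of \<open>z\<close> clears its denominator.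
\<close>

lemma trigonometric_polynomial_times_power:
  fixes g :: "complex \<Rightarrow> real"
  assumes "real_polynomial_function g"
  shows "\<exists>k P. \<forall>z. cmod z = 1 \<longrightarrow> z ^ k * of_real (g z) = poly P z"
  using assms
proof induction
  case (linear f)
  then have lin: "linear f" by (rule bounded_linear.linear)
  define P where "P = [: of_real (f 1) / 2 - of_real (f \<i>) / (2 * \<i>), 0, of_real (f 1) / 2 + of_real (f \<i>) / (2 * \<i>) :]"
  have "z ^ 1 * of_real (f z) = poly P z" if z: "cmod z = 1" for z
  proof -
    have zc: "z * cnj z = 1" using z complex_norm_square[of z] by simp
    have zf: "f z = Re z * f 1 + Im z * f \<i>"
    proof -
      have "z = Re z *\<^sub>R 1 + Im z *\<^sub>R \<i>" by (simp add: complex_eq_iff)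
      then have "f z = f (Re z *\<^sub>R 1 + Im z *\<^sub>R \<i>)" by simp
      then show ?thesis by (simp only: linear_add[OF lin] linear_scale[OF lin] real_scaleR_def)
    qed
    have r: "of_real (Re z) = (z + cnj z) / 2" and i: "of_real (Im z) = (z - cnj z) / (2 * \<i>)"
      by (simp_all add: complex_eq_iff)
    have "z * of_real (f z) = ((z * z + z * cnj z) / 2) * of_real (f 1) + ((z * z - z * cnj z) / (2 * \<i>)) * of_real (f \<i>)"
      unfolding zf of_real_add of_real_mult r i by (simp add: field_simps)
    also have "\<dots> = poly P z" unfolding zc P_def by (simp add: field_simps)
    finally show ?thesis by simp
  qed
  then show ?case by blast
next
  case (const c)
  show ?case by (intro exI[of _ 0] exI[of _ "[:of_real c:]"]) simp
next
  case (add f g)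
  then obtain k P l Q where "\<forall>z. cmod z = 1 \<longrightarrow> z ^ k * of_real (f z) = poly P z"
    "\<forall>z. cmod z = 1 \<longrightarrow> z ^ l * of_real (g z) = poly Q z" by blast
  then have "\<forall>z. cmod z = 1 \<longrightarrow> z ^ (k + l) * of_real (f z + g z) = poly (monom 1 l * P + monom 1 k * Q) z"
    by (simp add: poly_monom power_add algebra_simps)
  then show ?case by blast
next
  case (mult f g)
  then obtain k P l Q where "\<forall>z. cmod z = 1 \<longrightarrow> z ^ k * of_real (f z) = poly P z"
    "\<forall>z. cmod z = 1 \<longrightarrow> z ^ l * of_real (g z) = poly Q z" by blast
  then have "\<forall>z. cmod z = 1 \<longrightarrow> z ^ (k + l) * of_real (f z * g z) = poly (P * Q) z"
    by (simp add: power_add poly_mult) (metis mult.assoc mult.left_commute)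
  then show ?case by blast
qed

text \<open>
  By Stone-Weierstrass \<open>h\<close> is close to a trigonometric polynomial. Multiplying that by a
  power of \<open>z\<close> makes it a polynomial in \<open>z\<close> and does not change its modulus on the
  circle.
\<close>

lemma polynomial_modulus_approximation:
  fixes h :: "complex \<Rightarrow> real"
  assumes "continuous_on (sphere 0 1) h" "\<And>z. z \<in> sphere 0 1 \<Longrightarrow> 0 \<le> h z" "\<epsilon> > 0"
  obtains P where "\<And>z. z \<in> sphere 0 1 \<Longrightarrow> \<bar>cmod (poly P z) - h z\<bar> < \<epsilon>"
proof -
  obtain g where g: "real_polynomial_function g" "\<And>z. z \<in> sphere 0 1 \<Longrightarrow> \<bar>h z - g z\<bar> < \<epsilon>"
    using Stone_Weierstrass_real_polynomial_function[OF _ assms(1,3)] by auto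
  obtain k P where P: "\<forall>z. cmod z = 1 \<longrightarrow> z ^ k * of_real (g z) = poly P z"
    using trigonometric_polynomial_times_power[OF g(1)] by blast
  show ?thesis
  proof (rule that[of P])
    fix z :: complex assume z: "z \<in> sphere 0 1"
    then have "cmod (poly P z) = cmod (z ^ k * of_real (g z))" using P by simp
    also have "\<dots> = \<bar>g z\<bar>" using z by (simp add: norm_mult norm_power)
    finally have "cmod (poly P z) = \<bar>g z\<bar>" .
    then show "\<bar>cmod (poly P z) - h z\<bar> < \<epsilon>" using g(2)[OF z] assms(2)[OF z] by linarith
  qed
qed

text \<open>
  The modulus of the polynomial is to exceed \<open>s\<close> at the points \<open>\<psi> \<zeta>\<close> and to stay below
  \<open>(m + \<epsilon>) / t\<close> at the points \<open>\<phi> \<xi>\<close>. Where such points coincide this is possible since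
  \<open>s * t \<le> m\<close>. A continuous function \<open>h\<close> with both properties is the lower envelope of
  cones of slope \<open>C\<close> with apex \<open>a \<xi> = (m + \<epsilon> / 2) / t \<xi>\<close> over \<open>\<phi> \<xi>\<close>: it is at most \<open>a \<xi>\<close>
  at \<open>\<phi> \<xi>\<close>, and if \<open>C\<close> is large then all the cones lie above \<open>s \<zeta>\<close> at \<open>\<psi> \<zeta>\<close>. A margin
  \<open>\<delta>\<close> leaves room for approximating \<open>h\<close> by the modulus of a polynomial.
\<close>

lemma separating_polynomial:
  fixes \<phi> \<psi> :: "complex \<Rightarrow> complex" and s t :: "complex \<Rightarrow> real"
  assumes \<Gamma>: "compact \<Gamma>" "continuous_on \<Gamma> \<phi>" "\<phi> ` \<Gamma> \<subseteq> sphere 0 1" "continuous_on \<Gamma> t" "\<And>\<xi>. \<xi> \<in> \<Gamma> \<Longrightarrow> 0 < t \<xi>"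
    and \<Delta>: "compact \<Delta>" "continuous_on \<Delta> \<psi>" "\<psi> ` \<Delta> \<subseteq> sphere 0 1" "continuous_on \<Delta> s" "\<And>\<zeta>. \<zeta> \<in> \<Delta> \<Longrightarrow> 0 < s \<zeta>"
    and m: "0 \<le> m" "\<And>\<xi> \<zeta>. \<xi> \<in> \<Gamma> \<Longrightarrow> \<zeta> \<in> \<Delta> \<Longrightarrow> \<phi> \<xi> = \<psi> \<zeta> \<Longrightarrow> s \<zeta> * t \<xi> \<le> m" and \<epsilon>: "0 < \<epsilon>"
  obtains P where "\<And>\<zeta>. \<zeta> \<in> \<Delta> \<Longrightarrow> s \<zeta> < cmod (poly P (\<psi> \<zeta>))"
    "\<And>\<xi>. \<xi> \<in> \<Gamma> \<Longrightarrow> cmod (poly P (\<phi> \<xi>)) * t \<xi> < m + \<epsilon>"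
proof -
  have bnd: "\<exists>S>0. \<forall>x\<in>K. f x \<le> S" if "compact K" "continuous_on K f" for K and f :: "complex \<Rightarrow> real"
  proof -
    have "compact (f ` K)" by (rule compact_continuous_image[OF that(2,1)])
    then obtain B where "\<forall>x\<in>f ` K. norm x \<le> B" using compact_imp_bounded bounded_iff by metis
    then have "\<forall>x\<in>K. f x \<le> max B 1" by (auto simp: le_max_iff_disj abs_le_iff)
    then show ?thesis by (intro exI[of _ "max B 1"]) auto
  qed
  obtain S where S: "S > 0" "\<And>\<zeta>. \<zeta> \<in> \<Delta> \<Longrightarrow> s \<zeta> \<le> S" using bnd[OF \<Delta>(1,4)] by blast
  obtain T where T: "T > 0" "\<And>\<xi>. \<xi> \<in> \<Gamma> \<Longrightarrow> t \<xi> \<le> T" using bnd[OF \<Gamma>(1,4)] by blast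
  show ?thesis
  proof (cases "\<Gamma> = {}")
    case True
    show ?thesis
    proof (rule that[of "[:of_real (S + 1):]"])
      fix \<zeta> assume "\<zeta> \<in> \<Delta>"
      then have "s \<zeta> < S + 1" using S(2) by force
      then show "s \<zeta> < cmod (poly [:of_real (S + 1):] (\<psi> \<zeta>))" using S(1) by (simp del: of_real_add)
    qed (simp add: True)
  next
    case False
    define a where "a \<xi> = (m + \<epsilon> / 2) / t \<xi>" for \<xi>
    \<comment> \<open>Where \<open>\<phi> \<xi> = \<psi> \<zeta>\<close> the gap \<open>a \<xi> - s \<zeta>\<close> is at least \<open>\<epsilon> / (2 * T) = 2 * \<delta>\<close>.\<close>
    define \<delta> where "\<delta> = \<epsilon> / (4 * T)"
    have \<delta>: "\<delta> > 0" using \<epsilon> T by (simp add: \<delta>_def)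
    have tne: "\<And>\<xi>. \<xi> \<in> \<Gamma> \<Longrightarrow> t \<xi> \<noteq> 0" using \<Gamma>(5) by force
    have ac: "continuous_on \<Gamma> a" unfolding a_def using tne by (intro continuous_intros \<Gamma>(4)) auto
    have a0: "0 < a \<xi>" if "\<xi> \<in> \<Gamma>" for \<xi> using \<Gamma>(5)[OF that] m(1) \<epsilon> by (simp add: a_def)
    \<comment> \<open>On the compact set \<open>K\<close> the gap is too small, so there the distance of \<open>\<phi> \<xi>\<close> and \<open>\<psi> \<zeta>\<close>
      has a positive minimum.\<close>
    define K where "K = {x \<in> \<Gamma> \<times> \<Delta>. a (fst x) - s (snd x) \<le> \<delta>}"
    have c1: "continuous_on (\<Gamma> \<times> \<Delta>) (\<lambda>x. a (fst x))"
      by (rule continuous_on_compose2[OF ac]) (auto intro: continuous_intros)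
    have c2: "continuous_on (\<Gamma> \<times> \<Delta>) (\<lambda>x. s (snd x))"
      by (rule continuous_on_compose2[OF \<Delta>(4)]) (auto intro: continuous_intros)
    have c3: "continuous_on (\<Gamma> \<times> \<Delta>) (\<lambda>x. \<phi> (fst x))"
      by (rule continuous_on_compose2[OF \<Gamma>(2)]) (auto intro: continuous_intros)
    have c4: "continuous_on (\<Gamma> \<times> \<Delta>) (\<lambda>x. \<psi> (snd x))"
      by (rule continuous_on_compose2[OF \<Delta>(2)]) (auto intro: continuous_intros)
    have cK: "compact K"
    proof -
      have "compact (\<Gamma> \<times> \<Delta>)" by (rule compact_Times[OF \<Gamma>(1) \<Delta>(1)])
      moreover have "continuous_on (\<Gamma> \<times> \<Delta>) (\<lambda>x. a (fst x) - s (snd x))" by (intro continuous_intros c1 c2)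
      then have "closedin (top_of_set (\<Gamma> \<times> \<Delta>)) ((\<Gamma> \<times> \<Delta>) \<inter> (\<lambda>x. a (fst x) - s (snd x)) -` {..\<delta>})"
        by (rule continuous_closedin_preimage) simp
      moreover have "(\<Gamma> \<times> \<Delta>) \<inter> (\<lambda>x. a (fst x) - s (snd x)) -` {..\<delta>} = K" by (auto simp: K_def)
      ultimately show ?thesis using closedin_compact[OF \<open>compact (\<Gamma> \<times> \<Delta>)\<close>] by metis
    qed
    obtain C where C: "C > 0" "\<And>\<xi> \<zeta>. \<xi> \<in> \<Gamma> \<Longrightarrow> \<zeta> \<in> \<Delta> \<Longrightarrow> s \<zeta> + \<delta> \<le> a \<xi> + C * cmod (\<psi> \<zeta> - \<phi> \<xi>)"
    proof (cases "K = {}")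
      case True
      then have "s \<zeta> + \<delta> \<le> a \<xi> + 1 * cmod (\<psi> \<zeta> - \<phi> \<xi>)" if "\<xi> \<in> \<Gamma>" "\<zeta> \<in> \<Delta>" for \<xi> \<zeta>
      proof -
        have "(\<xi>, \<zeta>) \<notin> K" using True by simp
        then have "a \<xi> - s \<zeta> > \<delta>" using that by (simp add: K_def)
        then show ?thesis using norm_ge_zero[of "\<psi> \<zeta> - \<phi> \<xi>"] by linarith
      qed
      then show ?thesis by (intro that[of 1]) auto
    next
      case False
      have "continuous_on K (\<lambda>x. cmod (\<psi> (snd x) - \<phi> (fst x)))"
        by (intro continuous_intros continuous_on_subset[OF c3] continuous_on_subset[OF c4]) (auto simp: K_def)
      then obtain x0 where x0: "x0 \<in> K"
        "\<And>x. x \<in> K \<Longrightarrow> cmod (\<psi> (snd x0) - \<phi> (fst x0)) \<le> cmod (\<psi> (snd x) - \<phi> (fst x))"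
        using continuous_attains_inf[OF cK False] by blast
      define d0 where "d0 = cmod (\<psi> (snd x0) - \<phi> (fst x0))"
      have "d0 \<noteq> 0"
      proof
        assume "d0 = 0"
        then have eq: "\<phi> (fst x0) = \<psi> (snd x0)" by (simp add: d0_def)
        have in0: "fst x0 \<in> \<Gamma>" "snd x0 \<in> \<Delta>" and le: "a (fst x0) - s (snd x0) \<le> \<delta>" using x0(1) by (auto simp: K_def)
        have t0: "t (fst x0) > 0" "t (fst x0) \<le> T" using \<Gamma>(5) T(2) in0 by auto
        have "s (snd x0) \<le> m / t (fst x0)" using m(2)[OF in0 eq] t0 by (simp add: pos_le_divide_eq)
        moreover have "\<epsilon> / 2 / T \<le> \<epsilon> / 2 / t (fst x0)" using t0 \<epsilon> by (intro divide_left_mono) auto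
        moreover have "a (fst x0) = m / t (fst x0) + \<epsilon> / 2 / t (fst x0)" by (simp add: a_def add_divide_distrib)
        moreover have "\<epsilon> / 2 / T = 2 * \<delta>" by (simp add: \<delta>_def)
        ultimately show False using le \<delta> by linarith
      qed
      then have d0: "d0 > 0" by (simp add: d0_def)
      define C where "C = (S + \<delta>) / d0"
      have C0: "C > 0" using S(1) \<delta> d0 by (simp add: C_def)
      have "s \<zeta> + \<delta> \<le> a \<xi> + C * cmod (\<psi> \<zeta> - \<phi> \<xi>)" if xz: "\<xi> \<in> \<Gamma>" "\<zeta> \<in> \<Delta>" for \<xi> \<zeta>
      proof (cases "(\<xi>, \<zeta>) \<in> K")
        case True
        have "C * d0 \<le> C * cmod (\<psi> \<zeta> - \<phi> \<xi>)" using x0(2)[OF True] C0 by (intro mult_left_mono) (auto simp: d0_def)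
        moreover have "C * d0 = S + \<delta>" using d0 by (simp add: C_def)
        ultimately show ?thesis using S(2)[OF xz(2)] a0[OF xz(1)] by linarith
      next
        case False
        then have "a \<xi> - s \<zeta> > \<delta>" using xz by (simp add: K_def)
        moreover have "0 \<le> C * cmod (\<psi> \<zeta> - \<phi> \<xi>)" using C0 by simp
        ultimately show ?thesis by linarith
      qed
      then show ?thesis using C0 that by blast
    qed
    define h where "h u = (INF \<xi>\<in>\<Gamma>. a \<xi> + C * cmod (u - \<phi> \<xi>))" for u
    have nn: "0 \<le> a \<xi> + C * cmod (u - \<phi> \<xi>)" if "\<xi> \<in> \<Gamma>" for \<xi> u
      using a0[OF that] C(1) by (intro add_nonneg_nonneg mult_nonneg_nonneg) auto
    have bdd: "bdd_below ((\<lambda>\<xi>. a \<xi> + C * cmod (u - \<phi> \<xi>)) ` \<Gamma>)" for u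
      using nn by (intro bdd_belowI[of _ 0]) auto
    have h0: "0 \<le> h u" for u
      unfolding h_def using nn by (intro cINF_greatest False)
    have hlip: "h u \<le> h v + C * cmod (u - v)" for u v
    proof -
      have "h u - C * cmod (u - v) \<le> h v"
        unfolding h_def[of v]
      proof (rule cINF_greatest[OF False])
        fix \<xi> assume \<xi>: "\<xi> \<in> \<Gamma>"
        have "h u \<le> a \<xi> + C * cmod (u - \<phi> \<xi>)" unfolding h_def by (rule cINF_lower[OF bdd \<xi>])
        also have "C * cmod (u - \<phi> \<xi>) \<le> C * (cmod (u - v) + cmod (v - \<phi> \<xi>))"
          using C(1) norm_triangle_ineq[of "u - v" "v - \<phi> \<xi>"] by (intro mult_left_mono) auto
        finally show "h u - C * cmod (u - v) \<le> a \<xi> + C * cmod (v - \<phi> \<xi>)" by (simp add: algebra_simps)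
      qed
      then show ?thesis by simp
    qed
    have "C-lipschitz_on (sphere 0 1) h"
    proof (rule lipschitz_onI)
      fix u v :: complex
      show "dist (h u) (h v) \<le> C * dist u v"
        using hlip[of u v] hlip[of v u] by (simp add: dist_norm norm_minus_commute abs_le_iff)
    qed (use C in simp)
    then have hc: "continuous_on (sphere 0 1) h" by (rule lipschitz_on_continuous_on)
    obtain P where P: "\<And>z. z \<in> sphere 0 1 \<Longrightarrow> \<bar>cmod (poly P z) - h z\<bar> < \<delta>"
      using polynomial_modulus_approximation[OF hc h0 \<delta>] by blast
    show ?thesis
    proof (rule that[of P])
      fix \<zeta> assume \<zeta>: "\<zeta> \<in> \<Delta>"
      have "s \<zeta> + \<delta> \<le> h (\<psi> \<zeta>)" unfolding h_def using C(2) \<zeta> by (intro cINF_greatest False) auto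
      moreover have "\<bar>cmod (poly P (\<psi> \<zeta>)) - h (\<psi> \<zeta>)\<bar> < \<delta>" using P \<Delta>(3) \<zeta> by blast
      ultimately show "s \<zeta> < cmod (poly P (\<psi> \<zeta>))" by linarith
    next
      fix \<xi> assume \<xi>: "\<xi> \<in> \<Gamma>"
      have "h (\<phi> \<xi>) \<le> a \<xi>" unfolding h_def using cINF_lower[OF bdd \<xi>, of "\<phi> \<xi>"] by simp
      moreover have "\<bar>cmod (poly P (\<phi> \<xi>)) - h (\<phi> \<xi>)\<bar> < \<delta>" using P \<Gamma>(3) \<xi> by blast
      ultimately have "cmod (poly P (\<phi> \<xi>)) \<le> a \<xi> + \<delta>" by linarith
      then have "cmod (poly P (\<phi> \<xi>)) * t \<xi> \<le> (a \<xi> + \<delta>) * t \<xi>" using \<Gamma>(5)[OF \<xi>] by (intro mult_right_mono) auto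
      also have "\<dots> = m + \<epsilon> / 2 + \<delta> * t \<xi>"
      proof -
        have "a \<xi> * t \<xi> = m + \<epsilon> / 2" using tne[OF \<xi>] by (simp add: a_def)
        then show ?thesis by (simp add: distrib_right)
      qed
      also have "\<delta> * t \<xi> \<le> \<delta> * T" using T(2)[OF \<xi>] \<delta> by (intro mult_left_mono) auto
      also have "\<delta> * T = \<epsilon> / 4" using T(1) by (simp add: \<delta>_def)
      finally show "cmod (poly P (\<phi> \<xi>)) * t \<xi> < m + \<epsilon>" using \<epsilon> by simp
    qed
  qed
qed

section \<open>Self-maps that are regular up to the circle\<close>

text \<open>
  Both estimates rest on these properties of linear fractional self-maps.
\<close>

definition smooth_self_map :: "(complex \<Rightarrow> complex) \<Rightarrow> bool" where
  "smooth_self_map \<phi> \<longleftrightarrow> (\<exists>U. open U \<and> cball 0 1 \<subseteq> U \<and> \<phi> holomorphic_on U) \<and> inj_on \<phi> (ball 0 1) \<and>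
     \<phi> ` ball 0 1 \<subseteq> ball 0 1 \<and> (\<forall>z\<in>cball 0 1. deriv \<phi> z \<noteq> 0)"

lemma smooth_self_map_facts:
  assumes "smooth_self_map \<phi>"
  shows "\<phi> holomorphic_on ball 0 1" "continuous_on (cball 0 1) \<phi>" "continuous_on (cball 0 1) (deriv \<phi>)"
    "\<And>z. z \<in> cball 0 1 \<Longrightarrow> (\<phi> has_field_derivative deriv \<phi> z) (at z)"
    "\<And>z. z \<in> cball 0 1 \<Longrightarrow> cmod (\<phi> z) \<le> 1" "\<And>z. z \<in> cball 0 1 \<Longrightarrow> deriv \<phi> z \<noteq> 0"
    "\<And>z. z \<in> ball 0 1 \<Longrightarrow> cmod (\<phi> z) < 1"
proof -
  obtain U where U: "open U" "cball 0 1 \<subseteq> U" "\<phi> holomorphic_on U" using assms by (auto simp: smooth_self_map_def)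
  show "\<phi> holomorphic_on ball 0 1" using U by (meson ball_subset_cball holomorphic_on_subset subset_trans)
  show c: "continuous_on (cball 0 1) \<phi>" using U holomorphic_on_imp_continuous_on continuous_on_subset by metis
  show "continuous_on (cball 0 1) (deriv \<phi>)"
    using U holomorphic_deriv[OF U(3,1)] holomorphic_on_imp_continuous_on continuous_on_subset by metis
  show "(\<phi> has_field_derivative deriv \<phi> z) (at z)" if "z \<in> cball 0 1" for z
    using holomorphic_derivI[OF U(3,1)] U(2) that by blast
  show "deriv \<phi> z \<noteq> 0" if "z \<in> cball 0 1" for z using assms that by (auto simp: smooth_self_map_def)
  show b: "cmod (\<phi> z) < 1" if "z \<in> ball 0 1" for z
    using assms that by (auto simp: smooth_self_map_def image_subset_iff)
  have "\<phi> ` closure (ball 0 1) \<subseteq> cball 0 1"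
    by (rule image_closure_subset) (use c b in \<open>auto simp: less_imp_le\<close>)
  then show "cmod (\<phi> z) \<le> 1" if "z \<in> cball 0 1" for z using that by (auto simp: image_subset_iff)
qed

text \<open>
  The Schwarz lemma for the map that results when disc automorphisms move \<open>z\<close> and \<open>f z\<close>
  to the centre.
\<close>

lemma schwarz_pick:
  assumes hol: "f holomorphic_on ball 0 1" and im: "f ` ball 0 1 \<subseteq> ball 0 1" and z: "z \<in> ball 0 1"
  shows "cmod (deriv f z) * (1 - (cmod z)\<^sup>2) \<le> 1 - (cmod (f z))\<^sup>2"
proof -
  define w where "w = f z"
  have w: "cmod w < 1" and z1: "cmod z < 1" using im z by (auto simp: w_def image_subset_iff)
  have sq: "(cmod z)\<^sup>2 < 1" "(cmod w)\<^sup>2 < 1" using w z1 by (auto simp: power_less_one_iff abs_square_less_1)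
  \<comment> \<open>\<open>A\<close> takes 0 to \<open>z\<close>, and \<open>B\<close> takes \<open>f z\<close> to 0.\<close>
  define A where "A u = (u + z) / (1 + cnj z * u)" for u
  define B where "B u = (u - w) / (1 - cnj w * u)" for u
  have Aeq: "A = Moebius_function 0 (- z)" and Beq: "B = Moebius_function 0 w"
    by (auto simp: A_def B_def Moebius_function_def fun_eq_iff)
  have Ab: "cmod (A u) < 1" if "cmod u < 1" for u
    unfolding Aeq using Moebius_function_norm_lt_1[of "-z" u 0] z1 that by simp
  have Bb: "cmod (B u) < 1" if "cmod u < 1" for u
    unfolding Beq using Moebius_function_norm_lt_1[of w u 0] w that by simp
  have Ah: "A holomorphic_on ball 0 1" and Bh: "B holomorphic_on ball 0 1"
    unfolding Aeq Beq using z1 w by (auto intro: Moebius_function_holomorphic)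
  have fA: "(\<lambda>u. f (A u)) holomorphic_on ball 0 1"
  proof -
    have "A ` ball 0 1 \<subseteq> ball 0 1" using Ab by auto
    from holomorphic_on_compose_gen[OF Ah hol this] show ?thesis by (simp add: o_def)
  qed
  have gh: "(\<lambda>u. B (f (A u))) holomorphic_on ball 0 1"
  proof -
    have "(\<lambda>u. f (A u)) ` ball 0 1 \<subseteq> ball 0 1" using Ab im by (auto simp: image_subset_iff)
    from holomorphic_on_compose_gen[OF fA Bh this] show ?thesis by (simp add: o_def)
  qed
  have A0: "A 0 = z" by (simp add: A_def)
  have "cmod (deriv (\<lambda>u. B (f (A u))) 0) \<le> 1"
  proof (rule Schwarz_Lemma(2)[OF gh, of 0])
    show "B (f (A 0)) = 0" by (simp add: A0 B_def w_def)
    show "cmod (B (f (A u))) < 1" if "cmod u < 1" for u using Bb Ab[OF that] im by (auto simp: image_subset_iff)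
  qed simp
  moreover have "((\<lambda>u. B (f (A u))) has_field_derivative (1 / (1 - of_real ((cmod w)\<^sup>2))) * (deriv f z * (1 - of_real ((cmod z)\<^sup>2)))) (at 0)"
  proof -
    have dA: "(A has_field_derivative (1 - of_real ((cmod z)\<^sup>2))) (at 0)"
      unfolding A_def by (rule derivative_eq_intros refl | simp)+ (use complex_norm_square[of z] in simp)
    have df: "(f has_field_derivative deriv f z) (at (A 0))"
      unfolding A0 by (rule holomorphic_derivI[OF hol _ z]) simp
    have nz: "1 - cnj w * w \<noteq> 0"
    proof
      assume "1 - cnj w * w = 0"
      then have "of_real ((cmod w)\<^sup>2) = (1::complex)" using complex_norm_square[of w] by (simp add: mult.commute)
      then have "(cmod w)\<^sup>2 = 1" by (metis of_real_eq_1_iff)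
      then show False using sq by simp
    qed
    have "(B has_field_derivative 1 / (1 - cnj w * w)) (at w)"
      unfolding B_def using nz by (auto intro!: derivative_eq_intros simp: power2_eq_square)
    then have dB: "(B has_field_derivative 1 / (1 - of_real ((cmod w)\<^sup>2))) (at (f (A 0)))"
      using complex_norm_square[of w] by (simp add: A0 w_def[symmetric] mult.commute)
    show ?thesis by (rule DERIV_chain2[OF dB DERIV_chain2[OF df dA]])
  qed
  ultimately have "cmod ((1 / (1 - of_real ((cmod w)\<^sup>2))) * (deriv f z * (1 - of_real ((cmod z)\<^sup>2)))) \<le> 1"
    by (simp add: DERIV_imp_deriv)
  moreover have "cmod (1 - of_real ((cmod w)\<^sup>2)) = 1 - (cmod w)\<^sup>2" "cmod (1 - of_real ((cmod z)\<^sup>2)) = 1 - (cmod z)\<^sup>2"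
    using sq by (simp_all del: of_real_power add: norm_of_real[of "1 - _", unfolded of_real_diff of_real_1])
  ultimately have "1 / (1 - (cmod w)\<^sup>2) * (cmod (deriv f z) * (1 - (cmod z)\<^sup>2)) \<le> 1"
    by (simp only: norm_mult norm_divide norm_one)
  then show ?thesis using sq by (simp add: w_def[symmetric] pos_divide_le_eq)
qed

text \<open>
  The points of the closed disc at which \<open>F\<close> fails to be positive form a compact set on
  which \<open>|\<phi>| < 1\<close>; the maximum of \<open>|\<phi>|\<close> on this set serves as \<open>\<rho>\<close>.
\<close>

lemma positive_near_contact:
  fixes F :: "complex \<Rightarrow> real"
  assumes \<phi>: "smooth_self_map \<phi>" and F: "continuous_on (cball 0 1) F"
    and pos: "\<And>\<xi>. \<xi> \<in> sphere 0 1 \<Longrightarrow> \<phi> \<xi> \<in> sphere 0 1 \<Longrightarrow> 0 < F \<xi>"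
  obtains \<rho> where "\<rho> < 1" "\<And>z. z \<in> cball 0 1 \<Longrightarrow> \<rho> < cmod (\<phi> z) \<Longrightarrow> 0 < F z"
proof -
  note facts = smooth_self_map_facts[OF \<phi>]
  define K where "K = {z \<in> cball 0 1. F z \<le> 0}"
  have "closedin (top_of_set (cball 0 1)) (cball 0 1 \<inter> F -` {..0})"
    by (rule continuous_closedin_preimage[OF F]) simp
  moreover have "cball 0 1 \<inter> F -` {..0} = K" by (auto simp: K_def)
  ultimately have cK: "compact K" using closedin_compact[OF compact_cball] by metis
  show ?thesis
  proof (cases "K = {}")
    case True
    show ?thesis
    proof (rule that[of 0])
      fix z :: complex assume z: "z \<in> cball 0 1"
      have "z \<notin> K" using True by simp
      then show "0 < F z" using z by (simp add: K_def)
    qed simp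
  next
    case False
    have "continuous_on K (\<lambda>z. cmod (\<phi> z))"
      by (intro continuous_intros continuous_on_subset[OF facts(2)]) (auto simp: K_def)
    then obtain z0 where z0: "z0 \<in> K" "\<And>z. z \<in> K \<Longrightarrow> cmod (\<phi> z) \<le> cmod (\<phi> z0)"
      using continuous_attains_sup[OF cK False] by blast
    have "cmod (\<phi> z0) < 1"
    proof (rule ccontr)
      assume ge: "\<not> ?thesis"
      have "z0 \<in> cball 0 1" "F z0 \<le> 0" using z0 by (auto simp: K_def)
      moreover have "cmod (\<phi> z0) = 1" using facts(5)[OF \<open>z0 \<in> cball 0 1\<close>] ge by simp
      moreover have "z0 \<notin> ball 0 1" using facts(7)[of z0] ge by blast
      ultimately show False using pos[of z0] by auto
    qed
    then show ?thesis
    proof (rule that)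
      fix z :: complex assume z: "z \<in> cball 0 1" "cmod (\<phi> z0) < cmod (\<phi> z)"
      then have "z \<notin> K" using z0(2)[of z] by auto
      then show "0 < F z" using z by (simp add: K_def)
    qed
  qed
qed

section \<open>The upper estimate\<close>

context dirichlet
begin

text \<open>
  The Schwarz-Pick inequality raised to the power \<open>\<alpha>\<close>. It is asymptotically sharp for
  radial approach to a contact point, which is why the upper and lower estimates agree.
\<close>

lemma weight_schwarz_pick:
  assumes \<phi>: "smooth_self_map \<phi>" and z: "z \<in> ball 0 1"
  shows "weight z \<le> cmod (deriv \<phi> z) powr (- \<alpha>) * weight (\<phi> z)"
proof -
  note facts = smooth_self_map_facts[OF \<phi>]
  define d where "d = cmod (deriv \<phi> z)"
  have d: "d > 0" using facts(6)[of z] z by (simp add: d_def)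
  have im: "\<phi> ` ball 0 1 \<subseteq> ball 0 1" using facts(7) by auto
  have z1: "0 \<le> 1 - (cmod z)\<^sup>2" "0 \<le> 1 - (cmod (\<phi> z))\<^sup>2"
    using z facts(7)[OF z] by (auto simp: abs_square_le_1)
  have "d * (1 - (cmod z)\<^sup>2) \<le> 1 - (cmod (\<phi> z))\<^sup>2"
    unfolding d_def by (rule schwarz_pick[OF facts(1) im z])
  then have "(d * (1 - (cmod z)\<^sup>2)) powr \<alpha> \<le> (1 - (cmod (\<phi> z))\<^sup>2) powr \<alpha>"
    using d z1 alpha_pos by (intro powr_mono2) auto
  then have "d powr \<alpha> * (1 - (cmod z)\<^sup>2) powr \<alpha> \<le> (1 - (cmod (\<phi> z))\<^sup>2) powr \<alpha>"
    using d z1 by (simp add: powr_mult)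
  then have "d powr (- \<alpha>) * (d powr \<alpha> * (1 - (cmod z)\<^sup>2) powr \<alpha>) \<le> d powr (- \<alpha>) * (1 - (cmod (\<phi> z))\<^sup>2) powr \<alpha>"
    by (intro mult_left_mono) auto
  moreover have "d powr (- \<alpha>) * (d powr \<alpha> * (1 - (cmod z)\<^sup>2) powr \<alpha>) = (1 - (cmod z)\<^sup>2) powr \<alpha>"
    using d by (simp add: mult.assoc[symmetric] flip: powr_add)
  ultimately have "(1 + \<alpha>) / pi * (1 - (cmod z)\<^sup>2) powr \<alpha> \<le> (1 + \<alpha>) / pi * (d powr (- \<alpha>) * (1 - (cmod (\<phi> z))\<^sup>2) powr \<alpha>)"
    using alpha_pos by (intro mult_left_mono) auto
  then show ?thesis by (simp add: weight_def d_def mult_ac)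
qed

lemma smooth_univalent:
  assumes \<phi>: "smooth_self_map \<phi>" shows "univalent \<phi>"
proof -
  note facts = smooth_self_map_facts[OF \<phi>]
  have "continuous_on (cball 0 1) (\<lambda>z. cmod (deriv \<phi> z) powr (- \<alpha>))"
    using facts(6) by (intro continuous_intros facts(3)) auto
  then have "compact ((\<lambda>z. cmod (deriv \<phi> z) powr (- \<alpha>)) ` cball 0 1)"
    by (rule compact_continuous_image) simp
  then obtain B where "\<forall>x\<in>(\<lambda>z. cmod (deriv \<phi> z) powr (- \<alpha>)) ` cball 0 1. norm x \<le> B"
    using compact_imp_bounded bounded_iff by metis
  then have B: "cmod (deriv \<phi> z) powr (- \<alpha>) \<le> B" if "z \<in> ball 0 1" for z using that by auto
  have "weight z \<le> B * weight (\<phi> z)" if z: "z \<in> ball 0 1" for z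
    using weight_schwarz_pick[OF \<phi> z] mult_right_mono[OF B[OF z] weight_nonneg, of "\<phi> z"] by linarith
  then show ?thesis using facts(1) \<phi> unfolding univalent_def smooth_self_map_def by blast
qed

lemma powr_half_square: "(x powr (- \<alpha> / 2))\<^sup>2 = x powr (- \<alpha>)" for x :: real
  by (simp add: power2_eq_square flip: powr_add)

text \<open>
  A polynomial \<open>p\<close> that separates the values of \<open>s\<close> and \<open>t\<close> at contact points does so,
  by continuity, wherever the images under \<open>\<psi>\<close> and \<open>\<phi>\<close> are close to the circle. The
  Schwarz-Pick lemma turns this into the comparisons of weights required for the
  domination of \<open>Comp \<psi>\<close> by \<open>V p\<close> and for the bound on \<open>Comp \<phi>\<close> after \<open>V p\<close>. Two
  passages to adjoints, and the domination of \<open>V p\<close> by its adjoint, then combine these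
  facts.
\<close>

lemma upper_bound:
  assumes \<phi>: "smooth_self_map \<phi>" and \<psi>: "smooth_self_map \<psi>" and W: "adjoint_pair (Comp \<psi>) W"
    and m: "0 \<le> m" "\<And>\<xi> \<zeta>. \<xi> \<in> sphere 0 1 \<Longrightarrow> \<zeta> \<in> sphere 0 1 \<Longrightarrow> \<phi> \<xi> = \<psi> \<zeta> \<Longrightarrow> \<phi> \<xi> \<in> sphere 0 1 \<Longrightarrow>
       cmod (deriv \<psi> \<zeta>) powr (- \<alpha> / 2) * cmod (deriv \<phi> \<xi>) powr (- \<alpha> / 2) \<le> m"
  shows "ess_le (\<lambda>f. Comp \<phi> (W f)) m"
proof -
  have *: "ess_le (\<lambda>f. Comp \<phi> (W f)) (m + \<epsilon>)" if \<epsilon>: "\<epsilon> > 0" for \<epsilon>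
  proof -
    note f\<phi> = smooth_self_map_facts[OF \<phi>] and f\<psi> = smooth_self_map_facts[OF \<psi>]
    define \<Gamma> where "\<Gamma> = {\<xi> \<in> sphere 0 1. \<phi> \<xi> \<in> sphere 0 1}"
    define \<Delta> where "\<Delta> = {\<xi> \<in> sphere 0 1. \<psi> \<xi> \<in> sphere 0 1}"
    define t where "t z = cmod (deriv \<phi> z) powr (- \<alpha> / 2)" for z
    define s where "s z = cmod (deriv \<psi> z) powr (- \<alpha> / 2)" for z
    have tc: "continuous_on (cball 0 1) t" unfolding t_def using f\<phi>(6) by (intro continuous_intros f\<phi>(3)) auto
    have sc: "continuous_on (cball 0 1) s" unfolding s_def using f\<psi>(6) by (intro continuous_intros f\<psi>(3)) auto
    have cpt: "compact {\<xi> \<in> sphere 0 1. h \<xi> \<in> sphere 0 1}" if "continuous_on (cball 0 1) h" for h :: "complex \<Rightarrow> complex"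
    proof -
      have "continuous_on (sphere 0 1) h" by (rule continuous_on_subset[OF that]) auto
      then have "closedin (top_of_set (sphere 0 1)) (sphere 0 1 \<inter> h -` sphere 0 1)"
        by (rule continuous_closedin_preimage) simp
      moreover have "sphere 0 1 \<inter> h -` sphere 0 1 = {\<xi> \<in> sphere 0 1. h \<xi> \<in> sphere 0 1}" by auto
      ultimately show ?thesis using closedin_compact[OF compact_sphere] by metis
    qed
    have sub: "\<Gamma> \<subseteq> cball 0 1" "\<Delta> \<subseteq> cball 0 1" by (auto simp: \<Gamma>_def \<Delta>_def)
    obtain p where p1: "\<And>\<zeta>. \<zeta> \<in> \<Delta> \<Longrightarrow> s \<zeta> < cmod (poly p (\<psi> \<zeta>))"
      and p2: "\<And>\<xi>. \<xi> \<in> \<Gamma> \<Longrightarrow> cmod (poly p (\<phi> \<xi>)) * t \<xi> < m + \<epsilon>"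
    proof (rule separating_polynomial[of \<Gamma> \<phi> t \<Delta> \<psi> s m \<epsilon>])
      show "compact \<Gamma>" "compact \<Delta>" unfolding \<Gamma>_def \<Delta>_def by (intro cpt f\<phi>(2) f\<psi>(2))+
      show "continuous_on \<Gamma> \<phi>" "continuous_on \<Gamma> t" by (rule continuous_on_subset[OF _ sub(1)], rule f\<phi>(2) tc)+
      show "continuous_on \<Delta> \<psi>" "continuous_on \<Delta> s" by (rule continuous_on_subset[OF _ sub(2)], rule f\<psi>(2) sc)+
      show "\<phi> ` \<Gamma> \<subseteq> sphere 0 1" "\<psi> ` \<Delta> \<subseteq> sphere 0 1" by (auto simp: \<Gamma>_def \<Delta>_def)
      show "0 < t \<xi>" if "\<xi> \<in> \<Gamma>" for \<xi> using f\<phi>(6)[of \<xi>] sub(1) that by (auto simp: t_def)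
      show "0 < s \<xi>" if "\<xi> \<in> \<Delta>" for \<xi> using f\<psi>(6)[of \<xi>] sub(2) that by (auto simp: s_def)
      show "s \<zeta> * t \<xi> \<le> m" if "\<xi> \<in> \<Gamma>" "\<zeta> \<in> \<Delta>" "\<phi> \<xi> = \<psi> \<zeta>" for \<xi> \<zeta>
        unfolding s_def t_def using that by (intro m(2)) (auto simp: \<Gamma>_def \<Delta>_def)
    qed (use m(1) \<epsilon> in auto)
    have pc: "continuous_on A (\<lambda>z. poly p (h z))" if "continuous_on A h" for A and h :: "complex \<Rightarrow> complex"
      using that by (intro continuous_intros)
    obtain \<rho>1 where \<rho>1: "\<rho>1 < 1" "\<And>z. z \<in> cball 0 1 \<Longrightarrow> \<rho>1 < cmod (\<psi> z) \<Longrightarrow> 0 < cmod (poly p (\<psi> z)) - s z"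
    proof (rule positive_near_contact[OF \<psi>, of "\<lambda>z. cmod (poly p (\<psi> z)) - s z"])
      show "continuous_on (cball 0 1) (\<lambda>z. cmod (poly p (\<psi> z)) - s z)" by (intro continuous_intros pc f\<psi>(2) sc)
      show "0 < cmod (poly p (\<psi> \<xi>)) - s \<xi>" if "\<xi> \<in> sphere 0 1" "\<psi> \<xi> \<in> sphere 0 1" for \<xi>
        using p1[of \<xi>] that by (simp add: \<Delta>_def)
    qed auto
    obtain \<rho>2 where \<rho>2: "\<rho>2 < 1" "\<And>z. z \<in> cball 0 1 \<Longrightarrow> \<rho>2 < cmod (\<phi> z) \<Longrightarrow> 0 < m + \<epsilon> - cmod (poly p (\<phi> z)) * t z"
    proof (rule positive_near_contact[OF \<phi>, of "\<lambda>z. m + \<epsilon> - cmod (poly p (\<phi> z)) * t z"])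
      show "continuous_on (cball 0 1) (\<lambda>z. m + \<epsilon> - cmod (poly p (\<phi> z)) * t z)" by (intro continuous_intros pc f\<phi>(2) tc)
      show "0 < m + \<epsilon> - cmod (poly p (\<phi> \<xi>)) * t \<xi>" if "\<xi> \<in> sphere 0 1" "\<phi> \<xi> \<in> sphere 0 1" for \<xi>
        using p2[of \<xi>] that by (simp add: \<Gamma>_def)
    qed auto
    \<comment> \<open>\<open>Comp \<psi>\<close> is dominated by \<open>V p\<close>, and \<open>Comp \<phi>\<close> after \<open>V p\<close> is essentially bounded by
      \<open>m + \<epsilon>\<close>.\<close>
    have u\<phi>: "univalent \<phi>" and u\<psi>: "univalent \<psi>" using \<phi> \<psi> by (auto intro: smooth_univalent)
    have d1: "ess_dom (Comp \<psi>) (V p)"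
    proof (rule ess_dom_Comp[OF u\<psi> \<rho>1(1)])
      fix z assume z: "z \<in> ball 0 1" "\<rho>1 < cmod (\<psi> z)"
      have "s z \<le> cmod (poly p (\<psi> z))" "0 \<le> s z" using \<rho>1(2)[of z] z by (auto simp: s_def)
      then have "(s z)\<^sup>2 \<le> (cmod (poly p (\<psi> z)))\<^sup>2" by (intro power_mono)
      then have "(s z)\<^sup>2 * weight (\<psi> z) \<le> (cmod (poly p (\<psi> z)))\<^sup>2 * weight (\<psi> z)" by (intro mult_right_mono weight_nonneg)
      then show "weight z \<le> (cmod (poly p (\<psi> z)))\<^sup>2 * weight (\<psi> z)"
        using weight_schwarz_pick[OF \<psi> z(1)] unfolding s_def powr_half_square by linarith
    qed
    have d2: "ess_le (\<lambda>f. Comp \<phi> (V p f)) (m + \<epsilon>)"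
    proof (rule ess_le_Comp_V[OF u\<phi> \<rho>2(1)])
      fix z assume z: "z \<in> ball 0 1" "\<rho>2 < cmod (\<phi> z)"
      have "cmod (poly p (\<phi> z)) * t z \<le> m + \<epsilon>" "0 \<le> t z" using \<rho>2(2)[of z] z by (auto simp: t_def)
      then have "(cmod (poly p (\<phi> z)) * t z)\<^sup>2 \<le> (m + \<epsilon>)\<^sup>2" by (intro power_mono) auto
      then have le: "(cmod (poly p (\<phi> z)))\<^sup>2 * (t z)\<^sup>2 * weight (\<phi> z) \<le> (m + \<epsilon>)\<^sup>2 * weight (\<phi> z)"
        by (intro mult_right_mono weight_nonneg) (simp add: power_mult_distrib)
      have "(cmod (poly p (\<phi> z)))\<^sup>2 * weight z \<le> (cmod (poly p (\<phi> z)))\<^sup>2 * ((t z)\<^sup>2 * weight (\<phi> z))"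
        using weight_schwarz_pick[OF \<phi> z(1)] unfolding t_def powr_half_square by (intro mult_left_mono) auto
      then show "(cmod (poly p (\<phi> z)))\<^sup>2 * weight z \<le> (m + \<epsilon>)\<^sup>2 * weight (\<phi> z)" using le by (simp add: mult.assoc)
    qed (use m(1) \<epsilon> in auto)
    \<comment> \<open>With \<open>Wp\<close> and \<open>W\<phi>\<close> the adjoints of \<open>V p\<close> and \<open>Comp \<phi>\<close>: the bound passes to \<open>Wp\<close> after
      \<open>W\<phi>\<close>, by domination to \<open>Comp \<psi>\<close> after \<open>W\<phi>\<close>, and by a second adjunction to
      \<open>Comp \<phi>\<close> after \<open>W\<close>.\<close>
    obtain Wp where Wp: "adjoint_pair (V p) Wp" using adjoint_pair_exists[OF bounded_V] by blast
    obtain W\<phi> where W\<phi>: "adjoint_pair (Comp \<phi>) W\<phi>" using adjoint_pair_exists[OF bounded_Comp[OF u\<phi>]] by blast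
    have m\<epsilon>: "0 \<le> m + \<epsilon>" using m(1) \<epsilon> by simp
    have 1: "ess_le (\<lambda>f. Wp (W\<phi> f)) (m + \<epsilon>)"
      by (rule ess_le_adjoint[OF adjoint_pair_comp[OF W\<phi> Wp] d2 m\<epsilon>])
    have "ess_dom (Comp \<psi>) Wp" by (rule ess_dom_trans[OF d1 ess_dom_V_adjoint[OF Wp]])
    then have "ess_dom (\<lambda>f. Comp \<psi> (W\<phi> f)) (\<lambda>f. Wp (W\<phi> f))"
      by (rule ess_dom_comp[OF _ bounded_Comp[OF u\<psi>] _ adjoint_pair_sym[OF W\<phi>]]) (use Wp in \<open>simp add: adjoint_pair_def\<close>)
    then have "ess_le (\<lambda>f. Comp \<psi> (W\<phi> f)) (m + \<epsilon>)" by (rule ess_dom_imp_le[OF _ 1 m\<epsilon>])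
    then show ?thesis by (rule ess_le_adjoint[OF adjoint_pair_comp[OF W adjoint_pair_sym[OF W\<phi>]] _ m\<epsilon>])
  qed
  show ?thesis unfolding ess_le_def
  proof (intro allI impI)
    fix \<epsilon> :: real assume "\<epsilon> > 0"
    then have e2: "\<epsilon> / 2 > 0" by simp
    moreover have eq: "m + \<epsilon> / 2 + \<epsilon> / 2 = m + \<epsilon>" by simp
    ultimately show "\<exists>N. \<forall>f\<in>D. nrm (Comp \<phi> (W (R N f))) \<le> (m + \<epsilon>) * nrm f"
      using *[OF e2] unfolding ess_le_def by (metis eq)
  qed
qed

section \<open>Kernels that reproduce the derivative\<close>

text \<open>
  The Bergman kernel for the weight, without a normalizing constant. The base
  \<open>1 - cnj w * z\<close> has positive real part, so the principal branch of the power is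
  holomorphic.
\<close>

definition ker :: "complex \<Rightarrow> complex \<Rightarrow> complex" where
  "ker w z = (1 - cnj w * z) powr (- of_real (\<alpha> + 2))"

lemma Re_one_minus: "w \<in> ball 0 1 \<Longrightarrow> z \<in> cball 0 1 \<Longrightarrow> 0 < Re (1 - cnj w * z)"
proof -
  assume w: "w \<in> ball 0 1" "z \<in> cball 0 1"
  have "Re (cnj w * z) \<le> cmod w * cmod z" using complex_Re_le_cmod[of "cnj w * z"] by (simp add: norm_mult)
  also have "\<dots> \<le> cmod w * 1" using w by (intro mult_left_mono) auto
  also have "\<dots> < 1" using w by simp
  finally show ?thesis by simp
qed

lemma one_minus_not_nonpos: "w \<in> ball 0 1 \<Longrightarrow> z \<in> cball 0 1 \<Longrightarrow> 1 - cnj w * z \<notin> \<real>\<^sub>\<le>\<^sub>0"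
  using Re_one_minus[of w z] unfolding complex_nonpos_Reals_iff by linarith

lemma one_minus_nonzero: "w \<in> ball 0 1 \<Longrightarrow> z \<in> cball 0 1 \<Longrightarrow> 1 - cnj w * z \<noteq> 0"
  using Re_one_minus[of w z] by (metis less_irrefl zero_complex.sel(1))

lemma ker_holo_cball: "w \<in> ball 0 1 \<Longrightarrow> ker w holomorphic_on cball 0 1"
  unfolding ker_def by (intro holomorphic_intros one_minus_not_nonpos)

lemma ker_continuous: "w \<in> ball 0 1 \<Longrightarrow> continuous_on (cball 0 1) (ker w)"
  by (intro holomorphic_on_imp_continuous_on ker_holo_cball)

lemma ker_holo: "w \<in> ball 0 1 \<Longrightarrow> ker w holomorphic_on ball 0 1"
  using ker_holo_cball holomorphic_on_subset ball_subset_cball by blast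

lemma norm_ker:
  assumes "w \<in> ball 0 1" "z \<in> cball 0 1"
  shows "cmod (ker w z) = cmod (1 - cnj w * z) powr (- (\<alpha> + 2))"
proof -
  have "- complex_of_real (\<alpha> + 2) \<in> \<real>" by (intro Reals_minus Reals_of_real)
  from norm_powr_real_powr'[OF this] show ?thesis by (simp add: ker_def)
qed

definition kprim :: "complex \<Rightarrow> complex \<Rightarrow> complex" where
  "kprim w = primitive (ker w)"

lemma bounded_holo_L2:
  assumes "F holomorphic_on ball 0 1" "continuous_on (cball 0 1) F"
  shows "L2 F"
proof -
  have "compact (F ` cball 0 1)" by (rule compact_continuous_image[OF assms(2)]) simp
  then obtain B where B: "\<forall>x\<in>F ` cball 0 1. norm x \<le> B" using compact_imp_bounded bounded_iff by metis
  have m: "F \<in> borel_measurable \<mu>" by (rule holomorphic_imp_mu[OF assms(1)])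
  have "integrable \<mu> (\<lambda>z. (cmod (F z))\<^sup>2)"
  proof (rule integrable_bounded_mu[where B = "B\<^sup>2"])
    show "(\<lambda>z. (cmod (F z))\<^sup>2) \<in> borel_measurable \<mu>" using m by measurable
    show "norm ((cmod (F z))\<^sup>2) \<le> B\<^sup>2" if "z \<in> ball 0 1" for z using B that by (auto intro!: power_mono)
  qed
  then show ?thesis using m by (simp add: L2_def)
qed

lemma kprim_in_D: "w \<in> ball 0 1 \<Longrightarrow> kprim w \<in> D"
  unfolding kprim_def using bounded_holo_L2[OF ker_holo ker_continuous, of w]
  by (intro primitive_in_D ker_holo) (auto simp: L2_def)

lemma deriv_kprim: "w \<in> ball 0 1 \<Longrightarrow> z \<in> ball 0 1 \<Longrightarrow> deriv (kprim w) z = ker w z"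
  unfolding kprim_def by (rule deriv_primitive[OF ker_holo])

text \<open>
  The involutive automorphism of the disc that exchanges 0 and \<open>w\<close>.
\<close>

definition disc_aut :: "complex \<Rightarrow> complex \<Rightarrow> complex" where
  "disc_aut w z = (w - z) / (1 - cnj w * z)"

context
  fixes w :: complex
  assumes w: "w \<in> ball 0 1"
begin

lemma den_nz: "z \<in> cball 0 1 \<Longrightarrow> 1 - cnj w * z \<noteq> 0"
  by (rule one_minus_nonzero[OF w])

lemma one_minus_norm_pos: "0 < 1 - (cmod w)\<^sup>2"
  using w power_strict_mono[of "cmod w" 1 2] by simp

lemma one_minus_disc_aut:
  assumes z: "z \<in> cball 0 1"
  shows "1 - cnj w * disc_aut w z = of_real (1 - (cmod w)\<^sup>2) / (1 - cnj w * z)"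
proof -
  have "1 - cnj w * disc_aut w z = (1 - w * cnj w) / (1 - cnj w * z)"
    using den_nz[OF z] by (simp add: disc_aut_def field_simps)
  then show ?thesis unfolding complex_norm_square[symmetric] by simp
qed

lemma disc_aut_norm:
  assumes z: "z \<in> cball 0 1"
  shows "1 - (cmod (disc_aut w z))\<^sup>2 = (1 - (cmod w)\<^sup>2) * (1 - (cmod z)\<^sup>2) / (cmod (1 - cnj w * z))\<^sup>2"
proof -
  have nz: "(cmod (1 - cnj w * z))\<^sup>2 \<noteq> 0" using den_nz[OF z] by simp
  have "(cmod (1 - cnj w * z))\<^sup>2 - (cmod (w - z))\<^sup>2 = (1 - (cmod w)\<^sup>2) * (1 - (cmod z)\<^sup>2)"
    unfolding cmod_power2 by (simp add: power2_eq_square algebra_simps)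
  then show ?thesis using nz by (simp add: disc_aut_def norm_divide power_divide field_simps)
qed

lemma disc_aut_ball: "z \<in> ball 0 1 \<Longrightarrow> disc_aut w z \<in> ball 0 1"
proof -
  assume z: "z \<in> ball 0 1"
  have "0 < 1 - (cmod z)\<^sup>2" using z power_strict_mono[of "cmod z" 1 2] by simp
  then have "0 < (1 - (cmod w)\<^sup>2) * (1 - (cmod z)\<^sup>2) / (cmod (1 - cnj w * z))\<^sup>2"
    using one_minus_norm_pos den_nz[of z] z by (intro divide_pos_pos mult_pos_pos) auto
  then have "(cmod (disc_aut w z))\<^sup>2 < 1" using disc_aut_norm[of z] z by simp
  then show ?thesis by (simp add: abs_square_less_1)
qed

lemma disc_aut_involution: "z \<in> ball 0 1 \<Longrightarrow> disc_aut w (disc_aut w z) = z"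
proof -
  assume z: "z \<in> ball 0 1"
  then have nz: "1 - cnj w * z \<noteq> 0" by (intro den_nz) auto
  have r: "complex_of_real (1 - (cmod w)\<^sup>2) = 1 - w * cnj w" by (simp add: complex_norm_square del: of_real_power)
  have nr: "1 - w * cnj w \<noteq> 0" unfolding r[symmetric] of_real_eq_0_iff using one_minus_norm_pos by simp
  have "disc_aut w (disc_aut w z) = (w - disc_aut w z) / ((1 - w * cnj w) / (1 - cnj w * z))"
    unfolding disc_aut_def[of w "disc_aut w z"] using one_minus_disc_aut[of z] z r by simp
  also have "w - disc_aut w z = z * (1 - w * cnj w) / (1 - cnj w * z)"
    using nz by (simp add: disc_aut_def field_simps)
  also have "\<dots> / ((1 - w * cnj w) / (1 - cnj w * z)) = z" using nz nr by simp
  finally show ?thesis .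
qed

lemma disc_aut_image: "disc_aut w ` ball 0 1 = ball 0 1"
  using disc_aut_ball disc_aut_involution by (metis image_subset_iff subset_antisym subsetI image_eqI)

lemma disc_aut_inj: "inj_on (disc_aut w) (ball 0 1)"
  using disc_aut_involution by (metis inj_onI)

lemma disc_aut_holo: "disc_aut w holomorphic_on ball 0 1"
  unfolding disc_aut_def using den_nz by (intro holomorphic_intros) auto

lemma deriv_disc_aut:
  assumes z: "z \<in> ball 0 1"
  shows "deriv (disc_aut w) z = - of_real (1 - (cmod w)\<^sup>2) / (1 - cnj w * z)\<^sup>2"
proof (rule DERIV_imp_deriv)
  have nz: "1 - cnj w * z \<noteq> 0" using z by (intro den_nz) auto
  have "(disc_aut w has_field_derivative (w * cnj w - 1) / (1 - cnj w * z)\<^sup>2) (at z)"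
    unfolding disc_aut_def using nz by (auto intro!: derivative_eq_intros simp: field_simps power2_eq_square)
  also have "w * cnj w - 1 = - of_real (1 - (cmod w)\<^sup>2)" by (simp add: complex_norm_square del: of_real_power)
  finally show "(disc_aut w has_field_derivative - of_real (1 - (cmod w)\<^sup>2) / (1 - cnj w * z)\<^sup>2) (at z)" .
qed

lemma weight_disc_aut:
  assumes z: "z \<in> ball 0 1"
  shows "weight (disc_aut w z) = weight z * ((1 - (cmod w)\<^sup>2) / (cmod (1 - cnj w * z))\<^sup>2) powr \<alpha>"
proof -
  have "0 \<le> 1 - (cmod z)\<^sup>2" using z by (simp add: abs_square_le_1)
  then have "((1 - (cmod w)\<^sup>2) * (1 - (cmod z)\<^sup>2) / (cmod (1 - cnj w * z))\<^sup>2) powr \<alpha>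
     = (1 - (cmod z)\<^sup>2) powr \<alpha> * ((1 - (cmod w)\<^sup>2) / (cmod (1 - cnj w * z))\<^sup>2) powr \<alpha>"
    using one_minus_norm_pos by (subst powr_mult[symmetric]) (auto simp: mult_ac)
  then show ?thesis using disc_aut_norm[of z] z by (simp add: weight_def)
qed

end

context
  fixes w :: complex
  assumes w: "w \<in> ball 0 1"
begin

text \<open>
  The modulus of the derivative of \<open>disc_aut w\<close> at \<open>z\<close>.
\<close>

definition jac :: "complex \<Rightarrow> real" where
  "jac z = ((1 - (cmod w)\<^sup>2) / (cmod (1 - cnj w * z))\<^sup>2)"

lemma jac_pos: "z \<in> cball 0 1 \<Longrightarrow> 0 < jac z"
  unfolding jac_def using one_minus_norm_pos[OF w] one_minus_nonzero[OF w] by (intro divide_pos_pos) auto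

lemma jac_disc_aut: "z \<in> ball 0 1 \<Longrightarrow> jac (disc_aut w z) = 1 / jac z"
proof -
  assume z: "z \<in> ball 0 1"
  have r: "1 - (cmod w)\<^sup>2 > 0" by (rule one_minus_norm_pos[OF w])
  have "cmod (1 - cnj w * disc_aut w z) = \<bar>1 - (cmod w)\<^sup>2\<bar> / cmod (1 - cnj w * z)"
    using one_minus_disc_aut[OF w, of z] z by (simp only: norm_divide norm_of_real mem_ball mem_cball less_imp_le)
  then have "cmod (1 - cnj w * disc_aut w z) = (1 - (cmod w)\<^sup>2) / cmod (1 - cnj w * z)" using r by simp
  then show ?thesis using r by (simp add: jac_def power_divide power2_eq_square)
qed

lemma jac_measurable: "jac \<in> borel_measurable borel"
  unfolding jac_def
  by (intro borel_measurable_divide borel_measurable_power borel_measurable_continuous_onI continuous_intros)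

text \<open>
  Under \<open>disc_aut w\<close> Lebesgue measure contributes the factor \<open>jac ^ 2\<close> and the weight
  the factor \<open>jac powr \<alpha>\<close>.
\<close>

lemma nn_integral_disc_aut:
  assumes H: "H \<in> borel_measurable \<mu>"
  shows "(\<integral>\<^sup>+z. ennreal ((jac z)\<^sup>2 * jac z powr \<alpha>) * H (disc_aut w z) \<partial>\<mu>) = (\<integral>\<^sup>+z. H z \<partial>\<mu>)"
proof -
  define H' where "H' u = H u * ennreal (1 / jac u powr \<alpha>)" for u
  have m1: "(\<lambda>u. ennreal (1 / jac u powr \<alpha>)) \<in> borel_measurable borel"
    using jac_measurable by measurable
  have H': "H' \<in> borel_measurable \<mu>"
    unfolding H'_def by (rule borel_measurable_times_ennreal[OF H borel_imp_mu[OF m1]])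
  have b: "(\<lambda>u. ennreal (jac u powr \<alpha>)) \<in> borel_measurable borel" using jac_measurable by measurable
  have "(\<integral>\<^sup>+z. ennreal ((cmod (deriv (disc_aut w) z))\<^sup>2) * H' (disc_aut w z) \<partial>\<mu>)
      = (\<integral>\<^sup>+u. ennreal (jac u powr \<alpha>) * H' u * indicator (disc_aut w ` ball 0 1) u \<partial>\<mu>)"
  proof (rule nn_integral_mu_substitution[OF disc_aut_holo[OF w] disc_aut_inj[OF w] _ H' b])
    show "disc_aut w ` ball 0 1 \<subseteq> ball 0 1" using disc_aut_image[OF w] by simp
    fix z assume z: "z \<in> ball (0::complex) 1"
    have j: "jac z > 0" using z by (intro jac_pos) auto
    have "jac (disc_aut w z) powr \<alpha> * weight (disc_aut w z) = (1 / jac z) powr \<alpha> * (weight z * jac z powr \<alpha>)"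
      unfolding jac_disc_aut[OF z] weight_disc_aut[OF w z] jac_def[symmetric] ..
    also have "\<dots> = weight z" using j by (simp add: powr_divide)
    finally show "ennreal (weight z) = ennreal (jac (disc_aut w z) powr \<alpha>) * ennreal (weight (disc_aut w z))"
      using weight_nonneg by (simp add: ennreal_mult[symmetric])
  qed
  also have "\<dots> = (\<integral>\<^sup>+u. H u \<partial>\<mu>)"
  proof (rule nn_integral_cong)
    fix u assume "u \<in> space \<mu>"
    then have u: "u \<in> ball 0 1" by (simp add: space_mu)
    have j: "jac u powr \<alpha> > 0" using jac_pos[of u] u by simp
    have "ennreal (jac u powr \<alpha>) * ennreal (1 / jac u powr \<alpha>) = 1"
      using j by (simp add: ennreal_mult[symmetric] del: divide_powr_uminus)
    then show "ennreal (jac u powr \<alpha>) * H' u * indicator (disc_aut w ` ball 0 1) u = H u"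
      using u disc_aut_image[OF w] unfolding H'_def by (simp add: mult.left_commute mult.commute)
  qed
  also have "(\<integral>\<^sup>+z. ennreal ((cmod (deriv (disc_aut w) z))\<^sup>2) * H' (disc_aut w z) \<partial>\<mu>)
      = (\<integral>\<^sup>+z. ennreal ((jac z)\<^sup>2 * jac z powr \<alpha>) * H (disc_aut w z) \<partial>\<mu>)"
  proof (rule nn_integral_cong)
    fix z assume "z \<in> space \<mu>"
    then have z: "z \<in> ball 0 1" by (simp add: space_mu)
    have j: "jac z > 0" using z by (intro jac_pos) auto
    have r: "1 - (cmod w)\<^sup>2 > 0" by (rule one_minus_norm_pos[OF w])
    have "cmod (deriv (disc_aut w) z) = jac z"
      unfolding deriv_disc_aut[OF w z] jac_def norm_divide norm_minus_cancel norm_of_real norm_power using r by simp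
    moreover have "1 / jac (disc_aut w z) powr \<alpha> = jac z powr \<alpha>"
      unfolding jac_disc_aut[OF z] using j by (simp add: powr_divide)
    ultimately show "ennreal ((cmod (deriv (disc_aut w) z))\<^sup>2) * H' (disc_aut w z)
        = ennreal ((jac z)\<^sup>2 * jac z powr \<alpha>) * H (disc_aut w z)"
      by (simp add: H'_def ennreal_mult mult_ac)
  qed
  finally show ?thesis .
qed

text \<open>
  The Jacobian factor of the substitution by \<open>disc_aut w\<close> turns the conjugate of the
  kernel into the kernel itself, because \<open>cnj (1 - cnj w * disc_aut w z)\<close> is the
  positive number \<open>jac z\<close> times \<open>1 - cnj w * z\<close>. A positive factor may be taken out of a
  principal power.
\<close>

lemma ker_disc_aut:
  assumes z: "z \<in> ball 0 1"
  shows "of_real ((jac z)\<^sup>2 * jac z powr \<alpha>) * cnj (ker w (disc_aut w z)) = ker w z"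
proof -
  define q where "q = 1 - cnj w * z"
  define j where "j = jac z"
  have j: "j > 0" unfolding j_def using z by (intro jac_pos) auto
  have q: "q \<noteq> 0" "q \<notin> \<real>\<^sub>\<le>\<^sub>0"
    unfolding q_def using one_minus_nonzero[OF w, of z] one_minus_not_nonpos[OF w, of z] z by (simp_all only: mem_ball mem_cball less_imp_le not_False_eq_True)
  have t: "disc_aut w z \<in> cball 0 1" using disc_aut_ball[OF w z] by auto
  have "1 - cnj w * disc_aut w z = of_real (1 - (cmod w)\<^sup>2) / q"
    unfolding q_def using z by (intro one_minus_disc_aut[OF w]) auto
  also have "\<dots> = of_real j * cnj q"
  proof -
    have "of_real j = of_real (1 - (cmod w)\<^sup>2) / (q * cnj q)"
      unfolding j_def jac_def q_def[symmetric] of_real_divide complex_norm_square ..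
    then show ?thesis using q(1) by simp
  qed
  finally have eq: "cnj (1 - cnj w * disc_aut w z) = of_real j * q" by simp
  have "cnj (ker w (disc_aut w z)) = cnj (1 - cnj w * disc_aut w z) powr cnj (- of_real (\<alpha> + 2))"
    unfolding ker_def using one_minus_not_nonpos[OF w t] by (intro cnj_powr) (auto simp: complex_nonpos_Reals_iff)
  also have "\<dots> = (of_real j * q) powr (- of_real (\<alpha> + 2))" unfolding eq by simp
  also have "\<dots> = exp (- of_real (\<alpha> + 2) * (of_real (ln j) + Ln q))"
    unfolding powr_def using j q(1) by (simp add: Ln_times_of_real Ln_of_real)
  also have "\<dots> = of_real (exp (- (\<alpha> + 2) * ln j)) * ker w z"
    unfolding ker_def q_def[symmetric] powr_def using q(1) by (simp add: exp_add[symmetric] algebra_simps exp_of_real[symmetric])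
  finally have "cnj (ker w (disc_aut w z)) = of_real (exp (- (\<alpha> + 2) * ln j)) * ker w z" .
  moreover have "j\<^sup>2 * j powr \<alpha> * exp (- (\<alpha> + 2) * ln j) = 1"
  proof -
    have "j\<^sup>2 = exp (2 * ln j)" using j by (simp add: exp_double)
    then show ?thesis using j by (simp add: powr_def exp_add[symmetric] algebra_simps)
  qed
  ultimately show ?thesis unfolding j_def[symmetric]
    by (metis (no_types, lifting) mult.assoc mult_1 of_real_1 of_real_mult)
qed

lemma univalent_disc_aut: "univalent (disc_aut w)"
proof -
  define r where "r = 1 - (cmod w)\<^sup>2"
  have r: "r > 0" unfolding r_def by (rule one_minus_norm_pos[OF w])
  have le: "weight z \<le> (1 / (r / 4) powr \<alpha>) * weight (disc_aut w z)" if z: "z \<in> ball 0 1" for z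
  proof -
    have "cmod (1 - cnj w * z) \<le> 1 + cmod w * cmod z"
      using norm_triangle_ineq4[of 1 "cnj w * z"] by (simp add: norm_mult)
    also have "\<dots> \<le> 1 + 1 * 1" using w z by (intro add_left_mono mult_mono) auto
    finally have "(cmod (1 - cnj w * z))\<^sup>2 \<le> 2\<^sup>2" by (intro power_mono) auto
    then have "r / 4 \<le> jac z" unfolding jac_def r_def[symmetric] using r one_minus_nonzero[OF w, of z] z
      by (intro divide_left_mono) auto
    then have "(r / 4) powr \<alpha> \<le> jac z powr \<alpha>" using r alpha_pos by (intro powr_mono2) auto
    then have "weight z * (r / 4) powr \<alpha> \<le> weight z * jac z powr \<alpha>" by (intro mult_left_mono weight_nonneg)
    then have "weight z * (r / 4) powr \<alpha> \<le> weight (disc_aut w z)" using weight_disc_aut[OF w z] by (simp add: jac_def)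
    then show ?thesis using r by (simp add: field_simps)
  qed
  then show ?thesis unfolding univalent_def
    using disc_aut_holo[OF w] disc_aut_inj[OF w] equalityD1[OF disc_aut_image[OF w]] by blast
qed

text \<open>
  Substituting \<open>disc_aut w\<close> moves the point \<open>w\<close> to the centre and makes the integrand
  the holomorphic function \<open>A\<close>, whose integral is its value at 0 times \<open>moment 1 0\<close>, the
  total mass. To see that \<open>A\<close> is square integrable, it is written as a bounded factor
  times the derivative of \<open>f \<circ> disc_aut w\<close>.
\<close>

lemma reproducing_integral:
  assumes f: "f \<in> D"
  shows "(\<integral>z. deriv f z * cnj (ker w z) \<partial>\<mu>) = of_real (moment 1 0) * deriv f w"
proof -
  define A where "A z = deriv f (disc_aut w z) * ker w z" for z
  have tim: "disc_aut w ` ball 0 1 \<subseteq> ball 0 1" using disc_aut_image[OF w] by simp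
  have Ah: "A holomorphic_on ball 0 1"
    unfolding A_def using holomorphic_on_compose_gen[OF disc_aut_holo[OF w] D_deriv_holo[OF f] tim]
    by (intro holomorphic_on_mult ker_holo w) (simp add: o_def)
  have t: "disc_aut w \<in> measurable \<mu> \<mu>" by (rule measurable_self_map[OF disc_aut_holo[OF w] tim])
  have Jm: "(\<lambda>z. (jac z)\<^sup>2 * jac z powr \<alpha>) \<in> borel_measurable \<mu>"
  proof (rule borel_imp_mu)
    note jac_measurable[measurable]
    show "(\<lambda>z. (jac z)\<^sup>2 * jac z powr \<alpha>) \<in> borel_measurable borel" by measurable
  qed
  have kc: "(\<lambda>z. cnj (ker w z)) \<in> borel_measurable \<mu>"
    by (intro continuous_imp_mu continuous_on_cnj holomorphic_on_imp_continuous_on ker_holo w)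
  have "(\<integral>z. deriv f z * cnj (ker w z) \<partial>\<mu>)
      = (\<integral>z. complex_of_real ((jac z)\<^sup>2 * jac z powr \<alpha>) * (deriv f (disc_aut w z) * cnj (ker w (disc_aut w z))) \<partial>\<mu>)"
    by (rule integral_mu_transport[OF t Jm _ nn_integral_disc_aut])
      (auto intro!: borel_measurable_times D_deriv_meas[OF f] kc)
  also have "\<dots> = (\<integral>z. A z \<partial>\<mu>)"
  proof (rule Bochner_Integration.integral_cong[OF refl])
    fix z assume "z \<in> space \<mu>"
    then have z: "z \<in> ball 0 1" by (simp add: space_mu)
    show "complex_of_real ((jac z)\<^sup>2 * jac z powr \<alpha>) * (deriv f (disc_aut w z) * cnj (ker w (disc_aut w z))) = A z"
      unfolding A_def ker_disc_aut[OF z, symmetric] by (simp only: mult_ac)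
  qed
  also have "\<dots> = (\<integral>z. A z * cnj (z ^ 0) \<partial>\<mu>)" by simp
  also have "\<dots> = ((deriv ^^ 0) A 0 / fact 0) * of_real (moment 1 0)"
  proof (rule integral_power_series_monomial)
    show "(\<lambda>n. (deriv ^^ n) A 0 / fact n * z ^ n) sums A z" if "z \<in> ball 0 1" for z
      using holomorphic_power_series[OF Ah that] by simp
    define a where "a z = - ker w z * (1 - cnj w * z)\<^sup>2 / of_real (1 - (cmod w)\<^sup>2)" for z
    have r: "1 - (cmod w)\<^sup>2 > 0" by (rule one_minus_norm_pos[OF w])
    have ac: "continuous_on (cball 0 1) a" unfolding a_def
      by (intro continuous_intros ker_continuous w) (use r in \<open>simp del: of_real_diff\<close>)
    have "compact (a ` cball 0 1)" by (rule compact_continuous_image[OF ac]) simp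
    then obtain B where "\<forall>x\<in>a ` cball 0 1. norm x \<le> B" using compact_imp_bounded bounded_iff by metis
    then have B: "cmod (a z) \<le> B" if "z \<in> ball 0 1" for z using that by auto
    have am: "a \<in> borel_measurable \<mu>" by (rule continuous_imp_mu[OF continuous_on_subset[OF ac]]) auto
    have "L2 (\<lambda>z. a z * deriv (Comp (disc_aut w) f) z)"
      by (rule L2_bounded_mult(1)[OF D_L2[OF Comp_in_D[OF univalent_disc_aut f]] am B])
    then have "integrable \<mu> (\<lambda>z. (cmod (a z * deriv (Comp (disc_aut w) f) z))\<^sup>2)" by (simp add: L2_def)
    then show "integrable \<mu> (\<lambda>z. (cmod (A z))\<^sup>2)"
    proof (rule Bochner_Integration.integrable_cong[THEN iffD1, OF refl, rotated])
      fix z assume "z \<in> space \<mu>"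
      then have z: "z \<in> ball 0 1" by (simp add: space_mu)
      have nz: "1 - cnj w * z \<noteq> 0" using z by (intro one_minus_nonzero[OF w]) auto
      have rn: "complex_of_real (1 - (cmod w)\<^sup>2) \<noteq> 0" using r by (simp only: of_real_eq_0_iff)
      have "a z * deriv (Comp (disc_aut w) f) z = A z"
        unfolding deriv_Comp[OF univalent_disc_aut f z] deriv_disc_aut[OF w z] a_def A_def using nz rn by (simp del: of_real_diff)
      then show "(cmod (a z * deriv (Comp (disc_aut w) f) z))\<^sup>2 = (cmod (A z))\<^sup>2" by simp
    qed
  qed
  also have "\<dots> = of_real (moment 1 0) * deriv f w" by (simp add: A_def disc_aut_def ker_def)
  finally show ?thesis .
qed

end

lemma inner_kprim:
  assumes w: "w \<in> ball 0 1" and f: "f \<in> D"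
  shows "dirichlet_inner \<alpha> f (kprim w) = of_real (moment 1 0) * deriv f w"
proof -
  have "(\<integral>z. deriv f z * cnj (deriv (kprim w) z) \<partial>\<mu>) = (\<integral>z. deriv f z * cnj (ker w z) \<partial>\<mu>)"
    by (rule Bochner_Integration.integral_cong) (simp_all add: space_mu deriv_kprim[OF w])
  then show ?thesis using reproducing_integral[OF w f] by (simp add: dirichlet_inner_def kprim_def)
qed

lemma nrm_kprim:
  assumes w: "w \<in> ball 0 1"
  shows "nrm (kprim w) = sqrt (moment 1 0) * (1 - (cmod w)\<^sup>2) powr (- (\<alpha> + 2) / 2)"
proof -
  have r: "1 - (cmod w)\<^sup>2 > 0" by (rule one_minus_norm_pos[OF w])
  have K: "kprim w \<in> D" by (rule kprim_in_D[OF w])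
  have "of_real ((nrm (kprim w))\<^sup>2) = dirichlet_inner \<alpha> (kprim w) (kprim w)" by (rule ip_self[OF K, symmetric])
  also have "\<dots> = of_real (moment 1 0) * ker w w" unfolding inner_kprim[OF w K] deriv_kprim[OF w w] ..
  finally have "cmod (of_real ((nrm (kprim w))\<^sup>2)) = cmod (of_real (moment 1 0) * ker w w)" by simp
  then have "(nrm (kprim w))\<^sup>2 = moment 1 0 * cmod (ker w w)"
    using moment_nonneg by (simp only: norm_of_real norm_mult abs_power2 abs_of_nonneg)
  also have "cmod (ker w w) = cmod (1 - cnj w * w) powr (- (\<alpha> + 2))" using w by (intro norm_ker) auto
  also have "1 - cnj w * w = of_real (1 - (cmod w)\<^sup>2)"
    using complex_norm_square[of w] by (simp add: mult.commute)
  also have "cmod (of_real (1 - (cmod w)\<^sup>2)) = 1 - (cmod w)\<^sup>2" unfolding norm_of_real using r by simp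
  also have "(1 - (cmod w)\<^sup>2) powr (- (\<alpha> + 2)) = ((1 - (cmod w)\<^sup>2) powr (- (\<alpha> + 2) / 2))\<^sup>2"
    by (simp add: power2_eq_square flip: powr_add)
  finally have "nrm (kprim w) = sqrt (moment 1 0 * ((1 - (cmod w)\<^sup>2) powr (- (\<alpha> + 2) / 2))\<^sup>2)"
    using nrm_nonneg[OF K] by (metis real_sqrt_unique)
  then show ?thesis by (simp add: real_sqrt_mult)
qed

text \<open>
  The inner product with \<open>kprim w\<close> evaluates the derivative at \<open>w\<close>, so this is the chain
  rule read through the adjoint.
\<close>

lemma adjoint_kprim:
  assumes \<psi>: "univalent \<psi>" and W: "adjoint_pair (Comp \<psi>) W" and w: "w \<in> ball 0 1"
  shows "W (kprim w) = (\<lambda>z. cnj (deriv \<psi> w) * kprim (\<psi> w) z)"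
proof (rule ip_eqI)
  have pw: "\<psi> w \<in> ball 0 1" by (rule univalent_ball[OF \<psi> w])
  have K: "kprim w \<in> D" "kprim (\<psi> w) \<in> D" by (rule kprim_in_D[OF w], rule kprim_in_D[OF pw])
  show "W (kprim w) \<in> D" using W K by (simp add: adjoint_pair_def bounded_op_in)
  show "(\<lambda>z. cnj (deriv \<psi> w) * kprim (\<psi> w) z) \<in> D" by (rule scale_in[OF K(2)])
  fix h assume h: "h \<in> D"
  have "dirichlet_inner \<alpha> h (W (kprim w)) = dirichlet_inner \<alpha> (Comp \<psi> h) (kprim w)"
    using W h K by (simp add: adjoint_pair_def)
  also have "\<dots> = of_real (moment 1 0) * (deriv h (\<psi> w) * deriv \<psi> w)"
    unfolding inner_kprim[OF w Comp_in_D[OF \<psi> h]] deriv_Comp[OF \<psi> h w] ..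
  also have "\<dots> = dirichlet_inner \<alpha> h (\<lambda>z. cnj (deriv \<psi> w) * kprim (\<psi> w) z)"
    unfolding ip_scale2[OF K(2) h] inner_kprim[OF pw h] by simp
  finally show "dirichlet_inner \<alpha> h (W (kprim w)) = dirichlet_inner \<alpha> h (\<lambda>z. cnj (deriv \<psi> w) * kprim (\<psi> w) z)" .
qed

end

section \<open>The lower estimate\<close>

text \<open>
  The function \<open>Re (cnj (\<phi> \<xi>) * \<phi> z)\<close> on the closed disc is maximal at \<open>\<xi>\<close>. Its
  derivative along the circle vanishes there, which makes \<open>\<xi> * \<phi>' \<xi> * cnj (\<phi> \<xi>)\<close> real,
  and its outward radial derivative is nonnegative.
\<close>

lemma angular_derivative_positive:
  assumes \<phi>: "smooth_self_map \<phi>" and \<xi>: "\<xi> \<in> sphere 0 1" "\<phi> \<xi> \<in> sphere 0 1"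
  shows "\<xi> * deriv \<phi> \<xi> * cnj (\<phi> \<xi>) = of_real (cmod (deriv \<phi> \<xi>))"
proof -
  note facts = smooth_self_map_facts[OF \<phi>]
  define c where "c = \<xi> * deriv \<phi> \<xi> * cnj (\<phi> \<xi>)"
  have d: "(\<phi> has_field_derivative deriv \<phi> \<xi>) (at \<xi>)" using facts(4)[of \<xi>] \<xi> by auto
  have nn: "cnj (\<phi> \<xi>) * \<phi> \<xi> = 1" using complex_norm_square[of "\<phi> \<xi>"] \<xi>(2) by (simp add: mult.commute)
  have le: "Re (cnj (\<phi> \<xi>) * \<phi> z) \<le> Re (cnj (\<phi> \<xi>) * \<phi> \<xi>)" if "z \<in> cball 0 1" for z
  proof -
    have "Re (cnj (\<phi> \<xi>) * \<phi> z) \<le> cmod (\<phi> \<xi>) * cmod (\<phi> z)"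
      using complex_Re_le_cmod[of "cnj (\<phi> \<xi>) * \<phi> z"] by (simp add: norm_mult)
    also have "\<dots> \<le> 1" using facts(5)[OF that] \<xi>(2) by simp
    finally show ?thesis unfolding nn by simp
  qed
  have ReD: "((\<lambda>x. Re (F (complex_of_real x))) has_real_derivative Re D) (at a)"
    if "(F has_field_derivative D) (at (complex_of_real a))" for F D a
    using has_vector_derivative_real_field[OF that, of UNIV]
    by (simp add: has_vector_derivative_complex_iff)
  have "((\<lambda>s. cnj (\<phi> \<xi>) * \<phi> (\<xi> * exp (\<i> * s))) has_field_derivative \<i> * c) (at (complex_of_real 0))"
  proof -
    have "((\<lambda>s. \<xi> * exp (\<i> * s)) has_field_derivative \<xi> * \<i>) (at 0)"
      by (auto intro!: derivative_eq_intros)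
    moreover have "(\<phi> has_field_derivative deriv \<phi> \<xi>) (at (\<xi> * exp (\<i> * 0)))" using d by simp
    ultimately have "((\<lambda>s. \<phi> (\<xi> * exp (\<i> * s))) has_field_derivative deriv \<phi> \<xi> * (\<xi> * \<i>)) (at 0)"
      by (rule DERIV_chain2[rotated])
    from DERIV_cmult[OF this, of "cnj (\<phi> \<xi>)"] show ?thesis by (simp add: c_def mult_ac)
  qed
  then have "((\<lambda>x. Re (cnj (\<phi> \<xi>) * \<phi> (\<xi> * exp (\<i> * complex_of_real x)))) has_real_derivative Re (\<i> * c)) (at 0)"
    by (rule ReD)
  then have "Re (\<i> * c) = 0"
  proof (rule DERIV_local_max[of _ _ _ 1])
    show "\<forall>y. \<bar>0 - y\<bar> < 1 \<longrightarrow> Re (cnj (\<phi> \<xi>) * \<phi> (\<xi> * exp (\<i> * complex_of_real y)))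
        \<le> Re (cnj (\<phi> \<xi>) * \<phi> (\<xi> * exp (\<i> * complex_of_real 0)))"
    proof (intro allI impI)
      fix y :: real
      have "\<xi> * exp (\<i> * complex_of_real y) \<in> cball 0 1" using \<xi>(1) by (simp add: norm_mult)
      from le[OF this] show "Re (cnj (\<phi> \<xi>) * \<phi> (\<xi> * exp (\<i> * complex_of_real y)))
        \<le> Re (cnj (\<phi> \<xi>) * \<phi> (\<xi> * exp (\<i> * complex_of_real 0)))" by simp
    qed
  qed simp
  then have Im: "Im c = 0" by simp
  have "((\<lambda>s. cnj (\<phi> \<xi>) * \<phi> (s * \<xi>)) has_field_derivative c) (at (complex_of_real 1))"
  proof -
    have "((\<lambda>s. s * \<xi>) has_field_derivative \<xi>) (at 1)" by (auto intro!: derivative_eq_intros)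
    moreover have "(\<phi> has_field_derivative deriv \<phi> \<xi>) (at (1 * \<xi>))" using d by simp
    ultimately have "((\<lambda>s. \<phi> (s * \<xi>)) has_field_derivative deriv \<phi> \<xi> * \<xi>) (at 1)"
      by (rule DERIV_chain2[rotated])
    from DERIV_cmult[OF this, of "cnj (\<phi> \<xi>)"] show ?thesis by (simp add: c_def mult_ac)
  qed
  then have rd: "((\<lambda>x. Re (cnj (\<phi> \<xi>) * \<phi> (complex_of_real x * \<xi>))) has_real_derivative Re c) (at 1)"
    by (rule ReD)
  have Re: "0 \<le> Re c"
  proof (rule ccontr)
    assume "\<not> 0 \<le> Re c"
    then obtain \<delta> where \<delta>: "\<delta> > 0" "\<And>h. h > 0 \<Longrightarrow> h < \<delta> \<Longrightarrow>
        Re (cnj (\<phi> \<xi>) * \<phi> (complex_of_real 1 * \<xi>)) < Re (cnj (\<phi> \<xi>) * \<phi> (complex_of_real (1 - h) * \<xi>))"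
      using DERIV_neg_dec_left[OF rd] by (auto simp: not_le)
    define h where "h = min (\<delta> / 2) (1 / 2)"
    have h: "h > 0" "h < \<delta>" "h \<le> 1 / 2" using \<delta>(1) by (auto simp: h_def)
    have "cmod (complex_of_real (1 - h) * \<xi>) \<le> 1"
      unfolding norm_mult norm_of_real using h \<xi>(1) by simp
    then have "complex_of_real (1 - h) * \<xi> \<in> cball 0 1" by simp
    from le[OF this] \<delta>(2)[OF h(1,2)] show False by simp
  qed
  have "c = of_real (Re c)" using Im by (simp add: complex_eq_iff)
  moreover have "cmod c = cmod (deriv \<phi> \<xi>)" using \<xi> by (simp add: c_def norm_mult)
  moreover have "cmod c = Re c" using Im Re by (simp add: cmod_def)
  ultimately show ?thesis unfolding c_def by simp
qed

text \<open>
  If \<open>\<xi>\<close> is approached with the radial step \<open>t / |\<phi>' \<xi>|\<close> then, to first order, the image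
  approaches \<open>\<phi> \<xi>\<close> along its radius with step \<open>t\<close>. Thus the images under two maps with a
  common contact value can be synchronized.
\<close>

lemma radial_approach:
  assumes \<phi>: "smooth_self_map \<phi>" and \<xi>: "\<xi> \<in> sphere 0 1" "\<phi> \<xi> \<in> sphere 0 1"
    and t: "t \<longlonglongrightarrow> 0" "\<And>n. t n > 0"
  shows "(\<lambda>n. (\<phi> (of_real (1 - t n / cmod (deriv \<phi> \<xi>)) * \<xi>) - \<phi> \<xi>) / of_real (t n)) \<longlonglongrightarrow> - \<phi> \<xi>"
    and "(\<lambda>n. (1 - (cmod (of_real (1 - t n / cmod (deriv \<phi> \<xi>)) * \<xi>))\<^sup>2) / t n) \<longlonglongrightarrow> 2 / cmod (deriv \<phi> \<xi>)"
    and "(\<lambda>n. of_real (1 - t n / cmod (deriv \<phi> \<xi>)) * \<xi>) \<longlonglongrightarrow> \<xi>"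
proof -
  note facts = smooth_self_map_facts[OF \<phi>]
  define p where "p = cmod (deriv \<phi> \<xi>)"
  have xc: "\<xi> \<in> cball 0 1" using \<xi>(1) by auto
  have p: "p > 0" using facts(6)[OF xc] by (simp add: p_def)
  define w where "w n = of_real (1 - t n / p) * \<xi>" for n
  have "(\<lambda>n. of_real (1 - t n / p) * \<xi>) \<longlonglongrightarrow> of_real (1 - 0 / p) * \<xi>" by (intro tendsto_intros t) (use p in simp)
  then show w: "(\<lambda>n. of_real (1 - t n / cmod (deriv \<phi> \<xi>)) * \<xi>) \<longlonglongrightarrow> \<xi>" by (simp add: p_def)
  have wn: "w n \<noteq> \<xi>" for n using t(2)[of n] p \<xi>(1) by (auto simp: w_def)
  have d: "(\<phi> has_field_derivative deriv \<phi> \<xi>) (at \<xi>)" by (rule facts(4)[OF xc])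
  then have "((\<lambda>z. (\<phi> z - \<phi> \<xi>) / (z - \<xi>)) \<longlongrightarrow> deriv \<phi> \<xi>) (at \<xi>)"
    by (simp add: has_field_derivative_iff)
  moreover have "filterlim w (at \<xi>) sequentially"
  proof -
    have "w \<longlonglongrightarrow> \<xi>" unfolding w_def[abs_def] p_def by (rule w)
    then show ?thesis unfolding filterlim_at using wn by simp
  qed
  ultimately have "(\<lambda>n. (\<phi> (w n) - \<phi> \<xi>) / (w n - \<xi>)) \<longlonglongrightarrow> deriv \<phi> \<xi>"
    by (rule filterlim_compose)
  then have l: "(\<lambda>n. (\<phi> (w n) - \<phi> \<xi>) / (w n - \<xi>) * (- \<xi> / of_real p)) \<longlonglongrightarrow> deriv \<phi> \<xi> * (- \<xi> / of_real p)"
    by (rule tendsto_mult_right)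
  have eq: "(\<phi> (w n) - \<phi> \<xi>) / (w n - \<xi>) * (- \<xi> / of_real p) = (\<phi> (w n) - \<phi> \<xi>) / of_real (t n)" for n
  proof -
    have "w n - \<xi> = of_real (t n) * (- \<xi> / of_real p)" by (simp add: w_def algebra_simps)
    moreover have "- \<xi> / of_real p \<noteq> 0" using p \<xi>(1) by auto
    ultimately show ?thesis by simp
  qed
  have lim: "deriv \<phi> \<xi> * (- \<xi> / of_real p) = - \<phi> \<xi>"
  proof -
    have nn: "cnj (\<phi> \<xi>) * \<phi> \<xi> = 1" using complex_norm_square[of "\<phi> \<xi>"] \<xi>(2) by (simp add: mult.commute)
    have "\<xi> * deriv \<phi> \<xi> = \<xi> * deriv \<phi> \<xi> * (cnj (\<phi> \<xi>) * \<phi> \<xi>)" unfolding nn by simp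
    also have "\<dots> = of_real p * \<phi> \<xi>"
      using angular_derivative_positive[OF \<phi> \<xi>] by (simp add: p_def mult.assoc[symmetric])
    finally show ?thesis using p by (simp add: mult.commute)
  qed
  show "(\<lambda>n. (\<phi> (of_real (1 - t n / cmod (deriv \<phi> \<xi>)) * \<xi>) - \<phi> \<xi>) / of_real (t n)) \<longlonglongrightarrow> - \<phi> \<xi>"
    using l unfolding eq lim by (simp add: w_def p_def)
  have e2: "(1 - (cmod (w n))\<^sup>2) / t n = 2 / p - t n / p\<^sup>2" for n
  proof -
    have "(cmod (w n))\<^sup>2 = (1 - t n / p)\<^sup>2"
      unfolding w_def norm_mult norm_of_real using \<xi>(1) by simp
    then show ?thesis using t(2)[of n] p by (simp add: power2_eq_square field_simps)
  qed
  have "(\<lambda>n. 2 / p - t n / p\<^sup>2) \<longlonglongrightarrow> 2 / p - 0 / p\<^sup>2" by (intro tendsto_intros t) (use p in auto)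
  then have "(\<lambda>n. (1 - (cmod (w n))\<^sup>2) / t n) \<longlonglongrightarrow> 2 / p" unfolding e2 by simp
  then show "(\<lambda>n. (1 - (cmod (of_real (1 - t n / cmod (deriv \<phi> \<xi>)) * \<xi>))\<^sup>2) / t n) \<longlonglongrightarrow> 2 / cmod (deriv \<phi> \<xi>)"
    by (simp add: w_def p_def)
qed

context dirichlet
begin

definition nkern :: "complex \<Rightarrow> complex \<Rightarrow> complex" where
  "nkern w = (\<lambda>z. of_real (1 / nrm (kprim w)) * kprim w z)"

lemma nrm_kprim_pos: "w \<in> ball 0 1 \<Longrightarrow> 0 < nrm (kprim w)"
  using nrm_kprim[of w] moment_pos[of 0] one_minus_norm_pos[of w] by simp

lemma nkern_in_D: "w \<in> ball 0 1 \<Longrightarrow> nkern w \<in> D"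
  unfolding nkern_def by (intro scale_in kprim_in_D)

lemma nrm_nkern: "w \<in> ball 0 1 \<Longrightarrow> nrm (nkern w) = 1"
  unfolding nkern_def nrm_scale[OF kprim_in_D] norm_of_real using nrm_kprim_pos[of w] by simp

text \<open>
  The inner product with a basis function evaluates its derivative, which is bounded on
  the disc, divided by \<open>nrm (kprim w)\<close>, which tends to infinity at the circle.
\<close>

lemma nkern_weakly_null:
  assumes y: "y \<in> D" and w: "\<And>n. w n \<in> ball 0 1" "(\<lambda>n. cmod (w n)) \<longlonglongrightarrow> 1"
  shows "(\<lambda>n. dirichlet_inner \<alpha> y (nkern (w n))) \<longlonglongrightarrow> 0"
proof (rule ip_tendsto_0I[OF y nkern_in_D[OF w(1)]])
  show "nrm (nkern (w n)) \<le> 1" for n using nrm_nkern[OF w(1)] by simp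
  fix i
  define c where "c = moment 1 0 / sqrt (moment 1 0)"
  obtain B where B: "\<And>z. z \<in> ball 0 1 \<Longrightarrow> cmod (deriv (basis i) z) \<le> B"
  proof (cases i)
    case 0
    have "cmod (deriv (basis i) z) \<le> 0" if "z \<in> ball 0 1" for z
      using deriv_const_disc[OF that, of 1] 0 by simp
    then show ?thesis using that by blast
  next
    case (Suc k)
    have "cmod (deriv (basis i) z) \<le> 1 / sqrt (moment 1 k)" if z: "z \<in> ball 0 1" for z
      unfolding Suc deriv_basis[OF z] norm_mult norm_power norm_of_real
      using z moment_pos[of k] by (auto simp: abs_of_pos intro!: divide_right_mono power_le_one)
    then show ?thesis using that by blast
  qed
  have bd: "cmod (dirichlet_inner \<alpha> (basis i) (nkern (w n))) \<le> c * B * (1 - (cmod (w n))\<^sup>2) powr ((\<alpha> + 2) / 2)" for n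
  proof -
    have "dirichlet_inner \<alpha> (basis i) (nkern (w n)) = of_real (1 / nrm (kprim (w n))) * (of_real (moment 1 0) * deriv (basis i) (w n))"
      unfolding nkern_def ip_scale2[OF kprim_in_D[OF w(1)] basis_in_D] inner_kprim[OF w(1) basis_in_D] by simp
    then have "cmod (dirichlet_inner \<alpha> (basis i) (nkern (w n))) = 1 / nrm (kprim (w n)) * (moment 1 0 * cmod (deriv (basis i) (w n)))"
      using nrm_kprim_pos[OF w(1)] moment_nonneg by (simp add: norm_mult norm_divide abs_of_pos)
    also have "\<dots> \<le> 1 / nrm (kprim (w n)) * (moment 1 0 * B)"
      using nrm_kprim_pos[OF w(1), of n] moment_nonneg B[OF w(1)] by (intro mult_left_mono) auto
    also have "1 / nrm (kprim (w n)) = (1 - (cmod (w n))\<^sup>2) powr ((\<alpha> + 2) / 2) / sqrt (moment 1 0)"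
      unfolding nrm_kprim[OF w(1)] minus_divide_left[symmetric] by (simp add: powr_minus field_simps)
    finally show ?thesis by (simp add: c_def mult_ac)
  qed
  have "(\<lambda>n. c * B * (1 - (cmod (w n))\<^sup>2) powr ((\<alpha> + 2) / 2)) \<longlonglongrightarrow> c * B * 0 powr ((\<alpha> + 2) / 2)"
  proof (intro tendsto_mult tendsto_const tendsto_powr2)
    have "(\<lambda>n. 1 - (cmod (w n))\<^sup>2) \<longlonglongrightarrow> 1 - 1\<^sup>2" by (intro tendsto_intros w)
    then show "(\<lambda>n. 1 - (cmod (w n))\<^sup>2) \<longlonglongrightarrow> 0" by simp
    show "\<forall>\<^sub>F n in sequentially. 0 \<le> 1 - (cmod (w n))\<^sup>2"
      using one_minus_norm_pos[OF w(1)] by (simp add: less_imp_le)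
  qed (use alpha_pos in simp)
  then have "(\<lambda>n. c * B * (1 - (cmod (w n))\<^sup>2) powr ((\<alpha> + 2) / 2)) \<longlonglongrightarrow> 0" by simp
  then show "(\<lambda>n. dirichlet_inner \<alpha> (basis i) (nkern (w n))) \<longlonglongrightarrow> 0"
    by (rule Lim_null_comparison[rotated]) (use bd in simp)
qed

text \<open>
  The adjoint of \<open>Comp \<psi>\<close> sends kernels to kernels, so everything reduces to the value
  of a kernel and to the norms of two kernels.
\<close>

lemma operator_on_kernels:
  assumes \<phi>: "univalent \<phi>" and \<psi>: "univalent \<psi>" and W: "adjoint_pair (Comp \<psi>) W"
    and w: "w \<in> ball 0 1" and v: "v \<in> ball 0 1"
  shows "cmod (dirichlet_inner \<alpha> (Comp \<phi> (W (nkern w))) (nkern v)) =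
    cmod (deriv \<psi> w) * cmod (deriv \<phi> v) *
    ((1 - (cmod w)\<^sup>2) * (1 - (cmod v)\<^sup>2) / (cmod (1 - cnj (\<psi> w) * \<phi> v))\<^sup>2) powr ((\<alpha> + 2) / 2)"
proof -
  have pw: "\<psi> w \<in> ball 0 1" by (rule univalent_ball[OF \<psi> w])
  have pv: "\<phi> v \<in> ball 0 1" by (rule univalent_ball[OF \<phi> v])
  have K: "kprim w \<in> D" "kprim v \<in> D" "kprim (\<psi> w) \<in> D" using w v pw by (auto intro: kprim_in_D)
  have Wb: "bounded_op W" using W by (simp add: adjoint_pair_def)
  define a where "a = 1 / nrm (kprim w)"
  define b where "b = 1 / nrm (kprim v)"
  have ab: "a > 0" "b > 0" using nrm_kprim_pos w v by (auto simp: a_def b_def)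
  have "W (nkern w) = (\<lambda>z. of_real a * W (kprim w) z)"
    unfolding nkern_def a_def by (rule bounded_op_scale[OF Wb K(1)])
  also have "\<dots> = (\<lambda>z. (of_real a * cnj (deriv \<psi> w)) * kprim (\<psi> w) z)"
    unfolding adjoint_kprim[OF \<psi> W w] by (simp add: mult.assoc)
  finally have Wn: "W (nkern w) = (\<lambda>z. (of_real a * cnj (deriv \<psi> w)) * kprim (\<psi> w) z)" .
  have "Comp \<phi> (W (nkern w)) = (\<lambda>z. (of_real a * cnj (deriv \<psi> w)) * Comp \<phi> (kprim (\<psi> w)) z)"
    unfolding Wn by (rule bounded_op_scale[OF bounded_Comp[OF \<phi>] K(3)])
  then have "dirichlet_inner \<alpha> (Comp \<phi> (W (nkern w))) (nkern v)
      = (of_real a * cnj (deriv \<psi> w)) * (of_real b * dirichlet_inner \<alpha> (Comp \<phi> (kprim (\<psi> w))) (kprim v))"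
    unfolding nkern_def[of v] b_def[symmetric]
    by (simp add: ip_scale ip_scale2 Comp_in_D[OF \<phi>] K scale_in)
  also have "dirichlet_inner \<alpha> (Comp \<phi> (kprim (\<psi> w))) (kprim v) = of_real (moment 1 0) * (ker (\<psi> w) (\<phi> v) * deriv \<phi> v)"
    unfolding inner_kprim[OF v Comp_in_D[OF \<phi> K(3)]] deriv_Comp[OF \<phi> K(3) v] deriv_kprim[OF pw pv] ..
  finally have "cmod (dirichlet_inner \<alpha> (Comp \<phi> (W (nkern w))) (nkern v))
      = a * b * moment 1 0 * (cmod (deriv \<psi> w) * cmod (deriv \<phi> v) * cmod (ker (\<psi> w) (\<phi> v)))"
    using ab moment_nonneg by (simp add: norm_mult mult_ac)
  also have "cmod (ker (\<psi> w) (\<phi> v)) = cmod (1 - cnj (\<psi> w) * \<phi> v) powr (- (\<alpha> + 2))"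
    using pv by (intro norm_ker pw) auto
  also have "a * b * moment 1 0 = ((1 - (cmod w)\<^sup>2) * (1 - (cmod v)\<^sup>2)) powr ((\<alpha> + 2) / 2)"
  proof -
    have "a = (1 - (cmod w)\<^sup>2) powr ((\<alpha> + 2) / 2) / sqrt (moment 1 0)"
      unfolding a_def nrm_kprim[OF w] minus_divide_left[symmetric] by (simp add: powr_minus field_simps)
    moreover have "b = (1 - (cmod v)\<^sup>2) powr ((\<alpha> + 2) / 2) / sqrt (moment 1 0)"
      unfolding b_def nrm_kprim[OF v] minus_divide_left[symmetric] by (simp add: powr_minus field_simps)
    ultimately show ?thesis
      using moment_pos[of 0] one_minus_norm_pos[OF w] one_minus_norm_pos[OF v]
      by (simp add: powr_mult real_sqrt_mult_self flip: real_sqrt_mult)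
  qed
  finally have e1: "cmod (dirichlet_inner \<alpha> (Comp \<phi> (W (nkern w))) (nkern v))
     = cmod (deriv \<psi> w) * cmod (deriv \<phi> v) * (((1 - (cmod w)\<^sup>2) * (1 - (cmod v)\<^sup>2)) powr ((\<alpha> + 2) / 2)
        * cmod (1 - cnj (\<psi> w) * \<phi> v) powr (- (\<alpha> + 2)))"
    by (simp add: mult_ac)
  have c: "cmod (1 - cnj (\<psi> w) * \<phi> v) > 0" using one_minus_nonzero[OF pw, of "\<phi> v"] pv by auto
  have "(x / y\<^sup>2) powr ((\<alpha> + 2) / 2) = x powr ((\<alpha> + 2) / 2) * y powr (- (\<alpha> + 2))" if "0 \<le> x" "0 < y" for x y :: real
  proof -
    have "y\<^sup>2 = y powr 2" using that by simp
    then have "(y\<^sup>2) powr ((\<alpha> + 2) / 2) = y powr (\<alpha> + 2)" by (simp only: powr_powr) (simp add: add_divide_distrib)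
    then have "(x / y\<^sup>2) powr ((\<alpha> + 2) / 2) = x powr ((\<alpha> + 2) / 2) / y powr (\<alpha> + 2)"
      by (simp only: powr_divide)
    then show ?thesis by (simp only: powr_minus divide_inverse)
  qed
  note this[OF _ c, of "(1 - (cmod w)\<^sup>2) * (1 - (cmod v)\<^sup>2)"]
  then show ?thesis unfolding e1 using one_minus_norm_pos[OF w] one_minus_norm_pos[OF v] by simp
qed

text \<open>
  Let \<open>w n\<close> and \<open>v n\<close> tend radially to \<open>\<zeta>\<close> and \<open>\<xi>\<close> with synchronized images. Then
  \<open>|1 - cnj (\<psi> (w n)) * \<phi> (v n)|\<close> is asymptotically \<open>2 * t n\<close>, whence the limit of the
  inner products of \<open>Comp \<phi> (W (nkern (w n)))\<close> with \<open>nkern (v n)\<close>. A subsequence of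
  \<open>K (nkern (w n))\<close> converges in norm, so its inner products with the weakly null
  sequence \<open>nkern (v n)\<close> tend to 0, and the limit is at most the norm bound \<open>B\<close> for the
  difference.
\<close>

lemma lower_bound:
  assumes \<phi>: "smooth_self_map \<phi>" and \<psi>: "smooth_self_map \<psi>" and W: "adjoint_pair (Comp \<psi>) W"
    and K: "\<And>f. f \<in> D \<Longrightarrow> K f \<in> D"
    and Kc: "\<And>f. (\<And>n::nat. f n \<in> D \<and> nrm (f n) \<le> 1) \<Longrightarrow>
       \<exists>y r. y \<in> D \<and> strict_mono r \<and> (\<lambda>n. nrm (\<lambda>z. K (f (r n)) z - y z)) \<longlonglongrightarrow> 0"
    and B: "\<And>f. f \<in> D \<Longrightarrow> nrm f \<le> 1 \<Longrightarrow> nrm (\<lambda>z. Comp \<phi> (W f) z - K f z) \<le> B"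
    and \<xi>: "\<xi> \<in> sphere 0 1" and \<zeta>: "\<zeta> \<in> sphere 0 1" and c: "\<phi> \<xi> = \<psi> \<zeta>" "\<phi> \<xi> \<in> sphere 0 1"
  shows "(cmod (deriv \<phi> \<xi>) * cmod (deriv \<psi> \<zeta>)) powr (- \<alpha> / 2) \<le> B"
proof -
  note f\<phi> = smooth_self_map_facts[OF \<phi>] and f\<psi> = smooth_self_map_facts[OF \<psi>]
  have u\<phi>: "univalent \<phi>" and u\<psi>: "univalent \<psi>" using \<phi> \<psi> by (auto intro: smooth_univalent)
  define p where "p = cmod (deriv \<phi> \<xi>)"
  define q where "q = cmod (deriv \<psi> \<zeta>)"
  have pq: "p > 0" "q > 0" using f\<phi>(6)[of \<xi>] f\<psi>(6)[of \<zeta>] \<xi> \<zeta> by (auto simp: p_def q_def)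
  \<comment> \<open>The step does not exceed either derivative, so \<open>w n\<close> and \<open>v n\<close> lie on the radii of \<open>\<zeta>\<close>
    and \<open>\<xi>\<close>.\<close>
  define t where "t n = min p q / real (n + 1)" for n
  have t0: "t n > 0" "t n \<le> p" "t n \<le> q" for n
  proof -
    have "t n \<le> min p q / 1" unfolding t_def using pq by (intro divide_left_mono) auto
    then show "t n \<le> p" "t n \<le> q" by auto
    show "t n > 0" using pq by (simp add: t_def)
  qed
  have t: "t \<longlonglongrightarrow> 0" unfolding t_def by real_asymp
  define w where "w n = of_real (1 - t n / q) * \<zeta>" for n
  define v where "v n = of_real (1 - t n / p) * \<xi>" for n
  have cw: "cmod (w n) = 1 - t n / q" and cv: "cmod (v n) = 1 - t n / p" for n
    unfolding w_def v_def norm_mult norm_of_real using t0[of n] pq \<xi> \<zeta> by (auto simp: divide_le_eq)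
  have wb: "w n \<in> ball 0 1" and vb: "v n \<in> ball 0 1" for n
    using cw[of n] cv[of n] t0[of n] pq by auto
  have \<psi>c: "\<psi> \<zeta> \<in> sphere 0 1" using c by simp
  note r\<phi> = radial_approach[OF \<phi> \<xi> c(2) t t0(1), folded p_def, folded v_def]
  note r\<psi> = radial_approach[OF \<psi> \<zeta> \<psi>c t t0(1), folded q_def, folded w_def]
  define \<eta> where "\<eta> = \<phi> \<xi>"
  have \<eta>: "cnj \<eta> * \<eta> = 1" using complex_norm_square[of \<eta>] c(2) by (simp add: \<eta>_def mult.commute)
  have \<phi>v: "(\<lambda>n. \<phi> (v n)) \<longlonglongrightarrow> \<eta>"
  proof -
    have "isCont \<phi> \<xi>" using f\<phi>(4)[of \<xi>] \<xi> DERIV_isCont by auto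
    then show ?thesis unfolding \<eta>_def using r\<phi>(3) by (rule isCont_tendsto_compose)
  qed
  have \<psi>w: "(\<lambda>n. \<psi> (w n)) \<longlonglongrightarrow> \<eta>"
  proof -
    have "isCont \<psi> \<zeta>" using f\<psi>(4)[of \<zeta>] \<zeta> DERIV_isCont by auto
    then show ?thesis unfolding \<eta>_def c(1) using r\<psi>(3) by (rule isCont_tendsto_compose)
  qed
  \<comment> \<open>Both images approach \<open>\<eta>\<close> along its radius with step \<open>t n\<close>, to first order.\<close>
  have den: "(\<lambda>n. (1 - cnj (\<psi> (w n)) * \<phi> (v n)) / of_real (t n)) \<longlonglongrightarrow> 2"
  proof -
    have "(1 - cnj (\<psi> (w n)) * \<phi> (v n)) / of_real (t n)
        = - (cnj ((\<psi> (w n) - \<eta>) / of_real (t n)) * \<eta>) - cnj (\<psi> (w n)) * ((\<phi> (v n) - \<eta>) / of_real (t n))" for n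
    proof -
      have "1 - cnj (\<psi> (w n)) * \<phi> (v n) = - (cnj (\<psi> (w n) - \<eta>) * \<eta>) - cnj (\<psi> (w n)) * (\<phi> (v n) - \<eta>)"
        using \<eta> by (simp add: algebra_simps)
      then show ?thesis using t0(1)[of n] by (simp add: field_simps)
    qed
    moreover have "(\<lambda>n. - (cnj ((\<psi> (w n) - \<eta>) / of_real (t n)) * \<eta>) - cnj (\<psi> (w n)) * ((\<phi> (v n) - \<eta>) / of_real (t n)))
        \<longlonglongrightarrow> - (cnj (- \<eta>) * \<eta>) - cnj \<eta> * (- \<eta>)"
      using r\<psi>(1) r\<phi>(1) unfolding c(1)[symmetric] \<eta>_def[symmetric] by (intro tendsto_intros \<psi>w)
    moreover have "- (cnj (- \<eta>) * \<eta>) - cnj \<eta> * (- \<eta>) = 2" using \<eta> by simp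
    ultimately show ?thesis by simp
  qed
  define x where "x n = (1 - (cmod (w n))\<^sup>2) * (1 - (cmod (v n))\<^sup>2) / (cmod (1 - cnj (\<psi> (w n)) * \<phi> (v n)))\<^sup>2" for n
  have xlim: "x \<longlonglongrightarrow> 1 / (p * q)"
  proof -
    have "(\<lambda>n. ((1 - (cmod (w n))\<^sup>2) / t n) * ((1 - (cmod (v n))\<^sup>2) / t n) / (cmod ((1 - cnj (\<psi> (w n)) * \<phi> (v n)) / of_real (t n)))\<^sup>2)
        \<longlonglongrightarrow> (2 / q) * (2 / p) / (cmod 2)\<^sup>2"
      by (intro tendsto_intros r\<phi>(2) r\<psi>(2) den) simp
    moreover have "((1 - (cmod (w n))\<^sup>2) / t n) * ((1 - (cmod (v n))\<^sup>2) / t n) / (cmod ((1 - cnj (\<psi> (w n)) * \<phi> (v n)) / of_real (t n)))\<^sup>2 = x n" for n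
      using t0(1)[of n] by (simp add: x_def norm_divide power_divide power2_eq_square)
    ultimately show ?thesis by (simp add: mult.commute)
  qed
  have dlim: "(\<lambda>n. deriv \<psi> (w n)) \<longlonglongrightarrow> deriv \<psi> \<zeta>" "(\<lambda>n. deriv \<phi> (v n)) \<longlonglongrightarrow> deriv \<phi> \<xi>"
    using \<zeta> \<xi> wb vb
    by (auto intro!: continuous_on_tendsto_compose[OF f\<psi>(3) r\<psi>(3)] continuous_on_tendsto_compose[OF f\<phi>(3) r\<phi>(3)]
        simp: less_imp_le)
  have Tlim: "(\<lambda>n. cmod (dirichlet_inner \<alpha> (Comp \<phi> (W (nkern (w n)))) (nkern (v n))))
      \<longlonglongrightarrow> q * p * (1 / (p * q)) powr ((\<alpha> + 2) / 2)"
    unfolding operator_on_kernels[OF u\<phi> u\<psi> W wb vb] x_def[symmetric] q_def p_def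
    using pq by (intro tendsto_intros dlim xlim[unfolded p_def q_def]) (auto simp: p_def q_def)
  obtain y r where y: "y \<in> D" and r: "strict_mono r"
    and yl: "(\<lambda>n. nrm (\<lambda>z. K (nkern (w (r n))) z - y z)) \<longlonglongrightarrow> 0"
    using Kc[of "\<lambda>n. nkern (w n)"] nkern_in_D[OF wb] nrm_nkern[OF wb] by auto
  have rl: "filterlim r at_top sequentially" by (rule filterlim_subseq[OF r])
  have "(\<lambda>n. 1 - t n / p) \<longlonglongrightarrow> 1 - 0 / p" by (intro tendsto_intros t) (use pq in simp)
  then have "(\<lambda>n. cmod (v n)) \<longlonglongrightarrow> 1" unfolding cv by simp
  from nkern_weakly_null[OF y vb this] have yw: "(\<lambda>n. dirichlet_inner \<alpha> y (nkern (v (r n)))) \<longlonglongrightarrow> 0"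
    using rl by (rule filterlim_compose)
  have bound: "cmod (dirichlet_inner \<alpha> (Comp \<phi> (W (nkern (w (r n))))) (nkern (v (r n))))
     \<le> B + nrm (\<lambda>z. K (nkern (w (r n))) z - y z) + cmod (dirichlet_inner \<alpha> y (nkern (v (r n))))" for n
  proof -
    define f where "f = nkern (w (r n))"
    define k where "k = nkern (v (r n))"
    have f: "f \<in> D" "nrm f \<le> 1" and k: "k \<in> D" "nrm k = 1"
      using nkern_in_D[OF wb] nrm_nkern[OF wb] nkern_in_D[OF vb] nrm_nkern[OF vb] by (auto simp: f_def k_def)
    have T: "Comp \<phi> (W f) \<in> D" using W f by (intro Comp_in_D u\<phi>) (simp add: adjoint_pair_def bounded_op_in)
    have Kf: "K f \<in> D" by (rule K[OF f(1)])
    have "dirichlet_inner \<alpha> (Comp \<phi> (W f)) k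
      = dirichlet_inner \<alpha> (\<lambda>z. Comp \<phi> (W f) z - K f z) k + dirichlet_inner \<alpha> (\<lambda>z. K f z - y z) k + dirichlet_inner \<alpha> y k"
      using T Kf y k by (simp add: ip_diff)
    moreover have "cmod (dirichlet_inner \<alpha> (\<lambda>z. Comp \<phi> (W f) z - K f z) k) \<le> B"
      using cauchy_schwarz[OF diff_in[OF T Kf] k(1)] B[OF f] k(2) by simp
    moreover have "cmod (dirichlet_inner \<alpha> (\<lambda>z. K f z - y z) k) \<le> nrm (\<lambda>z. K f z - y z)"
      using cauchy_schwarz[OF diff_in[OF Kf y] k(1)] k(2) by simp
    moreover have "cmod (x + y + z) \<le> cmod x + cmod y + cmod z" for x y z :: complex
      by (rule norm_triangle_le) (simp add: norm_triangle_ineq)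
    ultimately have "cmod (dirichlet_inner \<alpha> (Comp \<phi> (W f)) k)
       \<le> B + nrm (\<lambda>z. K f z - y z) + cmod (dirichlet_inner \<alpha> y k)"
      by (smt (verit))
    then show ?thesis by (simp add: f_def k_def)
  qed
  have L1: "(\<lambda>n. B + nrm (\<lambda>z. K (nkern (w (r n))) z - y z) + cmod (dirichlet_inner \<alpha> y (nkern (v (r n))))) \<longlonglongrightarrow> B + 0 + cmod 0"
    by (intro tendsto_intros yl yw)
  have L2: "(\<lambda>n. cmod (dirichlet_inner \<alpha> (Comp \<phi> (W (nkern (w (r n))))) (nkern (v (r n)))))
      \<longlonglongrightarrow> q * p * (1 / (p * q)) powr ((\<alpha> + 2) / 2)"
    using Tlim rl by (rule filterlim_compose)
  have "q * p * (1 / (p * q)) powr ((\<alpha> + 2) / 2) \<le> B + 0 + cmod 0"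
    by (rule LIMSEQ_le[OF L2 L1]) (use bound in blast)
  moreover have "q * p * (1 / (p * q)) powr ((\<alpha> + 2) / 2) = (p * q) powr (- \<alpha> / 2)"
  proof -
    have "(1 / (p * q)) powr ((\<alpha> + 2) / 2) = (p * q) powr (- (\<alpha> + 2) / 2)"
      using pq by (simp only: minus_divide_left[symmetric] powr_minus_divide powr_divide powr_one_eq_one)
    then have "q * p * (1 / (p * q)) powr ((\<alpha> + 2) / 2) = (p * q) powr 1 * (p * q) powr (- (\<alpha> + 2) / 2)"
      using pq by (simp add: mult.commute)
    also have "\<dots> = (p * q) powr (- \<alpha> / 2)" unfolding powr_add[symmetric] by (simp add: field_simps)
    finally show ?thesis .
  qed
  ultimately show ?thesis by (simp add: p_def q_def)
qed

end

section \<open>The essential norm\<close>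

text \<open>
  A pole in the closed disc is excluded as follows: \<open>|a x + b| \<le> |c x + d|\<close> holds in the
  disc apart from the pole, hence by continuity at the pole as well, where it makes
  numerator and denominator vanish together, against \<open>a d - b c \<noteq> 0\<close>.
\<close>

lemma linear_fractional_smooth:
  assumes "linear_fractional_self_map \<phi>" shows "smooth_self_map \<phi>"
proof -
  obtain a b c d where det: "a * d - b * c \<noteq> 0" and \<phi>: "\<phi> = moebius a b c d" and im: "\<phi> ` ball 0 1 \<subseteq> ball 0 1"
    using assms by (auto simp: linear_fractional_self_map_def)
  have nz: "c * z + d \<noteq> 0" if z: "z \<in> cball 0 1" for z
  proof
    assume z0: "c * z + d = 0"
    then have d: "d = - c * z" by (simp add: eq_neg_iff_add_eq_0 add.commute)
    have c: "c \<noteq> 0" using det d by auto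
    define A where "A = {x. cmod (a * x + b) \<le> cmod (c * x + d)}"
    have "closed A" unfolding A_def by (intro closed_Collect_le continuous_intros)
    moreover have "ball 0 1 - {z} \<subseteq> A"
    proof
      fix x assume x: "x \<in> ball 0 1 - {z}"
      have "c * x + d = c * (x - z)" by (simp add: d algebra_simps)
      then have "c * x + d \<noteq> 0" using x c by simp
      moreover have "cmod (\<phi> x) < 1" using im x by (auto simp: image_subset_iff)
      ultimately show "x \<in> A" by (simp add: A_def \<phi> moebius_def norm_divide)
    qed
    moreover have "z islimpt (ball 0 1 - {z})"
    proof -
      have "z islimpt ball 0 1" using z by (simp add: islimpt_ball)
      then show ?thesis unfolding islimpt_approachable by blast
    qed
    ultimately have "z \<in> A" using closed_limpt islimpt_subset by blast
    then have "a * z + b = 0" using z0 by (simp add: A_def)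
    then have "b = - a * z" by (simp add: eq_neg_iff_add_eq_0 add.commute)
    then show False using det d by simp
  qed
  define U where "U = {z. c * z + d \<noteq> 0}"
  have U: "open U" unfolding U_def by (intro open_Collect_neq continuous_intros)
  have der: "(\<phi> has_field_derivative (a * d - b * c) / (c * z + d)\<^sup>2) (at z)" if "z \<in> U" for z
    unfolding \<phi> moebius_def using that
    by (auto intro!: derivative_eq_intros simp: U_def power2_eq_square algebra_simps)
  have "\<phi> holomorphic_on U" using der by (subst holomorphic_on_open[OF U]) blast
  moreover have "cball 0 1 \<subseteq> U" using nz by (auto simp: U_def)
  moreover have "inj_on \<phi> (ball 0 1)"
  proof (rule inj_onI)
    fix z w assume z: "z \<in> ball 0 1" and w: "w \<in> ball 0 1" and eq: "\<phi> z = \<phi> w"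
    have n: "c * z + d \<noteq> 0" "c * w + d \<noteq> 0" using nz[of z] nz[of w] z w by auto
    have "(a * z + b) * (c * w + d) = (a * w + b) * (c * z + d)"
      using eq n by (simp add: \<phi> moebius_def frac_eq_eq)
    then have "(a * d - b * c) * (z - w) = 0" by (simp add: algebra_simps)
    then show "z = w" using det by simp
  qed
  moreover have "deriv \<phi> z \<noteq> 0" if "z \<in> cball 0 1" for z
    using DERIV_imp_deriv[OF der, of z] nz[OF that] det by (simp add: U_def)
  ultimately show ?thesis using U im unfolding smooth_self_map_def by blast
qed

context dirichlet
begin

text \<open>
  Adjoints are unique, so the definite description denotes \<open>W g\<close>.
\<close>

lemma adjoint_operator_Comp:
  assumes W: "adjoint_pair (Comp \<psi>) W" and g: "g \<in> D"
  shows "adjoint_operator \<alpha> (Comp \<psi>) g = W g"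
  unfolding adjoint_operator_def
proof (rule the_equality)
  show Wg: "W g \<in> D \<and> (\<forall>f\<in>D. dirichlet_inner \<alpha> (Comp \<psi> f) g = dirichlet_inner \<alpha> f (W g))"
    using W g by (simp add: adjoint_pair_def bounded_op_in)
  fix h assume "h \<in> D \<and> (\<forall>f\<in>D. dirichlet_inner \<alpha> (Comp \<psi> f) g = dirichlet_inner \<alpha> f h)"
  then show "h = W g" using Wg by (intro ip_eqI) auto
qed

lemma compact_operator_iff:
  "compact_operator \<alpha> K \<longleftrightarrow> linear_operator \<alpha> K \<and>
     compactin (Metric_space.mtopology D (\<lambda>f g. nrm (\<lambda>z. f z - g z)))
       (Metric_space.mtopology D (\<lambda>f g. nrm (\<lambda>z. f z - g z)) closure_of (K ` {f \<in> D. nrm f \<le> 1}))"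
  unfolding compact_operator_def Let_def dist_eq nrm_eq[abs_def, symmetric] ..

text \<open>
  The passage from tails to the infimum over compact operators. The operators \<open>T\<close> after
  \<open>P N\<close> are compact and differ from \<open>T\<close> by \<open>T\<close> after \<open>R N\<close>, so a bound on tails is an
  upper bound. A lower bound holds if it holds for every bound \<open>B\<close> of \<open>T - K\<close> on the
  unit ball, with \<open>K\<close> only assumed to have the subsequence property of a compact
  operator.
\<close>

lemma essential_norm_bounds:
  assumes T: "bounded_op T" and T': "\<forall>f\<in>D. T' f = T f"
  shows "0 \<le> essential_norm \<alpha> T'"
    and "\<And>m. 0 \<le> m \<Longrightarrow> ess_le T m \<Longrightarrow> essential_norm \<alpha> T' \<le> m"
    and "\<And>s. (\<And>K B. (\<And>f. f \<in> D \<Longrightarrow> K f \<in> D) \<Longrightarrow>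
       (\<And>f. (\<And>n::nat. f n \<in> D \<and> nrm (f n) \<le> 1) \<Longrightarrow>
         \<exists>y r. y \<in> D \<and> strict_mono r \<and> (\<lambda>n. nrm (\<lambda>z. K (f (r n)) z - y z)) \<longlonglongrightarrow> 0) \<Longrightarrow>
       (\<And>f. f \<in> D \<Longrightarrow> nrm f \<le> 1 \<Longrightarrow> nrm (\<lambda>z. T f z - K f z) \<le> B) \<Longrightarrow> s \<le> B) \<Longrightarrow> s \<le> essential_norm \<alpha> T'"
proof -
  define NS where "NS K = {nrm (\<lambda>z. T f z - K f z) |f. f \<in> D \<and> nrm f \<le> 1}" for K
  have on: "operator_norm \<alpha> (\<lambda>f z. T' f z - K f z) = Sup (NS K)" for K
    unfolding operator_norm_def NS_def nrm_eq[symmetric] using T' by (intro arg_cong[where f = Sup]) force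
  have en: "essential_norm \<alpha> T' = Inf {Sup (NS K) |K. compact_operator \<alpha> K}"
    unfolding essential_norm_def on ..
  have KD: "K f \<in> D" if "compact_operator \<alpha> K" "f \<in> D" for K f
    using that by (auto simp: compact_operator_def linear_operator_def)
  have bdd: "bdd_above (NS K)" if K: "compact_operator \<alpha> K" for K
  proof -
    obtain C where C: "\<And>g. g \<in> K ` {f \<in> D. nrm f \<le> 1} \<Longrightarrow> nrm g \<le> C"
      using compact_image_bounded[OF metric_space_D] K KD[OF K] unfolding compact_operator_iff
      by (metis (no_types, lifting) image_subsetI mem_Collect_eq)
    obtain M where M: "M > 0" "\<And>f. f \<in> D \<Longrightarrow> nrm (T f) \<le> M * nrm f" using bounded_op_bound[OF T] by blast
    show ?thesis
    proof (rule bdd_aboveI[of _ "M + C"])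
      fix x assume "x \<in> NS K"
      then obtain f where f: "f \<in> D" "nrm f \<le> 1" "x = nrm (\<lambda>z. T f z - K f z)" by (auto simp: NS_def)
      have "x \<le> nrm (T f) + nrm (K f)"
        unfolding f(3) by (rule nrm_triangle_diff[OF bounded_op_in[OF T f(1)] KD[OF K f(1)]])
      moreover have "nrm (T f) \<le> M * 1"
        using order_trans[OF M(2)[OF f(1)] mult_left_mono[OF f(2), of M]] M(1) by simp
      moreover have "nrm (K f) \<le> C" using C f by blast
      ultimately show "x \<le> M + C" by simp
    qed
  qed
  have upper: "nrm (\<lambda>z. T f z - K f z) \<le> Sup (NS K)" if "compact_operator \<alpha> K" "f \<in> D" "nrm f \<le> 1" for K f
    by (rule cSup_upper[OF _ bdd[OF that(1)]]) (use that in \<open>auto simp: NS_def\<close>)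
  have nonneg: "0 \<le> Sup (NS K)" if K: "compact_operator \<alpha> K" for K
    using upper[OF K zero_in] nrm_zero nrm_nonneg[OF diff_in[OF bounded_op_in[OF T zero_in] KD[OF K zero_in]]] by simp
  have compactP: "compact_operator \<alpha> (\<lambda>f. T (P N f))" for N
    unfolding compact_operator_iff
  proof
    have TP: "bounded_op (\<lambda>f. T (P N f))" by (rule bounded_op_comp[OF T bounded_op_P])
    show "linear_operator \<alpha> (\<lambda>f. T (P N f))"
      unfolding linear_operator_def using bounded_op_in[OF TP] bounded_op_lincomb[OF TP] by blast
  qed (rule finite_rank_compact[OF metric_space_D T])
  have ne: "{Sup (NS K) |K. compact_operator \<alpha> K} \<noteq> {}" using compactP by blast
  show "0 \<le> essential_norm \<alpha> T'" unfolding en using nonneg by (intro cInf_greatest[OF ne]) auto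
  show "essential_norm \<alpha> T' \<le> m" if m: "0 \<le> m" "ess_le T m" for m
  proof (rule field_le_epsilon)
    fix \<epsilon> :: real assume \<epsilon>: "\<epsilon> > 0"
    then obtain N where N: "\<forall>f\<in>D. nrm (T (R N f)) \<le> (m + \<epsilon>) * nrm f" using m(2) by (auto simp: ess_le_def)
    have "essential_norm \<alpha> T' \<le> Sup (NS (\<lambda>f. T (P N f)))"
      unfolding en using nonneg by (intro cInf_lower) (auto intro!: compactP bdd_belowI[of _ 0])
    also have "\<dots> \<le> m + \<epsilon>"
    proof (rule cSup_least)
      show "NS (\<lambda>f. T (P N f)) \<noteq> {}" using zero_in nrm_zero by (auto simp: NS_def intro!: exI[of _ "\<lambda>z. 0"])
      fix x assume "x \<in> NS (\<lambda>f. T (P N f))"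
      then obtain f where f: "f \<in> D" "nrm f \<le> 1" "x = nrm (\<lambda>z. T f z - T (P N f) z)" by (auto simp: NS_def)
      have "x = nrm (T (R N f))" unfolding f(3) R_def by (subst bounded_op_diff[OF T f(1) P_in]) (rule refl)
      also have "\<dots> \<le> (m + \<epsilon>) * nrm f" using N f(1) by blast
      also have "\<dots> \<le> (m + \<epsilon>) * 1" using f(2) m(1) \<epsilon> by (intro mult_left_mono) auto
      finally show "x \<le> m + \<epsilon>" by simp
    qed
    finally show "essential_norm \<alpha> T' \<le> m + \<epsilon>" .
  qed
  show "s \<le> essential_norm \<alpha> T'" if s: "\<And>K B. (\<And>f. f \<in> D \<Longrightarrow> K f \<in> D) \<Longrightarrow>
       (\<And>f. (\<And>n::nat. f n \<in> D \<and> nrm (f n) \<le> 1) \<Longrightarrow>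
         \<exists>y r. y \<in> D \<and> strict_mono r \<and> (\<lambda>n. nrm (\<lambda>z. K (f (r n)) z - y z)) \<longlonglongrightarrow> 0) \<Longrightarrow>
       (\<And>f. f \<in> D \<Longrightarrow> nrm f \<le> 1 \<Longrightarrow> nrm (\<lambda>z. T f z - K f z) \<le> B) \<Longrightarrow> s \<le> B" for s
    unfolding en
  proof (rule cInf_greatest[OF ne])
    fix x assume "x \<in> {Sup (NS K) |K. compact_operator \<alpha> K}"
    then obtain K where K: "compact_operator \<alpha> K" "x = Sup (NS K)" by blast
    have cK: "compactin (Metric_space.mtopology D (\<lambda>f g. nrm (\<lambda>z. f z - g z)))
       (Metric_space.mtopology D (\<lambda>f g. nrm (\<lambda>z. f z - g z)) closure_of (K ` {f \<in> D. nrm f \<le> 1}))"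
      using K(1) unfolding compact_operator_iff by blast
    have sub: "K ` {f \<in> D. nrm f \<le> 1} \<subseteq> D" using KD[OF K(1)] by blast
    show "s \<le> x" unfolding K(2)
    proof (rule s[of K])
      show "K f \<in> D" if "f \<in> D" for f by (rule KD[OF K(1) that])
      show "nrm (\<lambda>z. T f z - K f z) \<le> Sup (NS K)" if "f \<in> D" "nrm f \<le> 1" for f by (rule upper[OF K(1) that])
      fix f :: "nat \<Rightarrow> complex \<Rightarrow> complex" assume f: "\<And>n. f n \<in> D \<and> nrm (f n) \<le> 1"
      have "K (f n) \<in> K ` {f \<in> D. nrm f \<le> 1}" for n using f[of n] by blast
      from compact_image_subsequence[OF metric_space_D cK, of "\<lambda>n. K (f n)", OF this sub]
      show "\<exists>y r. y \<in> D \<and> strict_mono r \<and> (\<lambda>n. nrm (\<lambda>z. K (f (r n)) z - y z)) \<longlonglongrightarrow> 0" by metis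
    qed
  qed
qed

end

theorem theorem5p10:
  fixes \<alpha> :: real and \<phi> \<psi> :: "complex \<Rightarrow> complex"
  assumes "\<alpha> > 0"
    and "linear_fractional_self_map \<phi>"
    and "linear_fractional_self_map \<psi>"
  defines "e \<equiv> essential_norm \<alpha>
      (composition_operator \<phi> \<circ> adjoint_operator \<alpha> (composition_operator \<psi>))"
    and "S \<equiv> {(norm (deriv \<phi> \<xi>) * norm (deriv \<psi> \<zeta>)) powr (- \<alpha>) |\<xi> \<zeta>.
      \<xi> \<in> sphere 0 1 \<and> \<zeta> \<in> sphere 0 1 \<and> \<phi> \<xi> = \<psi> \<zeta> \<and> \<phi> \<xi> \<in> sphere 0 1}"
  shows "if \<phi> ` sphere 0 1 \<inter> \<psi> ` sphere 0 1 \<inter> sphere 0 1 = {}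
    then e\<^sup>2 = 0
    else e\<^sup>2 \<in> S \<and> (\<forall>s\<in>S. s \<le> e\<^sup>2)"
proof -
  interpret dirichlet \<alpha> by standard (rule assms(1))
  have \<phi>: "smooth_self_map \<phi>" and \<psi>: "smooth_self_map \<psi>" using assms linear_fractional_smooth by auto
  note f\<phi> = smooth_self_map_facts[OF \<phi>] and f\<psi> = smooth_self_map_facts[OF \<psi>]
  have u\<phi>: "univalent \<phi>" and u\<psi>: "univalent \<psi>" using \<phi> \<psi> by (auto intro: smooth_univalent)
  obtain W where W: "adjoint_pair (Comp \<psi>) W" using adjoint_pair_exists[OF bounded_Comp[OF u\<psi>]] by blast
  define T where "T = (\<lambda>f. Comp \<phi> (W f))"
  have T: "bounded_op T" unfolding T_def
    using W by (intro bounded_op_comp[OF bounded_Comp[OF u\<phi>]]) (simp add: adjoint_pair_def)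
  have T': "\<forall>f\<in>D. (composition_operator \<phi> \<circ> adjoint_operator \<alpha> (composition_operator \<psi>)) f = T f"
    by (simp add: T_def adjoint_operator_Comp[OF W])
  note bounds = essential_norm_bounds[OF T T', folded e_def]
  define C where "C = {x \<in> sphere 0 1 \<times> sphere 0 1. \<phi> (fst x) = \<psi> (snd x) \<and> \<phi> (fst x) \<in> sphere 0 1}"
  \<comment> \<open>The estimates bound \<open>e\<close> itself, so \<open>g\<close> gives the square roots of the elements of \<open>S\<close>.\<close>
  define g where "g x = (cmod (deriv \<phi> (fst x)) * cmod (deriv \<psi> (snd x))) powr (- \<alpha> / 2)" for x
  have S: "S = (\<lambda>x. (g x)\<^sup>2) ` C"
  proof (intro set_eqI iffI)
    fix s assume "s \<in> S"
    then obtain \<xi> \<zeta> where x: "(\<xi>, \<zeta>) \<in> C" and s: "s = (norm (deriv \<phi> \<xi>) * norm (deriv \<psi> \<zeta>)) powr (- \<alpha>)"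
      unfolding S_def C_def mem_Collect_eq by (metis SigmaI fst_conv snd_conv)
    have "s = (g (\<xi>, \<zeta>))\<^sup>2" unfolding s g_def powr_half_square fst_conv snd_conv ..
    then show "s \<in> (\<lambda>x. (g x)\<^sup>2) ` C" using x by blast
  next
    fix s assume "s \<in> (\<lambda>x. (g x)\<^sup>2) ` C"
    then obtain x where x: "x \<in> C" "s = (g x)\<^sup>2" by blast
    then show "s \<in> S" unfolding S_def g_def C_def powr_half_square mem_Collect_eq by (metis SigmaE mem_Sigma_iff fst_conv snd_conv)
  qed
  have lower: "g x \<le> e" if "x \<in> C" for x
  proof (rule bounds(3))
    fix K B
    assume K: "\<And>f. f \<in> D \<Longrightarrow> K f \<in> D"
      and Kc: "\<And>f. (\<And>n::nat. f n \<in> D \<and> nrm (f n) \<le> 1) \<Longrightarrow>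
         \<exists>y r. y \<in> D \<and> strict_mono r \<and> (\<lambda>n. nrm (\<lambda>z. K (f (r n)) z - y z)) \<longlonglongrightarrow> 0"
      and B: "\<And>f. f \<in> D \<Longrightarrow> nrm f \<le> 1 \<Longrightarrow> nrm (\<lambda>z. T f z - K f z) \<le> B"
    have x: "fst x \<in> sphere 0 1" "snd x \<in> sphere 0 1" "\<phi> (fst x) = \<psi> (snd x)" "\<phi> (fst x) \<in> sphere 0 1"
      using that by (auto simp: C_def)
    show "g x \<le> B" unfolding g_def by (rule lower_bound[OF \<phi> \<psi> W K Kc B[unfolded T_def] x])
  qed
  have upper: "e \<le> m" if m: "0 \<le> m" "\<And>x. x \<in> C \<Longrightarrow> g x \<le> m" for m
  proof (rule bounds(2)[OF m(1)])
    show "ess_le T m" unfolding T_def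
    proof (rule upper_bound[OF \<phi> \<psi> W m(1)])
      fix \<xi> \<zeta> assume "\<xi> \<in> sphere 0 1" "\<zeta> \<in> sphere 0 1" "\<phi> \<xi> = \<psi> \<zeta>" "\<phi> \<xi> \<in> sphere 0 1"
      then have "(\<xi>, \<zeta>) \<in> C" by (simp add: C_def)
      from m(2)[OF this] show "cmod (deriv \<psi> \<zeta>) powr (- \<alpha> / 2) * cmod (deriv \<phi> \<xi>) powr (- \<alpha> / 2) \<le> m"
        by (simp add: g_def powr_mult mult.commute)
    qed
  qed
  have Cempty: "C = {} \<longleftrightarrow> \<phi> ` sphere 0 1 \<inter> \<psi> ` sphere 0 1 \<inter> sphere 0 1 = {}"
  proof
    assume C0: "C = {}"
    { fix \<xi> \<zeta> assume "\<xi> \<in> sphere 0 1" "\<zeta> \<in> sphere 0 1" "\<phi> \<xi> = \<psi> \<zeta>" "\<phi> \<xi> \<in> sphere 0 1"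
      then have "(\<xi>, \<zeta>) \<in> C" by (simp add: C_def) }
    then show "\<phi> ` sphere 0 1 \<inter> \<psi> ` sphere 0 1 \<inter> sphere 0 1 = {}" unfolding C0 by blast
  next
    assume E: "\<phi> ` sphere 0 1 \<inter> \<psi> ` sphere 0 1 \<inter> sphere 0 1 = {}"
    { fix x assume "x \<in> C"
      then have x: "fst x \<in> sphere 0 1" "snd x \<in> sphere 0 1" "\<phi> (fst x) = \<psi> (snd x)" "\<phi> (fst x) \<in> sphere 0 1"
        by (auto simp: C_def)
      have "\<phi> (fst x) \<in> \<phi> ` sphere 0 1" "\<phi> (fst x) \<in> \<psi> ` sphere 0 1"
        using imageI[OF x(1), of \<phi>] imageI[OF x(2), of \<psi>] unfolding x(3)[symmetric] .
      then have False using E x(4) by blast }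
    then show "C = {}" by blast
  qed
  show ?thesis
  proof (cases "C = {}")
    case True
    have "e = 0" using upper[of 0] bounds(1) True by simp
    then show ?thesis using True Cempty by simp
  next
    case False
    have sc: "sphere 0 1 \<subseteq> cball (0::complex) 1" by auto
    have c\<phi>: "continuous_on (sphere 0 1 \<times> sphere 0 1) (\<lambda>x. \<phi> (fst x))"
      by (rule continuous_on_compose2[OF f\<phi>(2)]) (use sc in \<open>auto intro!: continuous_intros\<close>)
    have c\<psi>: "continuous_on (sphere 0 1 \<times> sphere 0 1) (\<lambda>x. \<psi> (snd x))"
      by (rule continuous_on_compose2[OF f\<psi>(2)]) (use sc in \<open>auto intro!: continuous_intros\<close>)
    have d\<phi>: "continuous_on (sphere 0 1 \<times> sphere 0 1) (\<lambda>x. deriv \<phi> (fst x))"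
      by (rule continuous_on_compose2[OF f\<phi>(3)]) (use sc in \<open>auto intro!: continuous_intros\<close>)
    have d\<psi>: "continuous_on (sphere 0 1 \<times> sphere 0 1) (\<lambda>x. deriv \<psi> (snd x))"
      by (rule continuous_on_compose2[OF f\<psi>(3)]) (use sc in \<open>auto intro!: continuous_intros\<close>)
    have cp: "compact (sphere (0::complex) 1 \<times> sphere (0::complex) 1)" by (intro compact_Times compact_sphere)
    have "closedin (top_of_set (sphere 0 1 \<times> sphere 0 1))
       ((sphere 0 1 \<times> sphere 0 1) \<inter> (\<lambda>x. (\<phi> (fst x) - \<psi> (snd x), \<phi> (fst x))) -` ({0} \<times> sphere 0 1))"
      by (rule continuous_closedin_preimage) (intro continuous_intros c\<phi> c\<psi>, auto intro: closed_Times)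
    moreover have "(sphere 0 1 \<times> sphere 0 1) \<inter> (\<lambda>x. (\<phi> (fst x) - \<psi> (snd x), \<phi> (fst x))) -` ({0} \<times> sphere 0 1) = C"
      by (auto simp: C_def)
    ultimately have cC: "compact C" using closedin_compact[OF cp] by metis
    have "continuous_on (sphere 0 1 \<times> sphere 0 1) g"
      unfolding g_def using f\<phi>(6) f\<psi>(6) by (intro continuous_intros d\<phi> d\<psi>) auto
    then have "continuous_on C g" by (rule continuous_on_subset) (auto simp: C_def)
    then obtain x0 where x0: "x0 \<in> C" "\<And>x. x \<in> C \<Longrightarrow> g x \<le> g x0"
      using continuous_attains_sup[OF cC False] by blast
    have g0: "0 \<le> g x" for x by (simp add: g_def)
    have "e = g x0" using lower[OF x0(1)] upper[OF g0 x0(2)] by simp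
    then have "e\<^sup>2 \<in> S" "\<forall>s\<in>S. s \<le> e\<^sup>2" unfolding S using x0 g0 by (auto intro!: power_mono)
    then show ?thesis using False Cempty by simp
  qed
qed

end
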